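(* Suppose that for each $1\le p\le\infty$ there exists a constant $c_p>0$ such that $\widetilde m_p(\boldsymbol\alpha)\ge c_p$ for all $\boldsymbol\alpha\in\mathcal A$. Then for each $1\le p\le\infty$ there exists a constant $c_p'>0$ such that $(\deg\alpha)\cdot h_p(\alpha)\ge c_p'$ for all $\alpha\in\overline{\mathbb Q}^\times\setminus\operatorname{Tor}(\overline{\mathbb Q}^\times)$.
   Context: Let $\mathcal{G}=\overline{\mathbb{Q}}^\times/\operatorname{Tor}(\overline{\mathbb{Q}}^\times)$, a $\mathbb Q$-vector space written multiplicatively; $\boldsymbol\alpha$ is the class of $\alpha$. For $\alpha$ in a number field $K$, with $\|\cdot\|_v$ the absolute value at a place $v$ extending the usual $p$-adic/archimedean one, $h_p(\alpha)=\big(\sum_v\frac{[K_v:\mathbb Q_v]}{[K:\mathbb Q]}|\log\|\alpha\|_v|^p\big)^{1/p}$ for $1\le p<\infty$ and $h_\infty(\alpha)=\sup_v|\log\|\alpha\|_v|$; these depend only on $\boldsymbol\alpha$. Let $d(\boldsymbol\alpha)=\min_{\zeta\in\operatorname{Tor}}\deg(\zeta\alpha)$, $m_p(\boldsymbol\alpha)=d(\boldsymbol\alpha)h_p(\boldsymbol\alpha)$, and $\widetilde m_p(\boldsymbol\alpha)=\inf\sum_i|r_i|m_p(\boldsymbol\alpha_i)$ over all representations $\boldsymbol\alpha=\boldsymbol\alpha_1^{r_1}\cdots\boldsymbol\alpha_n^{r_n}$, $\boldsymbol\alpha_i\in\mathcal G$, $r_i\in\mathbb Q$. $\mathcal A$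 is the set of $\boldsymbol\alpha\ne\boldsymbol 1$ in $\mathcal G$ having a representative $\alpha$ such that: (i) $\alpha$ is an algebraic unit; (ii) $[\mathbb Q(\alpha^n):\mathbb Q]=[\mathbb Q(\alpha):\mathbb Q]$ for all $n\in\mathbb N$; (iii) for every proper subfield $F$ of $K=\mathbb Q(\alpha)$, $\operatorname{Norm}^K_F(\alpha)\in\operatorname{Tor}(F^\times)$. *)

theory Defs
  imports
    "HOL-Analysis.Analysis"
    "HOL-Algebra.Algebra"
    "HOL-Algebra.Algebraic_Closure_Type"
    "HOL-Computational_Algebra.Computational_Algebra"
begin

text \<open>
  The algebraic closure of the rationals is taken inside the complex numbers.
  Number fields are subfields of the complex numbers, represented by their carriers.
\<close>

abbreviation complex_ring :: "complex ring" where
  "complex_ring \<equiv> ring_of_type_algebra"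

definition field_degree :: "complex set \<Rightarrow> nat" where
  "field_degree K = ring.dim complex_ring \<rat> K"

definition adjoin :: "complex \<Rightarrow> complex set" where
  "adjoin \<alpha> = generate_field complex_ring {\<alpha>}"

definition alg_degree :: "complex \<Rightarrow> nat" where
  "alg_degree \<alpha> = field_degree (adjoin \<alpha>)"

definition tors :: "complex set" where
  "tors = {\<zeta>. \<exists>n>0. \<zeta> ^ n = 1}"


subsection \<open>Places and local degrees\<close>

definition padic_abs :: "nat \<Rightarrow> rat \<Rightarrow> real" where
  "padic_abs p r = (if r = 0 then 0 else
     real p powi (int (multiplicity (int p) (snd (quotient_of r)))
                  - int (multiplicity (int p) (fst (quotient_of r)))))"

definition abs_value_on :: "complex set \<Rightarrow> (complex \<Rightarrow> real) \<Rightarrow> bool" where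
  "abs_value_on K v \<longleftrightarrow>
     (\<forall>x\<in>K. 0 \<le> v x \<and> (v x = 0 \<longleftrightarrow> x = 0)) \<and>
     (\<forall>x\<in>K. \<forall>y\<in>K. v (x * y) = v x * v y \<and> v (x + y) \<le> v x + v y)"

text \<open>
  Every place of \<open>K\<close> contains exactly one absolute value extending the usual archimedean or some
  \<open>p\<close>-adic absolute value of the rationals, so a place is identified with that absolute value.
  Extensionality makes two of them equal as functions as soon as they agree on \<open>K\<close>.
\<close>

definition places :: "complex set \<Rightarrow> (complex \<Rightarrow> real) set" where
  "places K = {v \<in> extensional K. abs_value_on K v \<and>
     ((\<forall>r::rat. v (of_rat r) = \<bar>of_rat r\<bar>) \<or>
      (\<exists>p. Factorial_Ring.prime p \<and> (\<forall>r::rat. v (of_rat r) = padic_abs p r)))}"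

text \<open>
  The completion of \<open>K\<close> at \<open>v\<close> is the ring of \<open>v\<close>-Cauchy sequences in \<open>K\<close> modulo the null sequences.
  The classes of rational Cauchy sequences form the closure of the rationals in it, which is the
  completion of the rationals at the place below \<open>v\<close>.
\<close>

definition cauchy_ring :: "complex set \<Rightarrow> (complex \<Rightarrow> real) \<Rightarrow> (nat \<Rightarrow> complex) ring" where
  "cauchy_ring K v =
     \<lparr>carrier = {s. range s \<subseteq> K \<and> (\<forall>e>0. \<exists>N. \<forall>m\<ge>N. \<forall>n\<ge>N. v (s m - s n) < e)},
      monoid.mult = (\<lambda>s t n. s n * t n), one = (\<lambda>_. 1),
      ring.zero = (\<lambda>_. 0), add = (\<lambda>s t n. s n + t n)\<rparr>"

definition null_seqs :: "complex set \<Rightarrow> (complex \<Rightarrow> real) \<Rightarrow> (nat \<Rightarrow> complex) set" where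
  "null_seqs K v = {s \<in> carrier (cauchy_ring K v). (\<lambda>n. v (s n)) \<longlonglongrightarrow> 0}"

definition place_completion :: "complex set \<Rightarrow> (complex \<Rightarrow> real) \<Rightarrow> (nat \<Rightarrow> complex) set ring" where
  "place_completion K v = cauchy_ring K v Quot null_seqs K v"

definition completed_rationals :: "complex set \<Rightarrow> (complex \<Rightarrow> real) \<Rightarrow> (nat \<Rightarrow> complex) set set" where
  "completed_rationals K v =
     {null_seqs K v +>\<^bsub>cauchy_ring K v\<^esub> s | s. s \<in> carrier (cauchy_ring K v) \<and> range s \<subseteq> \<rat>}"

definition local_degree :: "complex set \<Rightarrow> (complex \<Rightarrow> real) \<Rightarrow> nat" where
  "local_degree K v =
     ring.dim (place_completion K v) (completed_rationals K v) (carrier (place_completion K v))"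


subsection \<open>Heights\<close>

definition height_in :: "complex set \<Rightarrow> ereal \<Rightarrow> complex \<Rightarrow> real" where
  "height_in K p \<alpha> =
     (if p = \<infinity> then (SUP v\<in>places K. \<bar>ln (v \<alpha>)\<bar>)
      else (\<Sum>\<^sub>\<infinity>v\<in>places K. real (local_degree K v) / real (field_degree K)
              * \<bar>ln (v \<alpha>)\<bar> powr real_of_ereal p) powr (1 / real_of_ereal p))"

text \<open>The height does not depend on the number field containing \<open>\<alpha>\<close>; the smallest one is used.\<close>

definition height :: "ereal \<Rightarrow> complex \<Rightarrow> real" where
  "height p \<alpha> = height_in (adjoin \<alpha>) p \<alpha>"


subsection \<open>The space of algebraic numbers modulo torsion\<close>

definition alg_units :: "complex monoid" where
  "alg_units = \<lparr>carrier = {x. algebraic x \<and> x \<noteq> 0}, monoid.mult = (*), one = 1\<rparr>"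

definition alg_mod_tors :: "complex set monoid" where
  "alg_mod_tors = alg_units Mod tors"

text \<open>Elements of the quotient group are cosets, i.e. the sets of all representatives.\<close>

definition class_height :: "ereal \<Rightarrow> complex set \<Rightarrow> real" where
  "class_height p C = height p (SOME \<alpha>. \<alpha> \<in> C)"

definition class_degree :: "complex set \<Rightarrow> nat" where
  "class_degree C = (LEAST n. \<exists>\<alpha>\<in>C. n = alg_degree \<alpha>)"

definition class_mahler :: "ereal \<Rightarrow> complex set \<Rightarrow> real" where
  "class_mahler p C = real (class_degree C) * class_height p C"

text \<open>The quotient group is divisible and torsion-free, so rational powers exist and are unique.\<close>

definition rat_pow :: "complex set \<Rightarrow> rat \<Rightarrow> complex set" where
  "rat_pow C r = (THE D. D \<in> carrier alg_mod_tors \<and>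
     D [^]\<^bsub>alg_mod_tors\<^esub> snd (quotient_of r) = C [^]\<^bsub>alg_mod_tors\<^esub> fst (quotient_of r))"

definition mahler_norm :: "ereal \<Rightarrow> complex set \<Rightarrow> real" where
  "mahler_norm p C = Inf {(\<Sum>i<n. \<bar>of_rat (r i)\<bar> * class_mahler p (D i)) | (n::nat) D r.
     (\<forall>i<n. D i \<in> carrier alg_mod_tors) \<and>
     C = (\<Otimes>\<^bsub>alg_mod_tors\<^esub>i\<in>{..<n}. rat_pow (D i) (r i))}"


subsection \<open>Norms and reduced classes\<close>

text \<open>The norm from \<open>K\<close> to \<open>F\<close> is the product of the images under the embeddings of \<open>K\<close> over \<open>F\<close>.\<close>

definition embeddings_over :: "complex set \<Rightarrow> complex set \<Rightarrow> (complex \<Rightarrow> complex) set" where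
  "embeddings_over F K = {\<sigma> \<in> ring_hom (complex_ring\<lparr>carrier := K\<rparr>) complex_ring.
     \<sigma> \<in> extensional K \<and> (\<forall>x\<in>F. \<sigma> x = x)}"

definition field_norm :: "complex set \<Rightarrow> complex set \<Rightarrow> complex \<Rightarrow> complex" where
  "field_norm F K \<alpha> = (\<Prod>\<sigma>\<in>embeddings_over F K. \<sigma> \<alpha>)"

definition reduced_rep :: "complex \<Rightarrow> bool" where
  "reduced_rep \<alpha> \<longleftrightarrow>
     algebraic_int \<alpha> \<and> algebraic_int (inverse \<alpha>) \<and>
     (\<forall>n>0. alg_degree (\<alpha> ^ n) = alg_degree \<alpha>) \<and>
     (\<forall>F. subfield F complex_ring \<and> F \<subset> adjoin \<alpha> \<longrightarrow> field_norm F (adjoin \<alpha>) \<alpha> \<in> F \<inter> tors)"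

definition reduced_classes :: "complex set set" where
  "reduced_classes = {C \<in> carrier alg_mod_tors. C \<noteq> \<one>\<^bsub>alg_mod_tors\<^esub> \<and> (\<exists>\<alpha>\<in>C. reduced_rep \<alpha>)}"

end

theory Submission
  imports Defs
begin

text \<open>
  Only the hypothesis for \<open>p = 1\<close> is used. If \<open>\<alpha>\<close> is not a unit, some nonarchimedean place \<open>v\<close> with
  \<open>\<parallel>\<alpha>\<parallel>\<^sub>v \<noteq> 1\<close> alone gives \<open>deg \<alpha> \<cdot> h\<^sub>p(\<alpha>) \<ge> ln 2\<close>, because \<open>ln \<parallel>\<alpha>\<parallel>\<^sub>v\<close> is a nonzero
  multiple of \<open>ln q / e\<close> with \<open>e\<close> at most the local degree. For a unit, \<open>deg \<alpha> \<cdot> h\<^sub>p(\<alpha>)\<close> dominates the sum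
  \<open>S(\<alpha>)\<close> of \<open>\<bar>ln \<bar>\<sigma>\<alpha>\<bar>\<bar>\<close> over the embeddings \<open>\<sigma>\<close> of \<open>\<rat>(\<alpha>)\<close>, by the power mean inequality. Replacing
  \<open>\<alpha>\<close> by a nontorsion norm to a proper subfield does not increase \<open>S\<close> and lowers the degree; when no such
  norm exists, \<open>\<alpha>\<close> represents a class in \<open>\<A>\<close>, whose \<open>m\<^sub>1\<close>, and hence its norm in the hypothesis, is at
  most \<open>2 S(\<alpha>)\<close>.
\<close>

hide_const (open) Polynomials.degree Polynomials.lead_coeff module.smult up_ring.monom up_ring.coeff


text \<open>Places are arbitrary absolute values and local degrees are dimensions of completions, so
  the obstacle is to tie both to embeddings. Inequalities are enough: an archimedean place comes
  from one or two embeddings, a local degree lies between 1 and the global degree, an archimedean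
  one is at most 2, and a p-adic one is at least the ramification. They cost constant factors, hence
  the constant \<open>min (ln 2) (c / 4)\<close>: one factor 2 compares S with the sum over
  archimedean places, the other bounds the local degrees in m_1. A norm does not increase S because
  the logarithm of a conjugate of the norm is the sum of the logarithms over the embeddings above
  it. For a non-unit a place has to be produced: Zorn's lemma gives a valuation ring excluding a
  nonintegral element, and the p-adic order is read off from relations x^e = p^k u with u a unit of
  that ring.\<close>

section \<open>Subrings, polynomials over them, integrality and valuation rings\<close>

definition subring_set :: "'a::comm_ring_1 set \<Rightarrow> bool" where
  "subring_set A \<longleftrightarrow> 1 \<in> A \<and> (\<forall>x\<in>A. \<forall>y\<in>A. x - y \<in> A \<and> x * y \<in> A)"

definition polys_over :: "'a::comm_ring_1 set \<Rightarrow> 'a poly set" where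
  "polys_over A = {p. \<forall>i. poly.coeff p i \<in> A}"

context
  fixes A :: "'a::comm_ring_1 set"
  assumes A: "subring_set A"
begin

lemma subring_set_1: "1 \<in> A"
  and subring_set_diff: "x \<in> A \<Longrightarrow> y \<in> A \<Longrightarrow> x - y \<in> A"
  and subring_set_mult: "x \<in> A \<Longrightarrow> y \<in> A \<Longrightarrow> x * y \<in> A"
  using A by (auto simp: subring_set_def)

lemma subring_set_0: "0 \<in> A"
  using subring_set_diff[OF subring_set_1 subring_set_1] by simp

lemma subring_set_uminus: "x \<in> A \<Longrightarrow> - x \<in> A"
  using subring_set_diff[OF subring_set_0] by force

lemma subring_set_add: "x \<in> A \<Longrightarrow> y \<in> A \<Longrightarrow> x + y \<in> A"
  using subring_set_diff[OF _ subring_set_uminus] by force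

lemma subring_set_power: "x \<in> A \<Longrightarrow> x ^ n \<in> A"
  by (induction n) (auto simp: subring_set_1 subring_set_mult)

lemma subring_set_sum: "(\<And>i. i \<in> I \<Longrightarrow> f i \<in> A) \<Longrightarrow> sum f I \<in> A"
  by (induction I rule: infinite_finite_induct) (auto simp: subring_set_0 subring_set_add)

lemma subring_set_of_nat: "of_nat n \<in> A"
  by (induction n) (auto simp: subring_set_0 subring_set_1 subring_set_add)

lemma subring_set_of_int: "of_int n \<in> A"
  by (cases n) (auto simp del: of_nat_Suc intro: subring_set_of_nat subring_set_uminus)

lemma polys_over_0: "0 \<in> polys_over A"
  by (simp add: polys_over_def subring_set_0)

lemma polys_over_1: "1 \<in> polys_over A"
  by (auto simp: polys_over_def subring_set_0 subring_set_1 coeff_1)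

lemma polys_over_pCons: "a \<in> A \<Longrightarrow> p \<in> polys_over A \<Longrightarrow> pCons a p \<in> polys_over A"
  by (auto simp: polys_over_def coeff_pCons split: nat.split)

lemma polys_over_add: "p \<in> polys_over A \<Longrightarrow> q \<in> polys_over A \<Longrightarrow> p + q \<in> polys_over A"
  by (auto simp: polys_over_def subring_set_add)

lemma polys_over_diff: "p \<in> polys_over A \<Longrightarrow> q \<in> polys_over A \<Longrightarrow> p - q \<in> polys_over A"
  by (auto simp: polys_over_def subring_set_diff)

lemma polys_over_mult: "p \<in> polys_over A \<Longrightarrow> q \<in> polys_over A \<Longrightarrow> p * q \<in> polys_over A"
  by (auto simp: polys_over_def coeff_mult intro!: subring_set_sum subring_set_mult)

lemma polys_over_smult: "a \<in> A \<Longrightarrow> p \<in> polys_over A \<Longrightarrow> smult a p \<in> polys_over A"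
  by (auto simp: polys_over_def subring_set_mult)

lemma polys_over_monom: "a \<in> A \<Longrightarrow> monom a n \<in> polys_over A"
  by (auto simp: polys_over_def subring_set_0)

lemma polys_over_coeff: "p \<in> polys_over A \<Longrightarrow> poly.coeff p i \<in> A"
  by (simp add: polys_over_def)

lemma poly_in_subring_set: "p \<in> polys_over A \<Longrightarrow> x \<in> A \<Longrightarrow> poly p x \<in> A"
  by (auto simp: poly_altdef polys_over_def intro!: subring_set_sum subring_set_mult subring_set_power)

end

lemma polys_over_mono: "A \<subseteq> B \<Longrightarrow> polys_over A \<subseteq> polys_over B"
  by (auto simp: polys_over_def)

definition ring_adjoin :: "'a::comm_ring_1 set \<Rightarrow> 'a \<Rightarrow> 'a set" where
  "ring_adjoin A y = (\<lambda>p. poly p y) ` polys_over A"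

lemma subring_ring_adjoin:
  assumes "subring_set A"
  shows "subring_set (ring_adjoin A y)"
  unfolding subring_set_def
proof (intro conjI ballI)
  have "poly 1 y \<in> ring_adjoin A y"
    unfolding ring_adjoin_def by (rule imageI) (rule polys_over_1[OF assms])
  thus "1 \<in> ring_adjoin A y" by simp
next
  fix u v assume "u \<in> ring_adjoin A y" "v \<in> ring_adjoin A y"
  then obtain p q where "u = poly p y" "p \<in> polys_over A" "v = poly q y" "q \<in> polys_over A"
    by (auto simp: ring_adjoin_def)
  thus "u - v \<in> ring_adjoin A y" "u * v \<in> ring_adjoin A y"
    unfolding ring_adjoin_def image_iff
    by (auto intro: bexI[of _ "p - q"] bexI[of _ "p * q"]
        polys_over_diff[OF assms] polys_over_mult[OF assms])
qed

lemma ring_adjoin_base: "subring_set A \<Longrightarrow> a \<in> A \<Longrightarrow> a \<in> ring_adjoin A y"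
  unfolding ring_adjoin_def image_iff
  by (rule bexI[of _ "[:a:]"]) (auto intro!: polys_over_pCons polys_over_0)

lemma ring_adjoin_gen: "subring_set A \<Longrightarrow> y \<in> ring_adjoin A y"
  unfolding ring_adjoin_def image_iff
  by (rule bexI[of _ "[:0, 1:]"]) (auto intro!: polys_over_pCons polys_over_0 simp: subring_set_0 subring_set_1)

lemma ring_adjoin_min:
  "subring_set B \<Longrightarrow> A \<subseteq> B \<Longrightarrow> y \<in> B \<Longrightarrow> ring_adjoin A y \<subseteq> B"
  by (auto simp: ring_adjoin_def intro!: poly_in_subring_set dest: subsetD[OF polys_over_mono])

definition integral_over :: "'a::comm_ring_1 set \<Rightarrow> 'a \<Rightarrow> bool" where
  "integral_over A x \<longleftrightarrow> (\<exists>p\<in>polys_over A. lead_coeff p = 1 \<and> poly p x = 0)"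

lemma reflect_polys_over:
  "subring_set A \<Longrightarrow> p \<in> polys_over A \<Longrightarrow> reflect_poly p \<in> polys_over A"
  by (auto simp: polys_over_def coeff_reflect_poly subring_set_0)

text \<open>Multiplying z = p(1/z) by z^n, with n the degree of p, turns the right side into the
  reflected polynomial at z, of degree at most n; this is a monic relation of degree n + 1. It
  supplies the starting ring for Zorn's lemma in \<open>valuation_ring_excluding\<close>.\<close>

lemma integral_if_in_ring_adjoin_inverse:
  fixes z :: "'a::field"
  assumes A: "subring_set A" and z: "z \<in> ring_adjoin A (inverse z)" "z \<noteq> 0"
  shows "integral_over A z"
proof -
  obtain p where p: "p \<in> polys_over A" "z = poly p (inverse z)"
    using z by (auto simp: ring_adjoin_def)
  define n where "n = degree p"
  define q where "q = monom 1 (Suc n) - reflect_poly p"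
  have deg: "degree (reflect_poly p) < Suc n"
    using degree_reflect_poly_le[of p] by (simp add: n_def)
  have "poly q z = z ^ Suc n - z ^ n * poly p (inverse z)"
    using z by (simp add: q_def n_def poly_monom poly_reflect_poly_nz)
  hence "poly q z = 0" using p by simp
  moreover have "q \<in> polys_over A"
    unfolding q_def using p
    by (intro polys_over_diff polys_over_monom reflect_polys_over A subring_set_1[OF A])
  moreover have "degree q = Suc n"
    unfolding q_def using deg by (subst diff_conv_add_uminus, subst degree_add_eq_left) (auto simp: degree_monom_eq)
  hence "lead_coeff q = 1"
    using deg by (simp add: q_def coeff_eq_0)
  ultimately show ?thesis unfolding integral_over_def by blast
qed

text \<open>A relation in degree \<open>n\<close> for \<open>y\<close> and one in degree \<open>m \<le> n\<close> for \<open>1/y\<close> yield a shorter one for \<open>y\<close>,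
  as \<open>1 - \<pi>c\<close> is always a unit.\<close>

lemma shorten_relation:
  fixes y w :: "'a::field"
  assumes O: "subring_set O'" and w: "w \<in> O'"
    and unit: "\<And>c. c \<in> O' \<Longrightarrow> 1 - w * c \<noteq> 0 \<and> inverse (1 - w * c) \<in> O'"
    and p: "p \<in> polys_over O'" "w * poly p y = 1"
    and q: "q \<in> polys_over O'" "w * poly q (inverse y) = 1"
    and le: "degree q \<le> degree p" and y: "y \<noteq> 0"
  shows "\<exists>p'\<in>polys_over O'. degree p' < degree p \<and> w * poly p' y = 1"
proof -
  define n m where "n = degree p" and "m = degree q"
  \<comment> \<open>A constant relation would say w a = 1, contradicting 1 - w a \<noteq> 0; so both
    degrees are positive.\<close>
  have const: False if f: "f \<in> polys_over O'" "w * poly f x = 1" "degree f = 0" for f x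
  proof -
    obtain a where "f = [:a:]" using f(3) by (auto elim: degree_eq_zeroE)
    with f unit[of a] polys_over_coeff[OF O f(1), of 0] show False by auto
  qed
  have pos: "n > 0" "m > 0"
    using const[OF p] const[OF q] by (auto simp: n_def m_def)
  define b0 u where "b0 = poly.coeff q 0" and "u = inverse (1 - w * b0)"
  have b0: "b0 \<in> O'" using q by (simp add: b0_def polys_over_def)
  have u: "u \<in> O'" "u * (1 - w * b0) = 1" using unit[OF b0] by (auto simp: u_def)
  define r where "r = reflect_poly q"
  have r: "r \<in> polys_over O'" using reflect_polys_over[OF O q(1)] by (simp add: r_def)
  have ym: "y ^ m = w * poly r y"
    using q(2) y by (simp add: r_def m_def poly_reflect_poly_nz)
  \<comment> \<open>The relation for 1/y reads y^m = w r(y), where r has coefficient b0 at degree m.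
    Moving w b0 y^m to the left and multiplying by u = 1/(1 - w b0) leaves y^m = w g(y) with g of
    degree below m.\<close>
  define g where "g = smult u (r - monom b0 m)"
  have g: "g \<in> polys_over O'"
    unfolding g_def by (intro polys_over_smult polys_over_diff polys_over_monom O u r b0)
  have g_y: "w * poly g y = y ^ m"
  proof -
    have "w * poly g y = u * (w * poly r y - w * b0 * y ^ m)"
      by (simp add: g_def poly_monom algebra_simps)
    also have "\<dots> = u * (1 - w * b0) * y ^ m" unfolding ym[symmetric] by (simp add: algebra_simps)
    finally show ?thesis using u by simp
  qed
  have deg_g: "degree g < m"
  proof -
    have "poly.coeff (r - monom b0 m) i = 0" if "i \<ge> m" for i
      using that by (cases "i = m") (auto simp: r_def coeff_reflect_poly m_def b0_def)
    hence "degree (r - monom b0 m) < m"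
      using pos by (intro degree_lessI) auto
    thus ?thesis unfolding g_def using degree_smult_le le_less_trans by blast
  qed
  define a where "a = poly.coeff p n"
  have a: "a \<in> O'" using p by (simp add: a_def polys_over_def)
  \<comment> \<open>The leading term of p is rewritten by y^n = y^(n-m) w g(y), which has lower
    degree.\<close>
  define p' where "p' = (p - monom a n) + smult (a * w) (monom 1 (n - m) * g)"
  have "p' \<in> polys_over O'"
    unfolding p'_def
    by (intro polys_over_add polys_over_diff polys_over_smult polys_over_mult polys_over_monom
        O p a g subring_set_mult[OF O] w subring_set_1[OF O])
  moreover have "w * poly p' y = w * poly p y + w * a * (y ^ (n - m) * (w * poly g y) - y ^ n)"
    by (simp add: p'_def poly_monom algebra_simps)
  hence "w * poly p' y = 1"
    using p(2) le pos by (simp add: g_y n_def m_def flip: power_add)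
  moreover have "degree p' < n"
    unfolding p'_def
  proof (rule degree_add_less)
    have "poly.coeff (p - monom a n) i = 0" if "i \<ge> n" for i
      using that by (cases "i = n") (auto simp: a_def n_def coeff_eq_0)
    thus "degree (p - monom a n) < n"
      using pos by (intro degree_lessI) auto
    have "degree (smult (a * w) (monom 1 (n - m) * g))
        \<le> degree (monom (1::'a) (n - m)) + degree g"
      by (meson degree_mult_le degree_smult_le order.trans)
    also have "\<dots> < n - m + m"
      using deg_g degree_monom_le[of "1::'a" "n - m"] by linarith
    finally show "degree (smult (a * w) (monom 1 (n - m) * g)) < n"
      using le by (simp add: n_def m_def)
  qed
  ultimately show ?thesis unfolding n_def by blast
qed

text \<open>A ring R maximal among the subrings that contain A and w = 1/z but not z works.
  Maximality puts z into R[y] for every y outside R, that is, gives a relation w p(y) = 1 over R; if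
  y and 1/y were both outside, two such relations of least degree would contradict
  \<open>shorten_relation\<close>.\<close>

theorem valuation_ring_excluding:
  fixes z :: "'a::field"
  assumes A: "subring_set A" and z: "\<not> integral_over A z" "z \<noteq> 0"
  shows "\<exists>O'. subring_set O' \<and> A \<subseteq> O' \<and> z \<notin> O' \<and> (\<forall>y. y \<in> O' \<or> inverse y \<in> O')"
proof -
  define w where "w = inverse z"
  define F where "F = {B. subring_set B \<and> A \<subseteq> B \<and> w \<in> B \<and> z \<notin> B}"
  have "\<exists>M\<in>F. \<forall>Y\<in>F. M \<subseteq> Y \<longrightarrow> Y = M"
  proof (rule subset_Zorn_nonempty)
    have "ring_adjoin A w \<in> F"
      using A z integral_if_in_ring_adjoin_inverse[OF A]
      by (auto simp: F_def w_def subring_ring_adjoin ring_adjoin_base ring_adjoin_gen)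
    thus "F \<noteq> {}" by blast
  next
    fix C assume C: "C \<noteq> {}" "subset.chain F C"
    have sub: "\<And>B. B \<in> C \<Longrightarrow> B \<in> F" using C by (auto simp: subset.chain_def)
    have "x - y \<in> \<Union>C \<and> x * y \<in> \<Union>C" if xy: "x \<in> \<Union>C" "y \<in> \<Union>C" for x y
    proof -
      obtain B1 B2 where B: "x \<in> B1" "B1 \<in> C" "y \<in> B2" "B2 \<in> C" using xy by blast
      hence "B1 \<subseteq> B2 \<or> B2 \<subseteq> B1" using C by (auto simp: subset.chain_def)
      then obtain B where "B \<in> C" "x \<in> B" "y \<in> B" using B by blast
      thus ?thesis using sub[of B] by (auto simp: F_def subring_set_def)
    qed
    moreover obtain B where "B \<in> C" using C by blast
    moreover from this have "B \<in> F" by (rule sub)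
    ultimately have "subring_set (\<Union>C)" "A \<subseteq> \<Union>C" "w \<in> \<Union>C"
      unfolding F_def subring_set_def by blast+
    moreover have "z \<notin> \<Union>C" using sub unfolding F_def by blast
    ultimately show "\<Union>C \<in> F" unfolding F_def by blast
  qed
  then obtain R where R: "R \<in> F" and max: "\<And>Y. Y \<in> F \<Longrightarrow> R \<subseteq> Y \<Longrightarrow> Y = R" by blast
  have R': "subring_set R" "A \<subseteq> R" "w \<in> R" "z \<notin> R" using R by (auto simp: F_def)
  note sr = R'(1)
  have adj: "z \<in> ring_adjoin R y" if "y \<notin> R" for y
  proof (rule ccontr)
    assume "z \<notin> ring_adjoin R y"
    hence "ring_adjoin R y \<in> F"
      using R' by (auto simp: F_def subring_ring_adjoin ring_adjoin_base)
    from max[OF this] show False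
      using ring_adjoin_gen[OF sr, of y] ring_adjoin_base[OF sr, of _ y] that by blast
  qed
  have wz: "w * z = 1" "z * w = 1" using z by (auto simp: w_def)
  have unit: "1 - w * c \<noteq> 0 \<and> inverse (1 - w * c) \<in> R" if c: "c \<in> R" for c
  proof
    show ne: "1 - w * c \<noteq> 0"
    proof
      assume "1 - w * c = 0"
      hence "z * (w * c) = z" by simp
      hence "c = z" using wz by (simp flip: mult.assoc)
      thus False using c R' by simp
    qed
    show "inverse (1 - w * c) \<in> R"
    proof (rule ccontr)
      let ?t = "1 - w * c"
      assume "inverse ?t \<notin> R"
      then obtain p where p: "p \<in> polys_over R" "z = poly p (inverse ?t)"
        using adj by (auto simp: ring_adjoin_def)
      have t: "?t \<in> R" using c R' by (simp add: subring_set_1 subring_set_diff subring_set_mult)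
      have "poly (reflect_poly p) ?t = ?t ^ degree p * z"
        using ne p by (simp add: poly_reflect_poly_nz)
      hence "z * ?t ^ degree p \<in> R"
        using poly_in_subring_set[OF sr reflect_polys_over[OF sr p(1)] t] by (simp add: mult.commute)
      \<comment> \<open>Since z w = 1, z t = z - c, so one factor t can be stripped from z t^(n+1)
        at the cost of adding c t^n, which lies in R.\<close>
      moreover have "z * ?t ^ n \<in> R \<Longrightarrow> z \<in> R" for n
      proof (induction n)
        case (Suc n)
        have "z * ?t ^ Suc n = z * ?t ^ n - (z * w) * c * ?t ^ n" by (simp add: algebra_simps)
        hence "z * ?t ^ n = z * ?t ^ Suc n + c * ?t ^ n" using wz by simp
        also have "\<dots> \<in> R"
          using Suc.prems subring_set_mult[OF sr c subring_set_power[OF sr t]]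
          by (rule subring_set_add[OF sr])
        finally show ?case by (rule Suc.IH)
      qed simp
      ultimately show False using R' by blast
    qed
  qed
  have rel: "\<exists>p\<in>polys_over R. w * poly p y = 1" if "y \<notin> R" for y
    using adj[OF that] wz by (auto simp: ring_adjoin_def)
  have "y \<in> R \<or> inverse y \<in> R" for y
  proof (rule ccontr)
    assume "\<not> (y \<in> R \<or> inverse y \<in> R)"
    hence y: "y \<notin> R" "inverse y \<notin> R" by auto
    have y0: "y \<noteq> 0" using y subring_set_0[OF sr] by auto
    obtain p where p: "p \<in> polys_over R" "w * poly p y = 1"
      and pmin: "\<And>p'. p' \<in> polys_over R \<Longrightarrow> w * poly p' y = 1 \<Longrightarrow> degree p \<le> degree p'"
      using rel[OF y(1)]
        ex_has_least_nat[of "\<lambda>p. p \<in> polys_over R \<and> w * poly p y = 1" _ degree] by blast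
    obtain q where q: "q \<in> polys_over R" "w * poly q (inverse y) = 1"
      and qmin: "\<And>p'. p' \<in> polys_over R \<Longrightarrow> w * poly p' (inverse y) = 1 \<Longrightarrow> degree q \<le> degree p'"
      using rel[OF y(2)]
        ex_has_least_nat[of "\<lambda>p. p \<in> polys_over R \<and> w * poly p (inverse y) = 1" _ degree] by blast
    show False
    proof (cases "degree q \<le> degree p")
      case True
      from shorten_relation[OF sr R'(3) unit p q this y0] pmin show False by fastforce
    next
      case False
      have "w * poly p (inverse (inverse y)) = 1" using p by simp
      from shorten_relation[OF sr R'(3) unit q p(1) this] False qmin y0 show False by fastforce
    qed
  qed
  thus ?thesis using R' by blast
qed

text \<open>Dividing the monic equation of degree k + 1 by x^k expresses x through powers of 1/x. If
  x were outside, 1/x would be inside, and then so would x.\<close>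

lemma valuation_ring_integrally_closed:
  fixes x :: "'a::field"
  assumes O: "subring_set O'" "\<And>y. y \<in> O' \<or> inverse y \<in> O'" and x: "integral_over O' x"
  shows "x \<in> O'"
proof (rule ccontr)
  assume "x \<notin> O'"
  hence inv: "inverse x \<in> O'" and x0: "x \<noteq> 0" using O subring_set_0[OF O(1)] by auto
  obtain p where p: "p \<in> polys_over O'" "lead_coeff p = 1" "poly p x = 0"
    using x by (auto simp: integral_over_def)
  define n where "n = degree p"
  have "n \<noteq> 0"
  proof
    assume "n = 0"
    then obtain a where "p = [:a:]" by (auto simp: n_def elim: degree_eq_zeroE)
    thus False using p by auto
  qed
  then obtain k where k: "n = Suc k" by (cases n) auto
  have "0 = (\<Sum>i\<le>n. poly.coeff p i * x ^ i)" using p by (simp add: poly_altdef n_def)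
  also have "\<dots> = x ^ Suc k + (\<Sum>i\<le>k. poly.coeff p i * x ^ i)"
    using p(2) k by (simp add: flip: n_def)
  finally have "x ^ Suc k = - (\<Sum>i\<le>k. poly.coeff p i * x ^ i)" by (simp add: eq_neg_iff_add_eq_0)
  hence "x ^ Suc k * inverse x ^ k = - (\<Sum>i\<le>k. poly.coeff p i * x ^ i) * inverse x ^ k" by simp
  also have "x ^ Suc k * inverse x ^ k = x" using x0 by (simp add: field_simps)
  also have "- (\<Sum>i\<le>k. poly.coeff p i * x ^ i) * inverse x ^ k
      = - (\<Sum>i\<le>k. poly.coeff p i * inverse x ^ (k - i))"
  proof -
    have "x ^ i * inverse x ^ k = inverse x ^ (k - i)" if "i \<le> k" for i
      using x0 that by (simp add: field_simps flip: power_add)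
    thus ?thesis by (auto simp: sum_distrib_right mult.assoc intro!: sum.cong)
  qed
  also have "\<dots> \<in> O'"
    using p inv O by (intro subring_set_uminus subring_set_sum subring_set_mult subring_set_power)
      (auto simp: polys_over_def)
  finally show False using \<open>x \<notin> O'\<close> by simp
qed

lemma integral_over_mono: "A \<subseteq> B \<Longrightarrow> integral_over A x \<Longrightarrow> integral_over B x"
  using polys_over_mono[of A B] by (auto simp: integral_over_def)

text \<open>The integral closure is the intersection of the valuation rings containing \<open>A\<close>.\<close>

lemma subring_set_integral_closure:
  fixes A :: "'a::field set"
  assumes A: "subring_set A"
  shows "subring_set {x. integral_over A x}"
proof -
  have base: "integral_over A a" if "a \<in> A" for a
    unfolding integral_over_def using A that
    by (intro bexI[of _ "[:-a, 1:]"])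
      (auto intro!: polys_over_pCons polys_over_0 subring_set_uminus simp: subring_set_1)
  have "integral_over A z"
    if "integral_over A x" "integral_over A y" "z = x - y \<or> z = x * y" for x y z
  proof (rule ccontr)
    assume z: "\<not> integral_over A z"
    hence "z \<noteq> 0" using base[OF subring_set_0[OF A]] by auto
    from valuation_ring_excluding[OF A z this] obtain O' where
      O: "subring_set O'" "A \<subseteq> O'" "z \<notin> O'" "\<And>y. y \<in> O' \<or> inverse y \<in> O'" by blast
    have "x \<in> O'" "y \<in> O'"
      using valuation_ring_integrally_closed[OF O(1,4)] integral_over_mono[OF O(2)] that by auto
    thus False using that O by (auto simp: subring_set_diff subring_set_mult)
  qed
  thus ?thesis unfolding subring_set_def using base subring_set_1[OF A] by blast
qed

lemma subring_set_Ints: "subring_set (\<int> :: 'a::comm_ring_1 set)"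
  by (auto simp: subring_set_def)

lemma subring_set_Rats: "subring_set (\<rat> :: 'a::field_char_0 set)"
  by (auto simp: subring_set_def)

lemma algebraic_int_iff_integral: "algebraic_int (x::'a::field) \<longleftrightarrow> integral_over \<int> x"
  by (auto simp: algebraic_int.simps integral_over_def polys_over_def)

lemma algebraic_iff_integral: "algebraic (x::'a::field_char_0) \<longleftrightarrow> integral_over \<rat> x"
proof
  assume "algebraic x"
  then obtain p where p: "\<And>i. poly.coeff p i \<in> \<rat>" "p \<noteq> 0" "poly p x = 0"
    by (auto simp: algebraic_altdef)
  show "integral_over \<rat> x"
    unfolding integral_over_def
  proof (intro bexI conjI)
    show "poly (smult (inverse (lead_coeff p)) p) x = 0" using p by simp
    show "lead_coeff (smult (inverse (lead_coeff p)) p) = 1" using p by simp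
    show "smult (inverse (lead_coeff p)) p \<in> polys_over \<rat>"
      using p by (auto simp: polys_over_def)
  qed
next
  assume "integral_over \<rat> x"
  thus "algebraic x"
    by (auto simp: algebraic_altdef integral_over_def polys_over_def)
qed

lemma algebraic_int_times: "algebraic_int (x::'a::field) \<Longrightarrow> algebraic_int y \<Longrightarrow> algebraic_int (x * y)"
  using subring_set_integral_closure[OF subring_set_Ints]
  by (auto simp: algebraic_int_iff_integral subring_set_def)

lemma algebraic_times: "algebraic (x::'a::field_char_0) \<Longrightarrow> algebraic y \<Longrightarrow> algebraic (x * y)"
  using subring_set_integral_closure[OF subring_set_Rats]
  by (auto simp: algebraic_iff_integral subring_set_def)

section \<open>Subfields and minimal polynomials\<close>

definition subfield_set :: "'a::field set \<Rightarrow> bool" where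
  "subfield_set F \<longleftrightarrow> subring_set F \<and> (\<forall>x\<in>F. inverse x \<in> F)"

lemma subfield_set_subring: "subfield_set F \<Longrightarrow> subring_set F"
  and subfield_set_inverse: "subfield_set F \<Longrightarrow> x \<in> F \<Longrightarrow> inverse x \<in> F"
  by (auto simp: subfield_set_def)

lemma subfield_set_divide: "subfield_set F \<Longrightarrow> x \<in> F \<Longrightarrow> y \<in> F \<Longrightarrow> x / y \<in> F"
  by (simp add: divide_inverse subfield_set_inverse subfield_set_subring subring_set_mult)

lemma subfield_set_Rats: "subfield_set (\<rat> :: 'a::field_char_0 set)"
  by (auto simp: subfield_set_def subring_set_Rats)

lemma Rats_subset_subfield_set:
  fixes F :: "'a::field_char_0 set"
  assumes "subfield_set F"
  shows "\<rat> \<subseteq> F"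
proof
  fix x :: 'a assume "x \<in> \<rat>"
  then obtain a b where "x = of_int a / of_int b" by (auto elim: Rats_cases')
  thus "x \<in> F"
    by (simp add: subfield_set_divide assms subring_set_of_int subfield_set_subring)
qed

lemma complex_ring_simps:
  "carrier complex_ring = UNIV" "x \<otimes>\<^bsub>complex_ring\<^esub> y = x * y" "x \<oplus>\<^bsub>complex_ring\<^esub> y = x + y"
  "\<one>\<^bsub>complex_ring\<^esub> = 1" "\<zero>\<^bsub>complex_ring\<^esub> = 0"
  by (auto simp: ring_of_type_algebra_def)

interpretation CR: ring complex_ring
  by (rule ring_from_type_algebra)

lemma complex_ring_a_inv: "\<ominus>\<^bsub>complex_ring\<^esub> x = - x"
  by (rule CR.minus_equality) (auto simp: complex_ring_simps)

lemma complex_ring_m_inv: "x \<noteq> 0 \<Longrightarrow> inv\<^bsub>complex_ring\<^esub> x = inverse x"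
  by (rule CR.inv_char) (auto simp: complex_ring_simps)

lemma subfield_complex_ring_iff: "subfield F complex_ring \<longleftrightarrow> subfield_set F"
proof
  assume F: "subfield F complex_ring"
  note r = subringE[OF subfieldE(1)[OF F], unfolded complex_ring_simps complex_ring_a_inv]
  have "inverse x \<in> F" if "x \<in> F" for x
  proof (cases "x = 0")
    case False
    thus ?thesis using CR.subfield_m_inv(1)[OF F, of x] that
      by (simp add: complex_ring_simps complex_ring_m_inv)
  qed (use r in auto)
  moreover have "x - y \<in> F" if "x \<in> F" "y \<in> F" for x y
    using r(7)[OF that(1) r(5)[OF that(2)]] by simp
  ultimately show "subfield_set F" using r by (auto simp: subfield_set_def subring_set_def)
next
  assume F: "subfield_set F"
  note sr = subfield_set_subring[OF F]
  show "subfield F complex_ring"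
  proof (rule field.subfieldI'[OF field_from_type_algebra])
    show "subring F complex_ring"
      by (rule CR.subringI)
        (auto simp: complex_ring_simps complex_ring_a_inv subring_set_1 subring_set_uminus
          subring_set_add subring_set_mult sr)
    show "inv\<^bsub>complex_ring\<^esub> k \<in> F" if "k \<in> F - {\<zero>\<^bsub>complex_ring\<^esub>}" for k
      using that by (auto simp: complex_ring_simps complex_ring_m_inv subfield_set_inverse F)
  qed
qed

text \<open>The quotient is formed over the whole field. The induction replays one step of long
  division, whose only division is by the leading coefficient of q, so the coefficients stay in
  F.\<close>

lemma div_polys_over:
  fixes p q :: "'a::field poly"
  assumes F: "subfield_set F" and q: "q \<in> polys_over F"
  shows "p \<in> polys_over F \<Longrightarrow> p div q \<in> polys_over F"
proof (induction "degree p" arbitrary: p rule: less_induct)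
  case less
  note sr = subfield_set_subring[OF F]
  show ?case
  proof (cases "q = 0 \<or> degree p < degree q \<or> p = 0")
    case True
    thus ?thesis by (auto simp: div_poly_less polys_over_0[OF sr])
  next
    case False
    hence q0: "q \<noteq> 0" and le: "degree q \<le> degree p" by auto
    define c where "c = lead_coeff p / lead_coeff q"
    define t where "t = monom c (degree p - degree q)"
    define p' where "p' = p - t * q"
    have "c \<in> F" unfolding c_def
      using less.prems q by (intro subfield_set_divide F) (auto simp: polys_over_def)
    hence t: "t \<in> polys_over F" by (simp add: t_def polys_over_monom sr)
    have p': "p' \<in> polys_over F"
      by (simp add: p'_def polys_over_diff polys_over_mult sr less.prems t q)
    have "p div q = (p' + t * q) div q" by (simp add: p'_def)
    also have "\<dots> = t + p' div q" using q0 by (simp add: add.commute)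
    finally have eq: "p div q = t + p' div q" .
    \<comment> \<open>Cancelling the leading term lowers the degree, except for constants, where p'
      vanishes outright.\<close>
    have "p' div q \<in> polys_over F"
    proof (cases "degree p = 0")
      case True
      then obtain a b where ab: "p = [:a:]" "q = [:b:]" using le by (auto elim!: degree_eq_zeroE)
      hence "p' = 0" using q0 by (simp add: p'_def t_def c_def monom_0)
      thus ?thesis by (simp add: polys_over_0 sr)
    next
      case False
      have "poly.coeff p' i = 0" if "i \<ge> degree p" for i
      proof (cases "i = degree p")
        case True
        have "poly.coeff (t * q) (degree p) = c * lead_coeff q"
          using le by (simp add: t_def coeff_monom_mult)
        thus ?thesis using True q0 by (simp add: p'_def c_def)
      next
        case False
        hence "degree p < i" using that by simp
        moreover have "degree (t * q) \<le> degree p"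
          unfolding t_def using degree_mult_le[of "monom c (degree p - degree q)" q]
            degree_monom_le[of c "degree p - degree q"] le by linarith
        ultimately show ?thesis by (simp add: p'_def coeff_eq_0)
      qed
      hence "degree p' < degree p" using False by (intro degree_lessI) auto
      thus ?thesis using less.hyps p' by blast
    qed
    thus ?thesis unfolding eq by (intro polys_over_add sr t)
  qed
qed

lemma mod_polys_over:
  fixes p q :: "'a::field poly"
  assumes "subfield_set F" "p \<in> polys_over F" "q \<in> polys_over F"
  shows "p mod q \<in> polys_over F"
  unfolding minus_div_mult_eq_mod[symmetric]
  by (intro polys_over_diff polys_over_mult div_polys_over assms subfield_set_subring)

text \<open>Least degree takes the place of irreducibility: it gives divisibility through division
  with remainder, and coprimality through \<open>minpoly_bezout\<close>.\<close>

definition is_minpoly :: "'a::field set \<Rightarrow> 'a \<Rightarrow> 'a poly \<Rightarrow> bool" where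
  "is_minpoly F x m \<longleftrightarrow> m \<in> polys_over F \<and> lead_coeff m = 1 \<and> poly m x = 0 \<and>
     (\<forall>q\<in>polys_over F. q \<noteq> 0 \<longrightarrow> poly q x = 0 \<longrightarrow> degree m \<le> degree q)"

lemma is_minpoly_exists:
  fixes x :: "'a::field"
  assumes F: "subfield_set F" and x: "integral_over F x"
  shows "\<exists>m. is_minpoly F x m"
proof -
  obtain p where p: "p \<in> polys_over F" "p \<noteq> 0" "poly p x = 0"
    using x unfolding integral_over_def by (metis leading_coeff_0_iff zero_neq_one)
  obtain q where q: "q \<in> polys_over F \<and> q \<noteq> 0 \<and> poly q x = 0"
    "\<And>r. r \<in> polys_over F \<and> r \<noteq> 0 \<and> poly r x = 0 \<Longrightarrow> degree q \<le> degree r"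
    using ex_has_least_nat[of "\<lambda>p. p \<in> polys_over F \<and> p \<noteq> 0 \<and> poly p x = 0" p degree] p by blast
  have "smult (inverse (lead_coeff q)) q \<in> polys_over F"
    using q by (intro polys_over_smult subfield_set_subring subfield_set_inverse F) (auto simp: polys_over_def)
  hence "is_minpoly F x (smult (inverse (lead_coeff q)) q)"
    unfolding is_minpoly_def using q by auto
  thus ?thesis by blast
qed

context
  fixes F :: "'a::field set" and x :: 'a and m :: "'a poly"
  assumes F: "subfield_set F" and m: "is_minpoly F x m"
begin

lemma minpoly_over: "m \<in> polys_over F" and minpoly_monic: "lead_coeff m = 1"
  and minpoly_root: "poly m x = 0"
  and minpoly_le: "q \<in> polys_over F \<Longrightarrow> q \<noteq> 0 \<Longrightarrow> poly q x = 0 \<Longrightarrow> degree m \<le> degree q"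
  using m by (auto simp: is_minpoly_def)

lemma minpoly_nonzero: "m \<noteq> 0"
  using minpoly_monic by auto

lemma minpoly_degree_pos: "degree m > 0"
proof (rule Nat.gr0I)
  assume "degree m = 0"
  then obtain a where "m = [:a:]" by (auto elim: degree_eq_zeroE)
  thus False using minpoly_monic minpoly_root by auto
qed

lemma minpoly_dvd:
  assumes q: "q \<in> polys_over F" "poly q x = 0"
  shows "m dvd q"
proof -
  have "poly (q mod m) x = 0"
    using q minpoly_root by (simp add: minus_div_mult_eq_mod[symmetric])
  moreover have "q mod m \<in> polys_over F" by (rule mod_polys_over[OF F q(1) minpoly_over])
  ultimately have "q mod m = 0"
    using minpoly_le[of "q mod m"] degree_mod_less[OF minpoly_nonzero, of q] minpoly_degree_pos by force
  thus ?thesis by (simp add: mod_eq_0_iff_dvd)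
qed

text \<open>The combinations of m and g form an ideal, and a nonzero element h of least degree in it
  divides both. As h divides g, it does not vanish at x, so m / h does, and minimality of m makes h
  constant. This yields inverses in F[x] and, with g the derivative of m, separability.\<close>

lemma minpoly_bezout:
  assumes g: "g \<in> polys_over F" "poly g x \<noteq> 0"
  shows "\<exists>a\<in>polys_over F. \<exists>b\<in>polys_over F. a * m + b * g = 1"
proof -
  note sr = subfield_set_subring[OF F]
  define S where "S = {h. \<exists>a\<in>polys_over F. \<exists>b\<in>polys_over F. h = a * m + b * g}"
  have S_diff: "u - v \<in> S" if uv: "u \<in> S" "v \<in> S" for u v
  proof -
    obtain a b a' b' where *: "a \<in> polys_over F" "b \<in> polys_over F" "u = a * m + b * g"
      "a' \<in> polys_over F" "b' \<in> polys_over F" "v = a' * m + b' * g"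
      using uv unfolding S_def by blast
    have "u - v = (a - a') * m + (b - b') * g" by (simp add: * algebra_simps)
    thus ?thesis unfolding S_def using * polys_over_diff[OF sr] by blast
  qed
  have S_mult: "c * u \<in> S" if c: "u \<in> S" "c \<in> polys_over F" for u c
  proof -
    obtain a b where *: "a \<in> polys_over F" "b \<in> polys_over F" "u = a * m + b * g"
      using c unfolding S_def by blast
    have "c * u = (c * a) * m + (c * b) * g" by (simp add: * algebra_simps)
    thus ?thesis unfolding S_def using * c polys_over_mult[OF sr] by blast
  qed
  have "m = 1 * m + 0 * g" "g = 0 * m + 1 * g" by simp_all
  hence mS: "m \<in> S" and gS: "g \<in> S"
    unfolding S_def using polys_over_0[OF sr] polys_over_1[OF sr] by blast+
  have S_over: "u \<in> polys_over F" if "u \<in> S" for u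
    using that g(1) minpoly_over by (auto simp: S_def intro!: polys_over_add polys_over_mult sr)
  obtain h where h: "h \<in> S" "h \<noteq> 0" and hmin: "\<And>r. r \<in> S \<Longrightarrow> r \<noteq> 0 \<Longrightarrow> degree h \<le> degree r"
    using ex_has_least_nat[of "\<lambda>p. p \<in> S \<and> p \<noteq> 0" m degree] mS minpoly_nonzero by blast
  have h_dvd: "h dvd u" if u: "u \<in> S" for u
  proof -
    have r: "u mod h \<in> S"
      unfolding minus_mult_div_eq_mod[symmetric] mult.commute[of h]
      by (intro S_diff S_mult u h div_polys_over F S_over)
    show ?thesis
    proof (cases "degree h = 0")
      case True
      then obtain c where "h = [:c:]" by (auto elim: degree_eq_zeroE)
      hence "is_unit h" using h(2) by (simp add: is_unit_const_poly_iff dvd_field_iff)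
      thus ?thesis by (rule unit_imp_dvd)
    next
      case False
      hence "u mod h = 0"
        using hmin[OF r] degree_mod_less[OF h(2), of u] by force
      thus ?thesis by (simp add: mod_eq_0_iff_dvd)
    qed
  qed
  define k where "k = m div h"
  have mk: "m = h * k" using h_dvd[OF mS] by (simp add: k_def)
  have "poly h x \<noteq> 0" using h_dvd[OF gS] g(2) by (auto simp: dvd_def)
  hence "poly k x = 0" using mk minpoly_root by simp
  moreover have "k \<in> polys_over F" unfolding k_def
    by (intro div_polys_over F S_over h minpoly_over)
  moreover have "k \<noteq> 0" using mk minpoly_nonzero by auto
  ultimately have "degree m \<le> degree k" by (intro minpoly_le)
  hence "degree h = 0" using mk h(2) \<open>k \<noteq> 0\<close> by (simp add: degree_mult_eq)
  then obtain c where c: "h = [:c:]" by (auto elim: degree_eq_zeroE)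
  have "c \<in> F" using polys_over_coeff[OF sr S_over[OF h(1)], of 0] c by simp
  hence "[:inverse c:] \<in> polys_over F" by (intro polys_over_pCons polys_over_0 sr subfield_set_inverse F)
  from S_mult[OF h(1) this] have "1 \<in> S" using c h(2) by (simp add: one_pCons)
  thus ?thesis unfolding S_def by auto
qed

lemma subfield_set_ring_adjoin: "subfield_set (ring_adjoin F x)"
  unfolding subfield_set_def
proof (intro conjI ballI)
  note sr = subfield_set_subring[OF F]
  show "subring_set (ring_adjoin F x)" by (rule subring_ring_adjoin[OF sr])
  fix y assume "y \<in> ring_adjoin F x"
  then obtain g where g: "g \<in> polys_over F" "y = poly g x" by (auto simp: ring_adjoin_def)
  show "inverse y \<in> ring_adjoin F x"
  proof (cases "y = 0")
    case True
    thus ?thesis using subring_set_0[OF subring_ring_adjoin[OF sr]] by simp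
  next
    case False
    then obtain a b where ab: "b \<in> polys_over F" "a * m + b * g = 1"
      using minpoly_bezout g by blast
    have "poly (a * m + b * g) x = 1" unfolding ab(2) by simp
    hence "poly b x * y = 1" using g minpoly_root by simp
    hence "inverse y = poly b x" using inverse_unique[of y "poly b x"] by (simp add: mult.commute)
    thus ?thesis using ab by (auto simp: ring_adjoin_def)
  qed
qed

end

text \<open>In characteristic 0 the derivative of m is nonzero and of smaller degree, so it cannot
  vanish at x.\<close>

lemma minpoly_pderiv:
  fixes x :: "'a::field_char_0"
  assumes F: "subfield_set F" and m: "is_minpoly F x m"
  shows "pderiv m \<in> polys_over F" "poly (pderiv m) x \<noteq> 0"
proof -
  note sr = subfield_set_subring[OF F]
  show d: "pderiv m \<in> polys_over F"
    using minpoly_over[OF F m] unfolding polys_over_def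
    by (auto simp: coeff_pderiv simp del: of_nat_Suc intro!: subring_set_mult[OF sr] subring_set_of_nat[OF sr])
  have "pderiv m \<noteq> 0" using minpoly_degree_pos[OF F m] by (auto simp: pderiv_eq_0_iff)
  thus "poly (pderiv m) x \<noteq> 0"
    using minpoly_le[OF F m d] minpoly_degree_pos[OF F m] by (auto simp: degree_pderiv)
qed

subsection \<open>Embeddings of fields into the complex numbers\<close>

text \<open>Extensionality makes an embedding determined by its values on F, so that embeddings can
  be counted.\<close>

definition emb :: "complex set \<Rightarrow> (complex \<Rightarrow> complex) set" where
  "emb F = {\<sigma> \<in> extensional F. \<sigma> 1 = 1 \<and> (\<forall>x\<in>F. \<forall>y\<in>F. \<sigma> (x + y) = \<sigma> x + \<sigma> y \<and> \<sigma> (x * y) = \<sigma> x * \<sigma> y)}"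

text \<open>Agreement with \<tau> is asked only on F, so \<tau> may be the plain identity as well as
  an extensional embedding; \<open>ext_emb_id\<close> passes between the two.\<close>

definition ext_emb :: "(complex \<Rightarrow> complex) \<Rightarrow> complex set \<Rightarrow> complex set \<Rightarrow> (complex \<Rightarrow> complex) set" where
  "ext_emb \<tau> F K = {\<sigma> \<in> emb K. \<forall>x\<in>F. \<sigma> x = \<tau> x}"

lemma embeddings_over_eq: "embeddings_over F K = ext_emb (\<lambda>x. x) F K"
  by (auto simp: embeddings_over_def ext_emb_def emb_def ring_hom_def complex_ring_simps)

context
  fixes F :: "complex set" and \<tau> :: "complex \<Rightarrow> complex"
  assumes F: "subfield_set F" and \<tau>: "\<tau> \<in> emb F"
begin

lemma emb_1: "\<tau> 1 = 1"
  and emb_add: "x \<in> F \<Longrightarrow> y \<in> F \<Longrightarrow> \<tau> (x + y) = \<tau> x + \<tau> y"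
  and emb_mult: "x \<in> F \<Longrightarrow> y \<in> F \<Longrightarrow> \<tau> (x * y) = \<tau> x * \<tau> y"
  and emb_extensional: "\<tau> \<in> extensional F"
  using \<tau> by (auto simp: emb_def)

lemma emb_0: "\<tau> 0 = 0"
  using emb_add[of 0 0] subring_set_0[OF subfield_set_subring[OF F]] by simp

lemma emb_uminus: "x \<in> F \<Longrightarrow> \<tau> (- x) = - \<tau> x"
  using emb_add[of x "-x"] subring_set_uminus[OF subfield_set_subring[OF F], of x] emb_0
  by (simp add: eq_neg_iff_add_eq_0 add.commute)

lemma emb_diff: "x \<in> F \<Longrightarrow> y \<in> F \<Longrightarrow> \<tau> (x - y) = \<tau> x - \<tau> y"
  using emb_add[of x "-y"] emb_uminus[of y] subring_set_uminus[OF subfield_set_subring[OF F], of y] by simp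

lemma emb_power: "x \<in> F \<Longrightarrow> \<tau> (x ^ n) = \<tau> x ^ n"
  by (induction n) (auto simp: emb_1 emb_mult subring_set_power[OF subfield_set_subring[OF F]])

lemma emb_sum: "(\<And>i. i \<in> I \<Longrightarrow> f i \<in> F) \<Longrightarrow> \<tau> (sum f I) = (\<Sum>i\<in>I. \<tau> (f i))"
  by (induction I rule: infinite_finite_induct)
    (auto simp: emb_0 emb_add subring_set_sum[OF subfield_set_subring[OF F]])

lemma emb_eq_0_iff: "x \<in> F \<Longrightarrow> \<tau> x = 0 \<longleftrightarrow> x = 0"
  using emb_mult[of x "inverse x"] subfield_set_inverse[OF F, of x] emb_1 emb_0 by (cases "x = 0") auto

lemma emb_inverse: "x \<in> F \<Longrightarrow> \<tau> (inverse x) = inverse (\<tau> x)"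
  using emb_mult[of x "inverse x"] subfield_set_inverse[OF F, of x] emb_1 emb_0
  by (cases "x = 0") (auto intro!: inverse_unique[symmetric])

lemma emb_of_nat: "\<tau> (of_nat n) = of_nat n"
  by (induction n) (auto simp: emb_0 emb_1 emb_add subring_set_1 subring_set_of_nat subfield_set_subring F)

lemma emb_of_int: "\<tau> (of_int n) = of_int n"
  by (cases n) (auto simp: emb_of_nat emb_diff emb_uminus emb_1 subring_set_of_nat subring_set_1
      subring_set_uminus subfield_set_subring F)

lemma emb_Rats: "x \<in> \<rat> \<Longrightarrow> \<tau> x = x"
  by (elim Rats_cases')
    (auto simp: divide_inverse emb_mult emb_inverse emb_of_int subring_set_of_int
      subfield_set_inverse subfield_set_subring F)

lemma coeff_map_emb: "poly.coeff (map_poly \<tau> p) i = \<tau> (poly.coeff p i)"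
  by (simp add: coeff_map_poly emb_0)

lemma map_emb_1: "map_poly \<tau> 1 = 1"
  by (simp add: map_poly_1 emb_1)

lemma map_emb_add:
  "p \<in> polys_over F \<Longrightarrow> q \<in> polys_over F \<Longrightarrow> map_poly \<tau> (p + q) = map_poly \<tau> p + map_poly \<tau> q"
  by (auto simp: poly_eq_iff coeff_map_emb emb_add polys_over_def)

lemma map_emb_diff:
  "p \<in> polys_over F \<Longrightarrow> q \<in> polys_over F \<Longrightarrow> map_poly \<tau> (p - q) = map_poly \<tau> p - map_poly \<tau> q"
  by (auto simp: poly_eq_iff coeff_map_emb emb_diff polys_over_def)

lemma map_emb_mult:
  "p \<in> polys_over F \<Longrightarrow> q \<in> polys_over F \<Longrightarrow> map_poly \<tau> (p * q) = map_poly \<tau> p * map_poly \<tau> q"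
  by (auto simp: poly_eq_iff coeff_map_emb coeff_mult emb_sum emb_mult polys_over_def
      subring_set_mult subfield_set_subring F)

lemma map_emb_pderiv: "p \<in> polys_over F \<Longrightarrow> map_poly \<tau> (pderiv p) = pderiv (map_poly \<tau> p)"
  by (auto simp: poly_eq_iff coeff_map_emb coeff_pderiv emb_mult polys_over_def emb_of_nat
      subring_set_of_nat subfield_set_subring F simp del: of_nat_Suc)

lemma map_emb_monic: "lead_coeff p = 1 \<Longrightarrow> degree (map_poly \<tau> p) = degree p"
proof (rule antisym)
  show "degree (map_poly \<tau> p) \<le> degree p"
    by (rule degree_le) (auto simp: coeff_map_emb coeff_eq_0 emb_0)
  assume "lead_coeff p = 1"
  thus "degree p \<le> degree (map_poly \<tau> p)"
    by (intro le_degree) (simp add: coeff_map_emb emb_1)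
qed

lemma poly_map_emb: "p \<in> polys_over F \<Longrightarrow> x \<in> F \<Longrightarrow> poly (map_poly \<tau> p) (\<tau> x) = \<tau> (poly p x)"
proof (induction p rule: pCons_induct)
  case (pCons a p)
  have "poly.coeff (pCons a p) 0 \<in> F" "poly.coeff (pCons a p) (Suc i) \<in> F" for i
    using pCons.prems unfolding polys_over_def by blast+
  hence a: "a \<in> F" "p \<in> polys_over F" by (auto simp: polys_over_def)
  thus ?case
    using pCons.IH pCons.prems pCons.hyps
    by (simp add: map_poly_pCons emb_0 emb_add emb_mult poly_in_subring_set subring_set_mult
        subfield_set_subring F)
qed (simp add: emb_0)

end

lemma emb_restrict:
  assumes "F \<subseteq> K" "subfield_set F" "\<sigma> \<in> emb K"
  shows "restrict \<sigma> F \<in> emb F"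
  using assms subfield_set_subring[OF assms(2)]
  by (auto simp: emb_def subring_set_1 subring_set_add subring_set_mult subset_iff)

context
  fixes F :: "complex set" and \<tau> :: "complex \<Rightarrow> complex" and \<alpha> :: complex and m :: "complex poly"
  assumes F: "subfield_set F" and \<tau>: "\<tau> \<in> emb F" and m: "is_minpoly F \<alpha> m"
begin

text \<open>Applying \<tau> to a Bezout identity for m and its derivative shows that the conjugated
  polynomial is coprime to its own derivative; hence its complex roots are simple.\<close>

lemma map_emb_minpoly_decomp: "map_poly \<tau> m = (\<Prod>z | poly (map_poly \<tau> m) z = 0. [:-z, 1:])"
proof -
  note sr = subfield_set_subring[OF F]
  obtain a b where ab: "a \<in> polys_over F" "b \<in> polys_over F" "a * m + b * pderiv m = 1"
    using minpoly_bezout[OF F m minpoly_pderiv[OF F m]] by blast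
  have "map_poly \<tau> (a * m + b * pderiv m)
      = map_poly \<tau> a * map_poly \<tau> m + map_poly \<tau> b * pderiv (map_poly \<tau> m)"
    using ab(1,2) minpoly_over[OF F m] minpoly_pderiv[OF F m]
    by (simp add: map_emb_add[OF F \<tau>] map_emb_mult[OF F \<tau>] map_emb_pderiv[OF F \<tau>] polys_over_mult[OF sr])
  hence one: "map_poly \<tau> a * map_poly \<tau> m + map_poly \<tau> b * pderiv (map_poly \<tau> m) = 1"
    using ab map_emb_1[OF F \<tau>] by simp
  have "rsquarefree (map_poly \<tau> m)"
    unfolding rsquarefree_roots
  proof safe
    fix z assume "poly (map_poly \<tau> m) z = 0" "poly (pderiv (map_poly \<tau> m)) z = 0"
    with arg_cong[OF one, of "\<lambda>p. poly p z"] show False by simp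
  qed
  moreover have "lead_coeff (map_poly \<tau> m) = 1"
    using minpoly_monic[OF F m] by (simp add: map_emb_monic[OF F \<tau>] coeff_map_emb[OF F \<tau>] emb_1[OF F \<tau>])
  ultimately show ?thesis using complex_poly_decompose_rsquarefree[of "map_poly \<tau> m"] by simp
qed

lemma map_emb_minpoly_nonzero: "map_poly \<tau> m \<noteq> 0"
proof -
  have "degree (map_poly \<tau> m) > 0"
    using minpoly_degree_pos[OF F m] map_emb_monic[OF F \<tau> minpoly_monic[OF F m]] by simp
  thus ?thesis by auto
qed

lemma card_roots_map_emb_minpoly: "card {z. poly (map_poly \<tau> m) z = 0} = degree m"
proof -
  have "degree m = degree (map_poly \<tau> m)"
    by (simp add: map_emb_monic[OF F \<tau> minpoly_monic[OF F m]])
  also have "\<dots> = degree (\<Prod>z | poly (map_poly \<tau> m) z = 0. [:-z, 1:])"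
    using map_emb_minpoly_decomp by simp
  also have "\<dots> = (\<Sum>z | poly (map_poly \<tau> m) z = 0. degree [:-z, 1:])"
    by (rule degree_prod_eq_sum_degree) auto
  finally show ?thesis by simp
qed

text \<open>This makes the assignment of g^\<tau>(\<rho>) to g(\<alpha>) well defined: two
  polynomials with the same value at \<alpha> differ by a multiple of m, and the conjugate of m
  kills \<rho>.\<close>

lemma map_emb_poly_eq:
  assumes "g \<in> polys_over F" "g' \<in> polys_over F" "poly g \<alpha> = poly g' \<alpha>" "poly (map_poly \<tau> m) \<rho> = 0"
  shows "poly (map_poly \<tau> g) \<rho> = poly (map_poly \<tau> g') \<rho>"
proof -
  note sr = subfield_set_subring[OF F]
  have d: "g - g' \<in> polys_over F" by (intro polys_over_diff sr assms)
  have "m dvd g - g'" using assms by (intro minpoly_dvd[OF F m] d) auto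
  hence eq: "g - g' = m * ((g - g') div m)" by simp
  have "map_poly \<tau> g - map_poly \<tau> g' = map_poly \<tau> (g - g')"
    by (simp add: map_emb_diff[OF F \<tau>] assms)
  also have "\<dots> = map_poly \<tau> m * map_poly \<tau> ((g - g') div m)"
    by (subst eq) (intro map_emb_mult[OF F \<tau>] minpoly_over[OF F m] div_polys_over F d)
  finally have "poly (map_poly \<tau> g - map_poly \<tau> g') \<rho> = 0" using assms by simp
  thus ?thesis by simp
qed

lemma ext_emb_poly:
  assumes \<sigma>: "\<sigma> \<in> ext_emb \<tau> F (ring_adjoin F \<alpha>)" and g: "g \<in> polys_over F"
  shows "\<sigma> (poly g \<alpha>) = poly (map_poly \<tau> g) (\<sigma> \<alpha>)"
proof -
  note sr = subfield_set_subring[OF F]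
  have K: "subfield_set (ring_adjoin F \<alpha>)" by (rule subfield_set_ring_adjoin[OF F m])
  have \<sigma>': "\<sigma> \<in> emb (ring_adjoin F \<alpha>)" "\<And>x. x \<in> F \<Longrightarrow> \<sigma> x = \<tau> x"
    using \<sigma> by (auto simp: ext_emb_def)
  have "map_poly \<sigma> g = map_poly \<tau> g"
    using g \<sigma>' emb_0[OF F \<tau>] emb_0[OF K \<sigma>'(1)] by (auto simp: poly_eq_iff coeff_map_poly polys_over_def)
  moreover have "g \<in> polys_over (ring_adjoin F \<alpha>)"
    using g ring_adjoin_base[OF sr] by (auto simp: polys_over_def)
  ultimately show ?thesis
    using poly_map_emb[OF K \<sigma>'(1) _ ring_adjoin_gen[OF sr]] by metis
qed

text \<open>An extension is determined by the image of \<alpha>, which is a root of the conjugated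
  minimal polynomial, and each root occurs. The count of embeddings, and with it every degree
  comparison below, rests on this.\<close>

lemma ext_emb_bij:
  "bij_betw (\<lambda>\<sigma>. \<sigma> \<alpha>) (ext_emb \<tau> F (ring_adjoin F \<alpha>)) {z. poly (map_poly \<tau> m) z = 0}"
proof (rule bij_betwI')
  note sr = subfield_set_subring[OF F]
  fix \<sigma> \<sigma>' assume s: "\<sigma> \<in> ext_emb \<tau> F (ring_adjoin F \<alpha>)" "\<sigma>' \<in> ext_emb \<tau> F (ring_adjoin F \<alpha>)"
  have ext: "\<sigma> \<in> extensional (ring_adjoin F \<alpha>)" "\<sigma>' \<in> extensional (ring_adjoin F \<alpha>)"
    using s by (auto simp: ext_emb_def emb_def)
  have "\<sigma> = \<sigma>'" if "\<sigma> \<alpha> = \<sigma>' \<alpha>"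
  proof (rule extensionalityI[OF ext])
    fix y assume "y \<in> ring_adjoin F \<alpha>"
    thus "\<sigma> y = \<sigma>' y" using that by (auto simp: ring_adjoin_def ext_emb_poly[OF s(1)] ext_emb_poly[OF s(2)])
  qed
  thus "\<sigma> \<alpha> = \<sigma>' \<alpha> \<longleftrightarrow> \<sigma> = \<sigma>'" by auto
next
  note sr = subfield_set_subring[OF F]
  have K: "subfield_set (ring_adjoin F \<alpha>)" by (rule subfield_set_ring_adjoin[OF F m])
  fix \<sigma> assume s: "\<sigma> \<in> ext_emb \<tau> F (ring_adjoin F \<alpha>)"
  have "poly (map_poly \<tau> m) (\<sigma> \<alpha>) = \<sigma> (poly m \<alpha>)"
    using ext_emb_poly[OF s minpoly_over[OF F m]] by simp
  also have "\<dots> = 0" using minpoly_root[OF F m] s emb_0[OF K] by (auto simp: ext_emb_def)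
  finally show "\<sigma> \<alpha> \<in> {z. poly (map_poly \<tau> m) z = 0}" by simp
next
  note sr = subfield_set_subring[OF F]
  fix \<rho> assume "\<rho> \<in> {z. poly (map_poly \<tau> m) z = 0}"
  hence \<rho>: "poly (map_poly \<tau> m) \<rho> = 0" by simp
  define K where "K = ring_adjoin F \<alpha>"
  \<comment> \<open>Any polynomial representing y may be chosen, by
    \<open>map_emb_poly_eq\<close>.\<close>
  define \<sigma> where "\<sigma> = restrict (\<lambda>y. poly (map_poly \<tau> (SOME g. g \<in> polys_over F \<and> poly g \<alpha> = y)) \<rho>) K"
  have eq: "\<sigma> (poly g \<alpha>) = poly (map_poly \<tau> g) \<rho>" if g: "g \<in> polys_over F" for g
  proof -
    define g' where "g' = (SOME g'. g' \<in> polys_over F \<and> poly g' \<alpha> = poly g \<alpha>)"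
    have "g' \<in> polys_over F \<and> poly g' \<alpha> = poly g \<alpha>"
      unfolding g'_def by (rule someI[of _ g]) (use g in auto)
    hence "poly (map_poly \<tau> g') \<rho> = poly (map_poly \<tau> g) \<rho>"
      using g \<rho> by (intro map_emb_poly_eq) auto
    moreover have "poly g \<alpha> \<in> K" using g by (auto simp: K_def ring_adjoin_def)
    ultimately show ?thesis by (simp add: \<sigma>_def g'_def)
  qed
  have const: "\<sigma> x = \<tau> x" if "x \<in> F" for x
    using eq[of "[:x:]"] that by (simp add: polys_over_pCons polys_over_0 sr map_poly_pCons emb_0[OF F \<tau>])
  have "\<sigma> \<in> emb K"
    unfolding emb_def
  proof (safe)
    show "\<sigma> \<in> extensional K" by (simp add: \<sigma>_def)
    show "\<sigma> 1 = 1" using const[of 1] emb_1[OF F \<tau>] subring_set_1[OF sr] by simp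
    fix x y assume "x \<in> K" "y \<in> K"
    then obtain g h where gh: "g \<in> polys_over F" "h \<in> polys_over F" "x = poly g \<alpha>" "y = poly h \<alpha>"
      by (auto simp: K_def ring_adjoin_def)
    show "\<sigma> (x + y) = \<sigma> x + \<sigma> y"
      using eq[of "g + h"] gh by (simp add: eq map_emb_add[OF F \<tau>] polys_over_add[OF sr])
    show "\<sigma> (x * y) = \<sigma> x * \<sigma> y"
      using eq[of "g * h"] gh by (simp add: eq map_emb_mult[OF F \<tau>] polys_over_mult[OF sr])
  qed
  moreover have "\<sigma> \<alpha> = \<rho>"
    using eq[of "[:0, 1:]"] by (simp add: polys_over_pCons polys_over_0 subring_set_1 subring_set_0 sr
        map_poly_pCons emb_0[OF F \<tau>] emb_1[OF F \<tau>])
  ultimately show "\<exists>\<sigma>\<in>ext_emb \<tau> F (ring_adjoin F \<alpha>). \<rho> = \<sigma> \<alpha>"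
    using const by (auto simp: ext_emb_def K_def)
qed

lemma card_ext_emb: "card (ext_emb \<tau> F (ring_adjoin F \<alpha>)) = degree m"
  using bij_betw_same_card[OF ext_emb_bij] card_roots_map_emb_minpoly by simp

lemma finite_ext_emb: "finite (ext_emb \<tau> F (ring_adjoin F \<alpha>))"
  using bij_betw_finite[OF ext_emb_bij] map_emb_minpoly_nonzero by (simp add: poly_roots_finite)

text \<open>By Vieta's formula the product of the roots is the constant coefficient up to sign. So
  the product over the extensions of \<tau> is \<tau> applied to one fixed element of F, the
  norm.\<close>

lemma prod_ext_emb:
  "(\<Prod>\<sigma>\<in>ext_emb \<tau> F (ring_adjoin F \<alpha>). \<sigma> \<alpha>) = \<tau> ((-1) ^ degree m * poly.coeff m 0)"
proof -
  note sr = subfield_set_subring[OF F]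
  have "(\<Prod>\<sigma>\<in>ext_emb \<tau> F (ring_adjoin F \<alpha>). \<sigma> \<alpha>) = (\<Prod>z | poly (map_poly \<tau> m) z = 0. z)"
    using prod.reindex_bij_betw[OF ext_emb_bij, of "\<lambda>z. z"] by simp
  also have "\<dots> = (-1) ^ degree m * (\<Prod>z | poly (map_poly \<tau> m) z = 0. -z)"
    by (simp add: prod_uminus card_roots_map_emb_minpoly flip: power_mult_distrib)
  also have "(\<Prod>z | poly (map_poly \<tau> m) z = 0. -z) = poly (\<Prod>z | poly (map_poly \<tau> m) z = 0. [:-z, 1:]) 0"
    by (simp add: poly_prod)
  also have "\<dots> = poly.coeff (map_poly \<tau> m) 0"
    using map_emb_minpoly_decomp by (simp flip: poly_0_coeff_0)
  also have "\<dots> = \<tau> (poly.coeff m 0)" by (simp add: coeff_map_emb[OF F \<tau>])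
  also have "(-1) ^ degree m * \<dots> = \<tau> ((-1) ^ degree m * poly.coeff m 0)"
    using minpoly_over[OF F m]
    by (simp add: emb_mult[OF F \<tau>] emb_power[OF F \<tau>] emb_uminus[OF F \<tau>] emb_1[OF F \<tau>]
        subring_set_power subring_set_uminus subring_set_1 sr polys_over_def)
  finally show ?thesis .
qed

end

section \<open>Archimedean sums and norms in a simple extension\<close>

text \<open>This is S of the overview. The field is an argument because the sum is multiplied by the
  relative degree when the field grows.\<close>

definition arch_sum :: "complex set \<Rightarrow> complex \<Rightarrow> real" where
  "arch_sum K x = (\<Sum>\<sigma>\<in>emb K. \<bar>ln (cmod (\<sigma> x))\<bar>)"

lemma id_in_emb: "subfield_set F \<Longrightarrow> restrict (\<lambda>x. x) F \<in> emb F"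
  by (auto simp: emb_def subring_set_1 subring_set_add subring_set_mult subfield_set_subring)

lemma ext_emb_id: "ext_emb (\<lambda>x. x) F K = ext_emb (restrict (\<lambda>x. x) F) F K"
  by (auto simp: ext_emb_def)

context
  fixes F :: "complex set" and \<alpha> :: complex and m :: "complex poly" and K :: "complex set"
  assumes F: "subfield_set F" and m: "is_minpoly F \<alpha> m" and K: "K = ring_adjoin F \<alpha>"
begin

lemma F_subset_K: "F \<subseteq> K"
  unfolding K using ring_adjoin_base[OF subfield_set_subring[OF F]] by blast

lemma subfield_K: "subfield_set K"
  unfolding K by (rule subfield_set_ring_adjoin[OF F m])

lemma ext_emb_altdef: "\<tau> \<in> emb F \<Longrightarrow> ext_emb \<tau> F K = {\<sigma> \<in> emb K. restrict \<sigma> F = \<tau>}"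
proof (safe)
  fix \<sigma> assume "\<tau> \<in> emb F" "\<sigma> \<in> ext_emb \<tau> F K"
  thus "restrict \<sigma> F = \<tau>"
    by (intro extensionalityI[of _ F]) (auto simp: ext_emb_def emb_def)
qed (auto simp: ext_emb_def)

text \<open>Restriction is onto because the conjugated minimal polynomial has positive degree, so
  every \<tau> extends.\<close>

lemma restrict_image_emb: "(\<lambda>\<sigma>. restrict \<sigma> F) ` emb K = emb F"
proof (intro equalityI subsetI)
  fix \<tau> assume \<tau>: "\<tau> \<in> emb F"
  have "card (ext_emb \<tau> F K) > 0"
    unfolding K using card_ext_emb[OF F \<tau> m] minpoly_degree_pos[OF F m] by simp
  then obtain \<sigma> where "\<sigma> \<in> ext_emb \<tau> F K" by (metis card_eq_0_iff less_irrefl equals0I)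
  thus "\<tau> \<in> (\<lambda>\<sigma>. restrict \<sigma> F) ` emb K" unfolding ext_emb_altdef[OF \<tau>] by blast
qed (use emb_restrict[OF F_subset_K F] in auto)

lemma finite_emb_iff: "finite (emb K) \<longleftrightarrow> finite (emb F)"
proof
  assume "finite (emb K)"
  thus "finite (emb F)" using restrict_image_emb by (metis finite_imageI)
next
  assume fin: "finite (emb F)"
  have "emb K \<subseteq> (\<Union>\<tau>\<in>emb F. ext_emb \<tau> F K)"
  proof
    fix \<sigma> assume "\<sigma> \<in> emb K"
    hence "restrict \<sigma> F \<in> emb F" "\<sigma> \<in> ext_emb (restrict \<sigma> F) F K"
      using emb_restrict[OF F_subset_K F] by (auto simp: ext_emb_def)
    thus "\<sigma> \<in> (\<Union>\<tau>\<in>emb F. ext_emb \<tau> F K)" by blast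
  qed
  moreover have "finite (\<Union>\<tau>\<in>emb F. ext_emb \<tau> F K)"
    unfolding K using fin finite_ext_emb[OF F _ m] by blast
  ultimately show "finite (emb K)" by (rule finite_subset)
qed

lemma sum_emb:
  assumes fin: "finite (emb F)"
  shows "(\<Sum>\<sigma>\<in>emb K. f \<sigma>) = (\<Sum>\<tau>\<in>emb F. \<Sum>\<sigma>\<in>ext_emb \<tau> F K. f \<sigma>)"
proof -
  have "(\<Sum>\<tau>\<in>emb F. \<Sum>\<sigma>\<in>ext_emb \<tau> F K. f \<sigma>) = (\<Sum>\<tau>\<in>emb F. sum f {\<sigma> \<in> emb K. restrict \<sigma> F = \<tau>})"
    by (intro sum.cong) (auto simp: ext_emb_altdef)
  also have "\<dots> = sum f (emb K)"
    using restrict_image_emb by (intro sum.group) (auto simp: fin finite_emb_iff)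
  finally show ?thesis by simp
qed

lemma card_emb:
  assumes fin: "finite (emb F)"
  shows "card (emb K) = card (emb F) * degree m"
  using sum_emb[OF fin, of "\<lambda>_. 1::nat"] card_ext_emb[OF F _ m] by (simp add: K)

lemma arch_sum_adjoin:
  assumes fin: "finite (emb F)" and x: "x \<in> F"
  shows "arch_sum K x = real (degree m) * arch_sum F x"
proof -
  have "arch_sum K x = (\<Sum>\<tau>\<in>emb F. \<Sum>\<sigma>\<in>ext_emb \<tau> F K. \<bar>ln (cmod (\<tau> x))\<bar>)"
    unfolding arch_sum_def sum_emb[OF fin] using x by (intro sum.cong) (auto simp: ext_emb_def)
  also have "\<dots> = (\<Sum>\<tau>\<in>emb F. real (degree m) * \<bar>ln (cmod (\<tau> x))\<bar>)"
    using card_ext_emb[OF F _ m] by (intro sum.cong) (auto simp: K)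
  finally show ?thesis by (simp add: arch_sum_def sum_distrib_left)
qed

lemma field_norm_eq: "field_norm F K \<alpha> = (-1) ^ degree m * poly.coeff m 0"
  unfolding field_norm_def embeddings_over_eq ext_emb_id K prod_ext_emb[OF F id_in_emb[OF F] m]
  using minpoly_over[OF F m] subfield_set_subring[OF F]
  by (auto simp: polys_over_def intro!: subring_set_mult subring_set_power subring_set_uminus subring_set_1)

lemma field_norm_in: "field_norm F K \<alpha> \<in> F"
  unfolding field_norm_eq using minpoly_over[OF F m] subfield_set_subring[OF F]
  by (auto simp: polys_over_def intro!: subring_set_mult subring_set_power subring_set_uminus subring_set_1)

lemma emb_field_norm: "\<tau> \<in> emb F \<Longrightarrow> \<tau> (field_norm F K \<alpha>) = (\<Prod>\<sigma>\<in>ext_emb \<tau> F K. \<sigma> \<alpha>)"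
  unfolding field_norm_eq by (simp add: K prod_ext_emb[OF F _ m])

text \<open>At each \<tau>, the logarithm of the conjugated norm is the sum of the logarithms of the
  conjugates of \<alpha> above \<tau>; the triangle inequality is applied there, before summing over
  \<tau>.\<close>

lemma arch_sum_field_norm_le:
  assumes fin: "finite (emb F)" and \<alpha>: "\<alpha> \<noteq> 0"
  shows "arch_sum F (field_norm F K \<alpha>) \<le> arch_sum K \<alpha>"
proof -
  have \<alpha>K: "\<alpha> \<in> K" unfolding K by (rule ring_adjoin_gen[OF subfield_set_subring[OF F]])
  have "\<bar>ln (cmod (\<tau> (field_norm F K \<alpha>)))\<bar> \<le> (\<Sum>\<sigma>\<in>ext_emb \<tau> F K. \<bar>ln (cmod (\<sigma> \<alpha>))\<bar>)"
    if \<tau>: "\<tau> \<in> emb F" for \<tau>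
  proof -
    have "ln (cmod (\<tau> (field_norm F K \<alpha>))) = ln (\<Prod>\<sigma>\<in>ext_emb \<tau> F K. cmod (\<sigma> \<alpha>))"
      by (simp add: emb_field_norm[OF \<tau>] prod_norm)
    also have "\<dots> = (\<Sum>\<sigma>\<in>ext_emb \<tau> F K. ln (cmod (\<sigma> \<alpha>)))"
      using \<alpha> \<alpha>K finite_ext_emb[OF F \<tau> m] emb_eq_0_iff[OF subfield_K]
      by (intro ln_prod) (auto simp: ext_emb_def K)
    finally show ?thesis by simp
  qed
  thus ?thesis unfolding arch_sum_def sum_emb[OF fin] by (intro sum_mono)
qed

end

section \<open>Degrees and generators of number fields\<close>

lemma emb_Rats_eq: "emb \<rat> = {restrict (\<lambda>x. x) \<rat>}"
  using id_in_emb[OF subfield_set_Rats] emb_Rats[OF subfield_set_Rats] emb_extensional[OF subfield_set_Rats]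
  by (auto intro!: extensionalityI[of _ \<rat>])

text \<open>The values of rational polynomials at \<alpha> already contain their inverses, so the
  generated field needs no quotients.\<close>

lemma adjoin_eq:
  assumes "algebraic \<alpha>"
  shows "adjoin \<alpha> = ring_adjoin \<rat> \<alpha>"
proof
  obtain m where m: "is_minpoly \<rat> \<alpha> m"
    using is_minpoly_exists[OF subfield_set_Rats] assms by (auto simp: algebraic_iff_integral)
  note fld = field_from_type_algebra[where 'a = complex]
  have "subfield (ring_adjoin \<rat> \<alpha>) complex_ring"
    unfolding subfield_complex_ring_iff by (rule subfield_set_ring_adjoin[OF subfield_set_Rats m])
  thus "adjoin \<alpha> \<subseteq> ring_adjoin \<rat> \<alpha>"
    unfolding adjoin_def
    by (intro field.generate_field_min_subfield1[OF fld])
      (auto simp: complex_ring_simps ring_adjoin_gen[OF subring_set_Rats])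
  have s: "subfield_set (adjoin \<alpha>)"
    unfolding adjoin_def subfield_complex_ring_iff[symmetric]
    by (intro field.generate_field_is_subfield[OF fld]) (auto simp: complex_ring_simps)
  show "ring_adjoin \<rat> \<alpha> \<subseteq> adjoin \<alpha>"
    by (intro ring_adjoin_min subfield_set_subring s Rats_subset_subfield_set)
      (auto simp: adjoin_def intro: generate_field.incl)
qed

lemma combine_complex_ring:
  "CR.combine Ks Us = (\<Sum>i<min (length Ks) (length Us). Ks ! i * Us ! i)"
proof (induction Ks Us rule: CR.combine.induct)
  case (1 k Ks u Us)
  thus ?case by (simp add: complex_ring_simps sum.lessThan_Suc_shift del: sum.lessThan_Suc)
qed (auto simp: complex_ring_simps)

text \<open>The powers of \<alpha> below the degree of m form a basis: independent because m has
  least degree, spanning because polynomials may be reduced modulo m.\<close>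

lemma dimension_ring_adjoin:
  assumes F: "subfield_set F" and m: "is_minpoly F \<alpha> m"
  shows "CR.dimension (degree m) F (ring_adjoin F \<alpha>)"
proof -
  note sr = subfield_set_subring[OF F]
  have sF: "subfield F complex_ring" by (simp add: subfield_complex_ring_iff F)
  define Us where "Us = map (\<lambda>i. \<alpha> ^ i) [0..<degree m]"
  have Us: "length Us = degree m" "set Us \<subseteq> carrier complex_ring"
    by (auto simp: Us_def complex_ring_simps)
  have "CR.independent F Us"
  proof (rule CR.trivial_combine_imp_independent[OF sF Us(2)])
    fix Ks assume Ks: "set Ks \<subseteq> F" "CR.combine Ks Us = \<zero>\<^bsub>complex_ring\<^esub>"
    define L where "L = min (length Ks) (degree m)"
    define p where "p = (\<Sum>i<L. monom (Ks ! i) i)"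
    have coeff: "poly.coeff p j = (if j < L then Ks ! j else 0)" for j
      by (simp add: p_def coeff_sum sum.delta if_distrib cong: if_cong)
    have "poly p \<alpha> = (\<Sum>i<L. Ks ! i * Us ! i)"
      by (auto simp: p_def poly_sum poly_monom Us_def L_def intro!: sum.cong)
    also have "\<dots> = 0" using Ks by (simp add: combine_complex_ring Us L_def complex_ring_simps)
    finally have "poly p \<alpha> = 0" .
    moreover have "p \<in> polys_over F"
      using Ks(1) by (auto simp: polys_over_def coeff subring_set_0[OF sr] L_def)
    moreover have "degree p < degree m"
      using minpoly_degree_pos[OF F m] by (intro degree_lessI) (auto simp: coeff L_def)
    ultimately have "p = 0" using minpoly_le[OF F m] by fastforce
    hence "Ks ! j = 0" if "j < L" for j using coeff[of j] that by simp
    thus "set (take (length Us) Ks) \<subseteq> {\<zero>\<^bsub>complex_ring\<^esub>}"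
      by (auto simp: set_conv_nth Us L_def complex_ring_simps)
  qed
  moreover have "CR.Span F Us = ring_adjoin F \<alpha>"
  proof
    show "CR.Span F Us \<subseteq> ring_adjoin F \<alpha>"
    proof
      fix y assume "y \<in> CR.Span F Us"
      then obtain Ks where Ks: "set Ks \<subseteq> F" "length Ks = degree m" "y = CR.combine Ks Us"
        unfolding CR.Span_mem_iff_length_version[OF sF Us(2)] by (auto simp: Us)
      have y: "y = (\<Sum>i<degree m. Ks ! i * \<alpha> ^ i)"
        using Ks by (auto simp: combine_complex_ring Us Us_def intro!: sum.cong)
      have "Ks ! i \<in> F" if "i < degree m" for i using Ks nth_mem[of i Ks] that by auto
      hence "(\<Sum>i<degree m. Ks ! i * \<alpha> ^ i) \<in> ring_adjoin F \<alpha>"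
        using ring_adjoin_base[OF sr] ring_adjoin_gen[OF sr] subring_ring_adjoin[OF sr]
        by (intro subring_set_sum subring_set_mult subring_set_power) auto
      thus "y \<in> ring_adjoin F \<alpha>" unfolding y .
    qed
    show "ring_adjoin F \<alpha> \<subseteq> CR.Span F Us"
    proof
      fix y assume "y \<in> ring_adjoin F \<alpha>"
      then obtain g where g: "g \<in> polys_over F" "y = poly g \<alpha>" by (auto simp: ring_adjoin_def)
      define r where "r = g mod m"
      have r: "r \<in> polys_over F" unfolding r_def by (intro mod_polys_over F g minpoly_over[OF F m])
      have dr: "degree r < degree m"
        using degree_mod_less[OF minpoly_nonzero[OF F m], of g] minpoly_degree_pos[OF F m]
        by (auto simp: r_def)
      have "y = poly r \<alpha>"
        using minpoly_root[OF F m] by (simp add: r_def g minus_div_mult_eq_mod[symmetric])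
      also have "\<dots> = (\<Sum>i\<le>degree r. poly.coeff r i * \<alpha> ^ i)" by (rule poly_altdef)
      also have "\<dots> = (\<Sum>i<degree m. poly.coeff r i * \<alpha> ^ i)"
        using dr by (intro sum.mono_neutral_left) (auto simp: coeff_eq_0)
      also have "\<dots> = CR.combine (map (poly.coeff r) [0..<degree m]) Us"
        by (auto simp: combine_complex_ring Us_def intro!: sum.cong)
      finally show "y \<in> CR.Span F Us"
        unfolding CR.Span_mem_iff_length_version[OF sF Us(2)] using r
        by (intro exI[of _ "map (poly.coeff r) [0..<degree m]"]) (auto simp: Us polys_over_def)
    qed
  qed
  ultimately show ?thesis using CR.dimension_independent Us(1) by metis
qed

lemma alg_degree_eq:
  assumes "algebraic \<alpha>" "is_minpoly \<rat> \<alpha> m"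
  shows "alg_degree \<alpha> = degree m"
proof -
  have sF: "subfield \<rat> complex_ring" by (simp add: subfield_complex_ring_iff subfield_set_Rats)
  show ?thesis
    unfolding alg_degree_def field_degree_def adjoin_eq[OF assms(1)]
    using CR.dimI[OF sF dimension_ring_adjoin[OF subfield_set_Rats assms(2)]] by (simp add: over_def)
qed

lemma algebraic_minpoly_exists: "algebraic (\<alpha>::'a::field_char_0) \<Longrightarrow> \<exists>m. is_minpoly \<rat> \<alpha> m"
  using is_minpoly_exists[OF subfield_set_Rats] by (auto simp: algebraic_iff_integral)

lemma subfield_adjoin: "algebraic \<alpha> \<Longrightarrow> subfield_set (adjoin \<alpha>)"
  using algebraic_minpoly_exists subfield_set_ring_adjoin[OF subfield_set_Rats] by (metis adjoin_eq)

lemma in_adjoin: "algebraic \<alpha> \<Longrightarrow> \<alpha> \<in> adjoin \<alpha>"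
  by (simp add: adjoin_eq ring_adjoin_gen[OF subring_set_Rats])

lemma finite_emb_adjoin: "algebraic \<alpha> \<Longrightarrow> finite (emb (adjoin \<alpha>))"
  using algebraic_minpoly_exists finite_emb_iff[OF subfield_set_Rats _ refl]
  by (metis adjoin_eq emb_Rats_eq finite.simps)

lemma card_emb_adjoin: "algebraic \<alpha> \<Longrightarrow> card (emb (adjoin \<alpha>)) = alg_degree \<alpha>"
proof -
  assume a: "algebraic \<alpha>"
  then obtain m where m: "is_minpoly \<rat> \<alpha> m" using algebraic_minpoly_exists by blast
  show ?thesis
    using card_emb[OF subfield_set_Rats m refl] alg_degree_eq[OF a m] by (simp add: emb_Rats_eq adjoin_eq a)
qed

lemma alg_degree_pos: "algebraic \<alpha> \<Longrightarrow> alg_degree \<alpha> > 0"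
  using algebraic_minpoly_exists alg_degree_eq minpoly_degree_pos[OF subfield_set_Rats] by metis

lemma
  assumes \<alpha>: "algebraic \<alpha>" and F: "subfield_set F" "F \<subseteq> adjoin \<alpha>"
  shows adjoin_eq_ring_adjoin: "adjoin \<alpha> = ring_adjoin F \<alpha>"
    and minpoly_exists_over: "\<exists>m. is_minpoly F \<alpha> m"
proof -
  show "\<exists>m. is_minpoly F \<alpha> m"
    using \<alpha> integral_over_mono[OF Rats_subset_subfield_set[OF F(1)]]
    by (intro is_minpoly_exists F) (auto simp: algebraic_iff_integral)
  note sr = subfield_set_subring[OF F(1)]
  show "adjoin \<alpha> = ring_adjoin F \<alpha>"
  proof
    show "adjoin \<alpha> \<subseteq> ring_adjoin F \<alpha>"
      unfolding adjoin_eq[OF \<alpha>]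
      by (intro ring_adjoin_min subring_ring_adjoin sr ring_adjoin_gen)
        (use Rats_subset_subfield_set[OF F(1)] ring_adjoin_base[OF sr] in auto)
    show "ring_adjoin F \<alpha> \<subseteq> adjoin \<alpha>"
      by (intro ring_adjoin_min subfield_set_subring subfield_adjoin F in_adjoin \<alpha>)
  qed
qed

lemma algebraic_in_adjoin:
  assumes "algebraic \<alpha>" "x \<in> adjoin \<alpha>"
  shows "algebraic x"
proof -
  have "subring_set {x::complex. algebraic x}"
    using subring_set_integral_closure[OF subring_set_Rats] by (simp add: algebraic_iff_integral)
  hence "ring_adjoin \<rat> \<alpha> \<subseteq> {x. algebraic x}"
    using assms(1) by (intro ring_adjoin_min) (auto simp: rat_imp_algebraic)
  thus ?thesis using assms adjoin_eq by auto
qed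

lemma adjoin_subset: "algebraic x \<Longrightarrow> subfield_set F \<Longrightarrow> x \<in> F \<Longrightarrow> adjoin x \<subseteq> F"
  unfolding adjoin_eq by (intro ring_adjoin_min subfield_set_subring Rats_subset_subfield_set)

section \<open>Norms of units and descent to a reduced representative\<close>

lemma algebraic_int_emb:
  assumes K: "subfield_set K" "\<sigma> \<in> emb K" and x: "x \<in> K" "algebraic_int x"
  shows "algebraic_int (\<sigma> x)"
proof -
  obtain p where p: "lead_coeff p = 1" "\<forall>i. poly.coeff p i \<in> \<int>" "poly p x = 0"
    using x by (auto simp: algebraic_int.simps)
  have Z: "y \<in> K" "\<sigma> y = y" if "y \<in> \<int>" for y
    using that emb_of_int[OF K] subring_set_of_int[OF subfield_set_subring[OF K(1)]] by (auto elim: Ints_cases)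
  have "p \<in> polys_over K" using p Z by (auto simp: polys_over_def)
  from poly_map_emb[OF K this x(1)] have "poly (map_poly \<sigma> p) (\<sigma> x) = 0"
    using p emb_0[OF K] by simp
  moreover have "map_poly \<sigma> p = p"
    using p Z by (auto simp: poly_eq_iff coeff_map_emb[OF K])
  ultimately show ?thesis using p algebraic_int.intros[of p "\<sigma> x"] by simp
qed

lemma algebraic_int_prod:
  "(\<And>i. i \<in> I \<Longrightarrow> algebraic_int (f i)) \<Longrightarrow> algebraic_int (prod f I :: 'a::field)"
  by (induction I rule: infinite_finite_induct) (auto intro: algebraic_int_times int_imp_algebraic_int)

lemma tors_power_iff: "n > 0 \<Longrightarrow> x ^ n \<in> tors \<longleftrightarrow> x \<in> tors"
proof
  assume "n > 0" "x ^ n \<in> tors"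
  then obtain k where "k > 0" "(x ^ n) ^ k = 1" by (auto simp: tors_def)
  thus "x \<in> tors" using \<open>n > 0\<close> unfolding tors_def by (auto intro!: exI[of _ "n * k"] simp: power_mult)
next
  assume "x \<in> tors"
  then obtain k where "k > 0" "x ^ k = 1" by (auto simp: tors_def)
  thus "x ^ n \<in> tors" unfolding tors_def by (auto intro!: exI[of _ k]) (metis mult.commute power_mult power_one)
qed

text \<open>If some power of \<open>\<alpha>\<close> has smaller degree, the norm to the field it generates is not torsion.\<close>

lemma not_reduced_rep_norm:
  assumes \<alpha>: "algebraic_int \<alpha>" "algebraic_int (inverse \<alpha>)" "\<alpha> \<notin> tors" and nr: "\<not> reduced_rep \<alpha>"
  shows "\<exists>F. subfield_set F \<and> F \<subset> adjoin \<alpha> \<and> field_norm F (adjoin \<alpha>) \<alpha> \<notin> tors"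
proof -
  have alg: "algebraic \<alpha>" using \<alpha> by blast
  have nin: "field_norm F (adjoin \<alpha>) \<alpha> \<in> F" if F: "subfield_set F" "F \<subset> adjoin \<alpha>" for F
  proof -
    have "F \<subseteq> adjoin \<alpha>" using F by blast
    from minpoly_exists_over[OF alg F(1) this] adjoin_eq_ring_adjoin[OF alg F(1) this]
    show ?thesis using field_norm_in[OF F(1)] by blast
  qed
  show ?thesis
  proof (cases "\<forall>n>0. alg_degree (\<alpha> ^ n) = alg_degree \<alpha>")
    case True
    thus ?thesis using nr \<alpha> nin unfolding reduced_rep_def subfield_complex_ring_iff by blast
  next
    case False
    then obtain n where n: "n > 0" "alg_degree (\<alpha> ^ n) \<noteq> alg_degree \<alpha>" by blast
    have in_K: "\<alpha> ^ n \<in> adjoin \<alpha>"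
      by (intro subring_set_power subfield_set_subring subfield_adjoin alg in_adjoin)
    have algn: "algebraic (\<alpha> ^ n)" by (rule algebraic_in_adjoin[OF alg in_K])
    define F where "F = adjoin (\<alpha> ^ n)"
    have F: "subfield_set F" unfolding F_def by (rule subfield_adjoin[OF algn])
    have FK: "F \<subseteq> adjoin \<alpha>" unfolding F_def by (intro adjoin_subset algn subfield_adjoin alg in_K)
    have "F \<noteq> adjoin \<alpha>" using n(2) by (auto simp: F_def alg_degree_def)
    obtain m where m: "is_minpoly F \<alpha> m" using minpoly_exists_over[OF alg F FK] by blast
    note K = adjoin_eq_ring_adjoin[OF alg F FK]
    note Kf = subfield_K[OF F m K]
    let ?E = "ext_emb (\<lambda>x. x) F (adjoin \<alpha>)"
    have pow: "\<sigma> \<alpha> ^ n = \<alpha> ^ n" if "\<sigma> \<in> ?E" for \<sigma>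
    proof -
      have "\<sigma> (\<alpha> ^ n) = \<alpha> ^ n" using that in_adjoin[OF algn] by (auto simp: ext_emb_def F_def)
      thus ?thesis using that emb_power[OF Kf _ in_adjoin[OF alg]] by (auto simp: ext_emb_def)
    qed
    \<comment> \<open>Embeddings over F fix \<alpha>^n, so the n-th power of the norm is a positive
      power of \<alpha>, hence not torsion.\<close>
    have "field_norm F (adjoin \<alpha>) \<alpha> ^ n = (\<Prod>\<sigma>\<in>?E. \<sigma> \<alpha> ^ n)"
      by (simp add: field_norm_def embeddings_over_eq prod_power_distrib)
    also have "\<dots> = (\<Prod>\<sigma>\<in>?E. \<alpha> ^ n)" by (intro prod.cong refl pow)
    also have "\<dots> = \<alpha> ^ (n * card ?E)" by (simp add: power_mult)
    finally have "field_norm F (adjoin \<alpha>) \<alpha> ^ n = \<alpha> ^ (n * card ?E)" .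
    moreover have "card ?E > 0"
      using card_ext_emb[OF F id_in_emb[OF F] m] minpoly_degree_pos[OF F m] K by (simp add: ext_emb_id)
    ultimately have "field_norm F (adjoin \<alpha>) \<alpha> \<notin> tors"
      using \<alpha>(3) n(1) tors_power_iff by (metis mult_pos_pos)
    thus ?thesis using F FK \<open>F \<noteq> adjoin \<alpha>\<close> by blast
  qed
qed

text \<open>Degrees are counted by embeddings, so it suffices that \<alpha> has degree above 1 over
  \<open>adjoin x\<close>; degree 1 would put \<alpha> into \<open>adjoin x\<close>.\<close>

lemma alg_degree_less:
  assumes \<alpha>: "algebraic \<alpha>" and F: "subfield_set F" "F \<subset> adjoin \<alpha>" and x: "x \<in> F"
  shows "alg_degree x < alg_degree \<alpha>"
proof -
  have x': "algebraic x" using algebraic_in_adjoin[OF \<alpha>] F x by blast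
  have sub: "adjoin x \<subset> adjoin \<alpha>" using adjoin_subset[OF x' F(1) x] F(2) by blast
  note E = subfield_adjoin[OF x']
  obtain m where m: "is_minpoly (adjoin x) \<alpha> m"
    using minpoly_exists_over[OF \<alpha> E] sub by blast
  have K: "adjoin \<alpha> = ring_adjoin (adjoin x) \<alpha>"
    using adjoin_eq_ring_adjoin[OF \<alpha> E] sub by blast
  have "degree m \<noteq> 1"
  proof
    assume d: "degree m = 1"
    have c: "poly.coeff m 1 = 1" using minpoly_monic[OF E m] d by simp
    have "poly m \<alpha> = poly.coeff m 0 + \<alpha>" using c by (simp add: poly_altdef d)
    hence "\<alpha> = - poly.coeff m 0" using minpoly_root[OF E m] by (simp add: eq_neg_iff_add_eq_0 add.commute)
    hence "\<alpha> \<in> adjoin x"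
      using minpoly_over[OF E m] subring_set_uminus[OF subfield_set_subring[OF E]] by (auto simp: polys_over_def)
    hence "adjoin \<alpha> \<subseteq> adjoin x" by (intro adjoin_subset \<alpha> E)
    thus False using sub by blast
  qed
  hence "degree m > 1" using minpoly_degree_pos[OF E m] by simp
  thus ?thesis
    using card_emb[OF E m K finite_emb_adjoin[OF x']] alg_degree_pos[OF x']
    by (simp add: card_emb_adjoin x' \<alpha>)
qed

theorem reduced_rep_descent:
  assumes "algebraic_int \<alpha>" "algebraic_int (inverse \<alpha>)" "\<alpha> \<noteq> 0" "\<alpha> \<notin> tors"
  shows "\<exists>\<beta>. algebraic_int \<beta> \<and> algebraic_int (inverse \<beta>) \<and> \<beta> \<noteq> 0 \<and> \<beta> \<notin> tors \<and> reduced_rep \<beta> \<and>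
    arch_sum (adjoin \<beta>) \<beta> \<le> arch_sum (adjoin \<alpha>) \<alpha>"
  using assms
proof (induction "alg_degree \<alpha>" arbitrary: \<alpha> rule: less_induct)
  case less
  have alg: "algebraic \<alpha>" using less.prems by blast
  show ?case
  proof (cases "reduced_rep \<alpha>")
    case False
    then obtain F where F: "subfield_set F" "F \<subset> adjoin \<alpha>" and nt: "field_norm F (adjoin \<alpha>) \<alpha> \<notin> tors"
      using not_reduced_rep_norm less.prems by blast
    define N where "N = field_norm F (adjoin \<alpha>) \<alpha>"
    have FK: "F \<subseteq> adjoin \<alpha>" using F by blast
    obtain m where m: "is_minpoly F \<alpha> m" using minpoly_exists_over[OF alg F(1) FK] by blast
    note K = adjoin_eq_ring_adjoin[OF alg F(1) FK]
    note Kf = subfield_adjoin[OF alg]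
    have NF: "N \<in> F" unfolding N_def by (rule field_norm_in[OF F(1) m K])
    have Nalg: "algebraic N" using algebraic_in_adjoin[OF alg] NF FK by blast
    let ?E = "ext_emb (\<lambda>x. x) F (adjoin \<alpha>)"
    have N: "N = (\<Prod>\<sigma>\<in>?E. \<sigma> \<alpha>)" by (simp add: N_def field_norm_def embeddings_over_eq)
    have E: "\<sigma> \<in> emb (adjoin \<alpha>)" if "\<sigma> \<in> ?E" for \<sigma> using that by (simp add: ext_emb_def)
    have fin: "finite ?E"
      using finite_ext_emb[OF F(1) id_in_emb[OF F(1)] m] K by (simp add: ext_emb_id)
    have N0: "N \<noteq> 0"
      unfolding N using less.prems emb_eq_0_iff[OF Kf E in_adjoin[OF alg]] fin by simp
    have Nint: "algebraic_int N" unfolding N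
      by (rule algebraic_int_prod, rule algebraic_int_emb[OF Kf E in_adjoin[OF alg]]) (use less.prems in auto)
    have "inverse N = (\<Prod>\<sigma>\<in>?E. \<sigma> (inverse \<alpha>))"
      unfolding N prod_inversef[symmetric]
      by (intro prod.cong refl) (simp add: emb_inverse[OF Kf E in_adjoin[OF alg]])
    also have "algebraic_int \<dots>"
      by (rule algebraic_int_prod, rule algebraic_int_emb[OF Kf E subfield_set_inverse[OF Kf in_adjoin[OF alg]]])
        (use less.prems in auto)
    finally have Ninv: "algebraic_int (inverse N)" .
    have "alg_degree N < alg_degree \<alpha>" by (rule alg_degree_less[OF alg F NF])
    from less.hyps[OF this Nint Ninv N0] nt obtain \<beta> where \<beta>:
      "algebraic_int \<beta> \<and> algebraic_int (inverse \<beta>) \<and> \<beta> \<noteq> 0 \<and> \<beta> \<notin> tors \<and> reduced_rep \<beta>"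
      "arch_sum (adjoin \<beta>) \<beta> \<le> arch_sum (adjoin N) N" unfolding N_def by blast
    have finF: "finite (emb F)" using finite_emb_iff[OF F(1) m K] finite_emb_adjoin[OF alg] by blast
    \<comment> \<open>F may be larger than \<open>adjoin N\<close>. Restriction maps the embeddings
      of F onto those of \<open>adjoin N\<close>, and a sum of nonnegative terms over an image is at
      most the sum over the source.\<close>
    have "arch_sum (adjoin N) N \<le> arch_sum F N"
    proof -
      have sub: "adjoin N \<subseteq> adjoin \<alpha>" using adjoin_subset[OF Nalg F(1) NF] FK by blast
      note EN = subfield_adjoin[OF Nalg]
      obtain m' where m': "is_minpoly (adjoin N) \<alpha> m'" using minpoly_exists_over[OF alg EN sub] by blast
      note K' = adjoin_eq_ring_adjoin[OF alg EN sub]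
      have img: "(\<lambda>\<tau>. restrict \<tau> (adjoin N)) ` emb F = emb (adjoin N)"
      proof -
        have "emb (adjoin N) = (\<lambda>\<sigma>. restrict \<sigma> (adjoin N)) ` emb (adjoin \<alpha>)"
          using restrict_image_emb[OF EN m' K'] by simp
        also have "\<dots> = (\<lambda>\<sigma>. restrict (restrict \<sigma> F) (adjoin N)) ` emb (adjoin \<alpha>)"
          using adjoin_subset[OF Nalg F(1) NF] by (intro image_cong) (auto simp: restrict_def fun_eq_iff)
        also have "\<dots> = (\<lambda>\<tau>. restrict \<tau> (adjoin N)) ` emb F"
          unfolding restrict_image_emb[OF F(1) m K, symmetric] image_image ..
        finally show ?thesis by simp
      qed
      have "arch_sum (adjoin N) N \<le> (\<Sum>\<tau>\<in>emb F. \<bar>ln (cmod (restrict \<tau> (adjoin N) N))\<bar>)"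
        unfolding arch_sum_def img[symmetric]
        using sum_image_le[OF finF, of "\<lambda>\<sigma>. \<bar>ln (cmod (\<sigma> N))\<bar>" "\<lambda>\<tau>. restrict \<tau> (adjoin N)"]
        by (simp add: o_def)
      thus ?thesis using in_adjoin[OF Nalg] by (simp add: arch_sum_def)
    qed
    also have "\<dots> \<le> arch_sum (adjoin \<alpha>) \<alpha>"
      unfolding N_def by (rule arch_sum_field_norm_le[OF F(1) m K finF less.prems(3)])
    finally show ?thesis using \<beta> order.trans by blast
  qed (use less.prems in blast)
qed

text \<open>The average of \<open>\<bar>ln \<bar>\<sigma> \<beta>\<bar>\<bar>\<close> over the embeddings is unchanged in a common extension of
  \<open>\<rat>(\<beta>)\<close> and \<open>\<rat>(\<gamma>)\<close>, where \<open>\<gamma>/\<beta>\<close> has absolute value \<open>1\<close> under every embedding.\<close>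

lemma arch_sum_tors:
  assumes b: "algebraic \<beta>" "\<beta> \<noteq> 0" and g: "algebraic \<gamma>" and t: "\<gamma> / \<beta> \<in> tors"
  shows "arch_sum (adjoin \<gamma>) \<gamma> * alg_degree \<beta> = arch_sum (adjoin \<beta>) \<beta> * alg_degree \<gamma>"
proof -
  define L where "L = ring_adjoin (adjoin \<beta>) \<gamma>"
  note Fb = subfield_adjoin[OF b(1)] and Fg = subfield_adjoin[OF g]
  note sb = subfield_set_subring[OF Fb] and sg = subfield_set_subring[OF Fg]
  have "integral_over (adjoin \<beta>) \<gamma>" "integral_over (adjoin \<gamma>) \<beta>"
    using g b(1) integral_over_mono[OF Rats_subset_subfield_set[OF Fb]]
      integral_over_mono[OF Rats_subset_subfield_set[OF Fg]] by (auto simp: algebraic_iff_integral)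
  then obtain m m' where m: "is_minpoly (adjoin \<beta>) \<gamma> m" "is_minpoly (adjoin \<gamma>) \<beta> m'"
    using is_minpoly_exists[OF Fb] is_minpoly_exists[OF Fg] by blast
  have "subfield_set (ring_adjoin (adjoin \<beta>) \<gamma>)" "subfield_set (ring_adjoin (adjoin \<gamma>) \<beta>)"
    using subfield_set_ring_adjoin Fb Fg m by blast+
  \<comment> \<open>Both orders of adjunction give the compositum, through which the two fields are
    compared.\<close>
  hence L': "L = ring_adjoin (adjoin \<gamma>) \<beta>"
    unfolding L_def using b(1) g
    by (intro antisym ring_adjoin_min subfield_set_subring adjoin_subset)
      (auto intro: ring_adjoin_gen[OF sb] ring_adjoin_gen[OF sg] ring_adjoin_base[OF sb] ring_adjoin_base[OF sg] in_adjoin)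
  note finb = finite_emb_adjoin[OF b(1)] and fing = finite_emb_adjoin[OF g]
  note Lf = subfield_K[OF Fb m(1) L_def]
  have inL: "\<beta> \<in> L" "\<gamma> \<in> L"
    using F_subset_K[OF Fb m(1) L_def] F_subset_K[OF Fg m(2) L'] in_adjoin b(1) g by blast+
  have eq: "arch_sum L \<gamma> = arch_sum L \<beta>"
    unfolding arch_sum_def
  proof (intro sum.cong refl)
    fix \<sigma> assume s: "\<sigma> \<in> emb L"
    obtain n where n: "n > 0" "(\<gamma> / \<beta>) ^ n = 1" using t by (auto simp: tors_def)
    hence "\<gamma> ^ n = \<beta> ^ n" using b(2) by (simp add: power_divide)
    hence "\<sigma> \<gamma> ^ n = \<sigma> \<beta> ^ n" using emb_power[OF Lf s] inL by metis
    hence "cmod (\<sigma> \<gamma>) ^ n = cmod (\<sigma> \<beta>) ^ n" by (metis norm_power)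
    hence "cmod (\<sigma> \<gamma>) = cmod (\<sigma> \<beta>)" 
      by (rule power_eq_imp_eq_base[OF _ norm_ge_zero norm_ge_zero n(1)])
    thus "\<bar>ln (cmod (\<sigma> \<gamma>))\<bar> = \<bar>ln (cmod (\<sigma> \<beta>))\<bar>" by simp
  qed
  \<comment> \<open>Both products count the embeddings of L.\<close>
  have "alg_degree \<beta> * degree m = alg_degree \<gamma> * degree m'"
    using card_emb[OF Fb m(1) L_def finb] card_emb[OF Fg m(2) L' fing] b(1) g by (simp add: card_emb_adjoin)
  hence c: "real (alg_degree \<beta>) * degree m = real (alg_degree \<gamma>) * degree m'"
    by (simp flip: of_nat_mult)
  have s: "degree m * arch_sum (adjoin \<beta>) \<beta> = degree m' * arch_sum (adjoin \<gamma>) \<gamma>"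
    using arch_sum_adjoin[OF Fb m(1) L_def finb in_adjoin[OF b(1)]]
      arch_sum_adjoin[OF Fg m(2) L' fing in_adjoin[OF g]] eq by simp
  have "degree m' > 0" using minpoly_degree_pos[OF Fg m(2)] .
  have "degree m' * (arch_sum (adjoin \<gamma>) \<gamma> * alg_degree \<beta>) = (degree m * arch_sum (adjoin \<beta>) \<beta>) * alg_degree \<beta>"
    unfolding s by simp
  also have "\<dots> = (alg_degree \<beta> * real (degree m)) * arch_sum (adjoin \<beta>) \<beta>" by simp
  also have "\<dots> = degree m' * (arch_sum (adjoin \<beta>) \<beta> * alg_degree \<gamma>)"
    unfolding c by simp
  finally show ?thesis using \<open>degree m' > 0\<close> by simp
qed

subsection \<open>Absolute values\<close>

locale valued_subfield =
  fixes K :: "complex set" and v :: "complex \<Rightarrow> real"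
  assumes subfield_K: "subfield_set K" and abs_value: "abs_value_on K v"
begin

lemma sr: "subring_set K"
  by (rule subfield_set_subring[OF subfield_K])

lemmas K_closed = subring_set_0[OF sr] subring_set_1[OF sr] subring_set_add[OF sr] subring_set_diff[OF sr]
  subring_set_mult[OF sr] subring_set_uminus[OF sr] subring_set_power[OF sr] subring_set_of_nat[OF sr]
  subring_set_of_int[OF sr] subfield_set_inverse[OF subfield_K] subfield_set_divide[OF subfield_K]

lemma nonneg: "x \<in> K \<Longrightarrow> v x \<ge> 0"
  and eq_0_iff: "x \<in> K \<Longrightarrow> v x = 0 \<longleftrightarrow> x = 0"
  and mult: "x \<in> K \<Longrightarrow> y \<in> K \<Longrightarrow> v (x * y) = v x * v y"
  and triangle: "x \<in> K \<Longrightarrow> y \<in> K \<Longrightarrow> v (x + y) \<le> v x + v y"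
  using abs_value by (auto simp: abs_value_on_def)

lemma zero: "v 0 = 0"
  using eq_0_iff[of 0] K_closed by simp

lemma pos: "x \<in> K \<Longrightarrow> x \<noteq> 0 \<Longrightarrow> v x > 0"
  using nonneg[of x] eq_0_iff[of x] by linarith

lemma one: "v 1 = 1"
  using mult[of 1 1] eq_0_iff[of 1] K_closed by simp

lemma uminus: "x \<in> K \<Longrightarrow> v (- x) = v x"
proof -
  assume x: "x \<in> K"
  have m1: "- 1 \<in> K" by (simp add: K_closed)
  have "v (-1) * v (-1) = 1" using mult[OF m1 m1] one by simp
  hence "v (-1) = 1" using nonneg[OF m1] by (auto simp: square_eq_1_iff)
  thus "v (- x) = v x" using mult[OF m1 x] by simp
qed

lemma diff_le: "x \<in> K \<Longrightarrow> y \<in> K \<Longrightarrow> v (x - y) \<le> v x + v y"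
  using triangle[of x "-y"] uminus[of y] K_closed by simp

lemma diff_commute: "x \<in> K \<Longrightarrow> y \<in> K \<Longrightarrow> v (x - y) = v (y - x)"
  using uminus[of "x - y"] K_closed by simp

lemma diff_ge: "x \<in> K \<Longrightarrow> y \<in> K \<Longrightarrow> v x - v y \<le> v (x - y)"
  using triangle[of "x - y" y] K_closed by simp

lemma add_ge: "x \<in> K \<Longrightarrow> y \<in> K \<Longrightarrow> v x - v y \<le> v (x + y)"
  using diff_ge[of x "-y"] uminus[of y] K_closed by simp

lemma power: "x \<in> K \<Longrightarrow> v (x ^ n) = v x ^ n"
  by (induction n) (auto simp: one mult K_closed)

lemma inverse: "x \<in> K \<Longrightarrow> v (inverse x) = inverse (v x)"
  using mult[of x "inverse x"] one zero K_closed by (cases "x = 0") (auto intro!: inverse_unique[symmetric])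

lemma divide: "x \<in> K \<Longrightarrow> y \<in> K \<Longrightarrow> v (x / y) = v x / v y"
  by (simp add: divide_inverse mult inverse K_closed)

lemma sum_le: "(\<And>i. i \<in> I \<Longrightarrow> f i \<in> K) \<Longrightarrow> v (sum f I) \<le> (\<Sum>i\<in>I. v (f i))"
proof (induction I rule: infinite_finite_induct)
  case (insert i I)
  have "v (f i + sum f I) \<le> v (f i) + v (sum f I)"
    using insert.prems by (intro triangle subring_set_sum[OF sr]) auto
  also have "v (sum f I) \<le> (\<Sum>i\<in>I. v (f i))" by (rule insert.IH) (use insert.prems in auto)
  finally show ?case using insert.hyps by simp
qed (auto simp: zero)

lemma power_int: "x \<in> K \<Longrightarrow> v (x powi k) = v x powi k" "x \<in> K \<Longrightarrow> x powi k \<in> K"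
  by (auto simp: power_int_def power inverse K_closed)

lemma Rats_in: "x \<in> \<rat> \<Longrightarrow> x \<in> K"
  using Rats_subset_subfield_set[OF subfield_K] by blast

end

section \<open>Separating absolute values and weak approximation\<close>

text \<open>Once (b/a)^n exceeds \<rho>, the interval from a^n to b^n is wide enough,
  multiplicatively, to contain an integer power of \<rho>.\<close>

lemma between_powers:
  fixes a b \<rho> :: real
  assumes "0 < a" "a < b" "1 < \<rho>"
  shows "\<exists>n k. a ^ n < \<rho> powi k \<and> \<rho> powi k < b ^ n"
proof -
  have "b / a > 1" using assms by simp
  then obtain n where n: "\<rho> < (b / a) ^ n" using real_arch_pow by blast
  define k where "k = \<lfloor>log \<rho> (a ^ n)\<rfloor> + 1"
  have an: "a ^ n > 0" using assms by simp
  have "a ^ n = \<rho> powr log \<rho> (a ^ n)" using assms an by simp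
  also have "\<dots> < \<rho> powr real_of_int k" using assms by (intro powr_less_mono) (auto simp: k_def)
  finally have 1: "a ^ n < \<rho> powi k" using assms by (simp add: powr_real_of_int')
  have "\<rho> powi k = \<rho> powr real_of_int k" using assms by (simp add: powr_real_of_int')
  also have "\<dots> \<le> \<rho> powr (log \<rho> (a ^ n) + 1)" using assms by (intro powr_mono) (auto simp: k_def)
  also have "\<dots> = a ^ n * \<rho>" using assms an by (simp add: powr_add)
  also have "\<dots> < b ^ n" using n assms by (simp add: power_divide field_simps)
  finally show ?thesis using 1 by blast
qed

text \<open>If w x < v x, some power v(c)^k lies strictly between w(x)^n and v(x)^n; as v and w
  agree at the rational c, the element x^n / c^k separates them. So if nothing separates, v \<le> w,
  and applying this to inverses gives v = w on K.\<close>

lemma abs_values_separate: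
  assumes v: "valued_subfield K v" and w: "valued_subfield K w"
    and agree: "\<And>r. r \<in> \<rat> \<Longrightarrow> v r = w r" and c: "c \<in> \<rat>" "v c > 1" and ne: "\<exists>x\<in>K. v x \<noteq> w x"
  shows "\<exists>x\<in>K. v x > 1 \<and> w x < 1"
proof (rule ccontr)
  interpret V: valued_subfield K v by (rule v)
  interpret W: valued_subfield K w by (rule w)
  assume H: "\<not> ?thesis"
  have le: "v x \<le> w x" if x: "x \<in> K" "x \<noteq> 0" for x
  proof (rule ccontr)
    assume "\<not> v x \<le> w x"
    then obtain n k where nk: "w x ^ n < v c powi k" "v c powi k < v x ^ n"
      using between_powers[of "w x" "v x" "v c"] W.pos[OF x] c by auto
    define y where "y = x ^ n / c powi k"
    have cK: "c \<in> K" by (rule V.Rats_in[OF c(1)])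
    have "y \<in> K" using x cK by (auto simp: y_def V.K_closed V.power_int)
    moreover have "v y = v x ^ n / v c powi k" "w y = w x ^ n / v c powi k"
      using x cK agree[OF c(1)] unfolding y_def
      by (auto simp: V.divide W.divide V.power W.power V.power_int W.power_int V.K_closed)
    moreover have "v c powi k > 0" using c by simp
    ultimately show False using H nk by (auto simp: field_simps)
  qed
  have "v x = w x" if x: "x \<in> K" for x
  proof (cases "x = 0")
    case False
    have "inverse (v x) \<le> inverse (w x)"
      using le[of "inverse x"] x False by (simp add: V.K_closed V.inverse W.inverse)
    hence "w x \<le> v x" using V.pos[OF x False] W.pos[OF x False] by (simp add: field_simps)
    thus ?thesis using le[OF x False] by simp
  qed (simp add: V.zero W.zero)
  thus False using ne by blast
qed

lemma power_at_top: "1 < (x::real) \<Longrightarrow> filterlim (\<lambda>n. x ^ n) at_top sequentially"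
  by (rule filterlim_at_infinity_imp_filterlim_at_top[OF filterlim_realpow_sequentially_gt1]) auto

text \<open>The elements \<open>y^k / (1 + y^k)\<close> tend to \<open>1\<close> or \<open>0\<close> according to whether \<open>v y > 1\<close> or \<open>v y < 1\<close>.\<close>

lemma (in valued_subfield) idempotent_approx_1:
  assumes y: "y \<in> K" "v y > 1"
  shows "(\<lambda>k. v (y ^ k / (1 + y ^ k) - 1)) \<longlonglongrightarrow> 0"
proof (rule tendsto_sandwich)
  show "\<forall>\<^sub>F k in sequentially. 0 \<le> v (y ^ k / (1 + y ^ k) - 1)"
    using y by (intro always_eventually allI nonneg) (auto simp: K_closed)
  have ev: "\<forall>\<^sub>F k in sequentially. v y ^ k > 2"
    using power_at_top[OF y(2)] by (simp add: filterlim_at_top_dense)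
  show "\<forall>\<^sub>F k in sequentially. v (y ^ k / (1 + y ^ k) - 1) \<le> 1 / (v y ^ k - 1)"
    using ev
  proof eventually_elim
    case (elim k)
    have ge: "v y ^ k - 1 \<le> v (1 + y ^ k)"
      using add_ge[of "y ^ k" 1] y by (simp add: power one K_closed add.commute)
    hence "1 + y ^ k \<noteq> 0" using elim zero by auto
    hence "y ^ k / (1 + y ^ k) - 1 = - (1 / (1 + y ^ k))" by (simp add: field_simps)
    hence "v (y ^ k / (1 + y ^ k) - 1) = 1 / v (1 + y ^ k)"
      using y by (simp add: uminus divide one K_closed)
    also have "\<dots> \<le> 1 / (v y ^ k - 1)" using ge elim by (intro divide_left_mono) auto
    finally show ?case .
  qed
  have "filterlim (\<lambda>k. -1 + v y ^ k) at_top sequentially"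
    by (intro filterlim_tendsto_add_at_top[OF tendsto_const] power_at_top y)
  hence "(\<lambda>k. inverse (-1 + v y ^ k)) \<longlonglongrightarrow> 0"
    by (rule tendsto_inverse_0_at_top)
  thus "(\<lambda>k. 1 / (v y ^ k - 1)) \<longlonglongrightarrow> 0" by (simp add: inverse_eq_divide)
qed auto

lemma (in valued_subfield) idempotent_approx_0:
  assumes y: "y \<in> K" "v y < 1"
  shows "(\<lambda>k. v (y ^ k / (1 + y ^ k))) \<longlonglongrightarrow> 0"
proof (rule tendsto_sandwich)
  show "\<forall>\<^sub>F k in sequentially. 0 \<le> v (y ^ k / (1 + y ^ k))"
    using y by (intro always_eventually allI nonneg) (auto simp: K_closed)
  have lim: "(\<lambda>k. v y ^ k) \<longlonglongrightarrow> 0" using y nonneg by (intro LIMSEQ_realpow_zero) auto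
  have ev: "\<forall>\<^sub>F k in sequentially. v y ^ k < 1"
    using order_tendstoD(2)[OF lim, of 1] by simp
  show "\<forall>\<^sub>F k in sequentially. v (y ^ k / (1 + y ^ k)) \<le> v y ^ k / (1 - v y ^ k)"
    using ev
  proof eventually_elim
    case (elim k)
    have ge: "1 - v y ^ k \<le> v (1 + y ^ k)"
      using add_ge[of 1 "y ^ k"] y by (simp add: power one K_closed)
    have "v (y ^ k / (1 + y ^ k)) = v y ^ k / v (1 + y ^ k)"
      using y by (simp add: divide power K_closed)
    also have "\<dots> \<le> v y ^ k / (1 - v y ^ k)"
      using ge elim nonneg[OF y(1)] by (intro divide_left_mono) (auto intro!: mult_pos_pos)
    finally show ?case .
  qed
  have "(\<lambda>k. v y ^ k / (1 - v y ^ k)) \<longlonglongrightarrow> 0 / (1 - 0)" by (intro tendsto_intros lim) auto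
  thus "(\<lambda>k. v y ^ k / (1 - v y ^ k)) \<longlonglongrightarrow> 0" by simp
qed auto

text \<open>In the induction y serves the absolute values treated so far, and x separates v from the
  new w. If w y = 1, the element y^k x works for large k. If w y > 1, the factor y^k is replaced by
  y^k / (1 + y^k), which tends to 1 at v and w and to 0 on W.\<close>

lemma weak_approximation:
  assumes v: "valued_subfield K v" and W: "finite W" "\<And>w. w \<in> W \<Longrightarrow> valued_subfield K w"
    and nt: "\<exists>x\<in>K. v x > 1"
    and sep: "\<And>w. w \<in> W \<Longrightarrow> \<exists>x\<in>K. v x > 1 \<and> w x < 1"
  shows "\<exists>y\<in>K. v y > 1 \<and> (\<forall>w\<in>W. w y < 1)"
  using W(1,2) sep
proof (induction W rule: finite_induct)
  case empty
  thus ?case using nt by blast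
next
  interpret V: valued_subfield K v by (rule v)
  case (insert w W)
  then obtain y where y: "y \<in> K" "v y > 1" "\<And>w. w \<in> W \<Longrightarrow> w y < 1" by auto
  obtain x where x: "x \<in> K" "v x > 1" "w x < 1" using insert.prems(2) by blast
  interpret W: valued_subfield K w using insert.prems(1) by blast
  have vs: "valued_subfield K u" if "u \<in> W" for u using insert.prems(1) that by blast
  consider "w y < 1" | "w y = 1" | "w y > 1" by linarith
  thus ?case
  proof cases
    case 1
    thus ?thesis using y by auto
  next
    case 2
    have "\<forall>\<^sub>F k in sequentially. \<forall>u\<in>W. u (y ^ k * x) < 1"
      unfolding eventually_ball_finite_distrib[OF insert.hyps(1)]
    proof
      fix u assume u: "u \<in> W"
      interpret U: valued_subfield K u by (rule vs[OF u])
      have "(\<lambda>k. u y ^ k * u x) \<longlonglongrightarrow> 0 * u x"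
        using y(3)[OF u] U.nonneg[OF y(1)] by (intro tendsto_intros LIMSEQ_realpow_zero) auto
      hence "\<forall>\<^sub>F k in sequentially. u y ^ k * u x < 1" by (rule order_tendstoD) simp
      thus "\<forall>\<^sub>F k in sequentially. u (y ^ k * x) < 1"
        using x y by (simp add: U.mult U.power U.K_closed)
    qed
    then obtain k where k: "\<forall>u\<in>W. u (y ^ k * x) < 1" using eventually_happens by force
    have "v (y ^ k * x) > 1"
    proof -
      have "1 * v x \<le> v y ^ k * v x" using y x by (intro mult_right_mono one_le_power) auto
      hence "1 < v y ^ k * v x" using x(2) by linarith
      thus ?thesis using x y by (simp add: V.mult V.power V.K_closed)
    qed
    moreover have "w (y ^ k * x) < 1" using 2 x y by (simp add: W.mult W.power W.K_closed)
    moreover have "y ^ k * x \<in> K" using x y by (simp add: V.K_closed)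
    ultimately show ?thesis using k by auto
  next
    case 3
    define e where "e = (\<lambda>k. y ^ k / (1 + y ^ k))"
    have eK: "e k \<in> K" for k using y by (simp add: e_def V.K_closed)
    have one: "(\<lambda>k. u (e k)) \<longlonglongrightarrow> 1" if u: "valued_subfield K u" "u y > 1" for u
    proof -
      interpret U: valued_subfield K u by (rule u)
      have "(\<lambda>k. \<bar>u (e k) - 1\<bar>) \<longlonglongrightarrow> 0"
      proof (rule tendsto_sandwich[of "\<lambda>_. 0"])
        show "\<forall>\<^sub>F k in sequentially. \<bar>u (e k) - 1\<bar> \<le> u (e k - 1)"
        proof (intro always_eventually allI)
          fix k
          show "\<bar>u (e k) - 1\<bar> \<le> u (e k - 1)"
            using U.diff_ge[OF eK[of k] U.K_closed(2)] U.diff_ge[OF U.K_closed(2) eK[of k]]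
              U.diff_commute[OF eK[of k] U.K_closed(2)] U.one by simp
        qed
        show "(\<lambda>k. u (e k - 1)) \<longlonglongrightarrow> 0"
          unfolding e_def by (rule U.idempotent_approx_1[OF y(1) u(2)])
      qed auto
      thus ?thesis by (simp add: tendsto_rabs_zero_iff LIM_zero_iff)
    qed
    have "(\<lambda>k. v (e k) * v x) \<longlonglongrightarrow> 1 * v x" by (intro tendsto_intros one v y)
    hence "\<forall>\<^sub>F k in sequentially. v (e k) * v x > 1" by (rule order_tendstoD) (use x in simp)
    moreover have "(\<lambda>k. w (e k) * w x) \<longlonglongrightarrow> 1 * w x"
      by (intro tendsto_intros one 3 W.valued_subfield_axioms)
    hence "\<forall>\<^sub>F k in sequentially. w (e k) * w x < 1" by (rule order_tendstoD) (use x in simp)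
    moreover have "\<forall>\<^sub>F k in sequentially. \<forall>u\<in>W. u (e k * x) < 1"
      unfolding eventually_ball_finite_distrib[OF insert.hyps(1)]
    proof
      fix u assume u: "u \<in> W"
      interpret U: valued_subfield K u by (rule vs[OF u])
      have "(\<lambda>k. u (e k) * u x) \<longlonglongrightarrow> 0 * u x"
        unfolding e_def by (intro tendsto_intros U.idempotent_approx_0 y u)
      hence "\<forall>\<^sub>F k in sequentially. u (e k) * u x < 1" by (rule order_tendstoD) simp
      thus "\<forall>\<^sub>F k in sequentially. u (e k * x) < 1"
        using x eK by (simp add: U.mult)
    qed
    ultimately have "\<forall>\<^sub>F k in sequentially. v (e k * x) > 1 \<and> w (e k * x) < 1 \<and> (\<forall>u\<in>W. u (e k * x) < 1)"
      by eventually_elim (use x eK in \<open>auto simp: V.mult W.mult\<close>)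
    then obtain k where "v (e k * x) > 1 \<and> w (e k * x) < 1 \<and> (\<forall>u\<in>W. u (e k * x) < 1)"
      using eventually_happens by force
    moreover have "e k * x \<in> K" using x eK by (simp add: V.K_closed)
    ultimately show ?thesis by auto
  qed
qed

lemma dependent_over:
  assumes dim: "CR.dimension n F L" and F: "subfield_set F" and xs: "set xs \<subseteq> L" "length xs > n"
  shows "\<exists>c. (\<forall>i<length xs. c i \<in> F) \<and> (\<exists>i<length xs. c i \<noteq> 0) \<and> (\<Sum>i<length xs. c i * xs ! i) = 0"
proof -
  have sF: "subfield F complex_ring" by (simp add: subfield_complex_ring_iff F)
  have "\<not> CR.independent F xs"
    using CR.independent_length_le_dimension[OF sF dim _ xs(1)] xs(2) by auto
  moreover have "set xs \<subseteq> carrier complex_ring" by (simp add: complex_ring_simps)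
  ultimately obtain Ks where Ks: "length Ks = length xs" "CR.combine Ks xs = \<zero>\<^bsub>complex_ring\<^esub>"
    "set Ks \<subseteq> F" "set Ks \<noteq> {\<zero>\<^bsub>complex_ring\<^esub>}"
    using CR.dependent_imp_non_trivial_combine[OF sF] by metis
  have "xs \<noteq> []" using xs by auto
  hence "\<exists>i<length xs. Ks ! i \<noteq> 0"
    using Ks(1,4) by (auto simp: complex_ring_simps set_conv_nth) (metis length_greater_0_conv)
  moreover have "Ks ! i \<in> F" if "i < length xs" for i using Ks(1,3) that by auto
  moreover have "(\<Sum>i<length xs. Ks ! i * xs ! i) = 0"
    using Ks(1,2) by (simp add: combine_complex_ring complex_ring_simps)
  ultimately show ?thesis by blast
qed

text \<open>Elements close to 1 at one member of W and close to 0 at the others are linearly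
  independent over \<rat>: in a relation, the coefficient of largest value would be at most half of
  itself. The coefficients can be compared across W because all members agree on \<rat>.\<close>

lemma card_separated_le:
  assumes dim: "CR.dimension d \<rat> K" and K: "subfield_set K"
    and W: "finite W" "\<And>w. w \<in> W \<Longrightarrow> valued_subfield K w"
    and agree: "\<And>v w r. v \<in> W \<Longrightarrow> w \<in> W \<Longrightarrow> r \<in> \<rat> \<Longrightarrow> v r = w r"
    and nt: "\<And>v. v \<in> W \<Longrightarrow> \<exists>c\<in>\<rat>. v c > 1"
    and ne: "\<And>v w. v \<in> W \<Longrightarrow> w \<in> W \<Longrightarrow> v \<noteq> w \<Longrightarrow> \<exists>x\<in>K. v x \<noteq> w x"
  shows "card W \<le> d"
proof (rule ccontr)
  assume "\<not> card W \<le> d"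
  obtain ws where ws: "set ws = W" "distinct ws" using finite_distinct_list[OF W(1)] by blast
  define n where "n = length ws"
  have n: "n = card W" using ws distinct_card by (force simp: n_def)
  hence n_gt: "n > d" using \<open>\<not> card W \<le> d\<close> by simp
  have wW: "ws ! i \<in> W" if "i < n" for i using that ws by (auto simp: n_def)
  \<comment> \<open>Each of the n terms estimated at the end is at most \<epsilon> times the largest
    coefficient, so their sum is at most half of it.\<close>
  define \<epsilon> where "\<epsilon> = 1 / (2 * real n)"
  have \<epsilon>: "\<epsilon> > 0" using n_gt by (simp add: \<epsilon>_def)
  have "\<exists>x\<in>K. v (x - 1) < \<epsilon> \<and> (\<forall>w\<in>W - {v}. w x < \<epsilon>)" if v: "v \<in> W" for v
  proof -
    have "\<exists>y\<in>K. v y > 1 \<and> (\<forall>w\<in>W-{v}. w y < 1)"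
    proof (rule weak_approximation)
      interpret V: valued_subfield K v by (rule W(2)[OF v])
      show "valued_subfield K v" by (rule W(2)[OF v])
      show "finite (W - {v})" using W by simp
      show "valued_subfield K w" if "w \<in> W - {v}" for w using W that by blast
      show "\<exists>x\<in>K. 1 < v x" using nt[OF v] V.Rats_in by blast
      fix w assume w: "w \<in> W - {v}"
      obtain c where "c \<in> \<rat>" "v c > 1" using nt[OF v] by blast
      with w v show "\<exists>x\<in>K. 1 < v x \<and> w x < 1"
        by (intro abs_values_separate[where c = c] W agree ne) auto
    qed
    then obtain y where y: "y \<in> K" "v y > 1" "\<And>w. w \<in> W - {v} \<Longrightarrow> w y < 1" by blast
    interpret V: valued_subfield K v by (rule W(2)[OF v])
    have "\<forall>\<^sub>F k in sequentially. v (y ^ k / (1 + y ^ k) - 1) < \<epsilon>"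
      by (rule order_tendstoD(2)[OF V.idempotent_approx_1[OF y(1,2)] \<epsilon>])
    moreover have "\<forall>\<^sub>F k in sequentially. \<forall>w\<in>W-{v}. w (y ^ k / (1 + y ^ k)) < \<epsilon>"
    proof (subst eventually_ball_finite_distrib, use W in simp, intro ballI)
      fix w assume w: "w \<in> W - {v}"
      then interpret W: valued_subfield K w using W by blast
      show "\<forall>\<^sub>F k in sequentially. w (y ^ k / (1 + y ^ k)) < \<epsilon>"
        by (rule order_tendstoD(2)[OF W.idempotent_approx_0[OF y(1) y(3)[OF w]] \<epsilon>])
    qed
    ultimately have "\<forall>\<^sub>F k in sequentially. v (y ^ k / (1 + y ^ k) - 1) < \<epsilon> \<and>
        (\<forall>w\<in>W-{v}. w (y ^ k / (1 + y ^ k)) < \<epsilon>)" by (rule eventually_conj)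
    then obtain k where "v (y ^ k / (1 + y ^ k) - 1) < \<epsilon>" "\<forall>w\<in>W-{v}. w (y ^ k / (1 + y ^ k)) < \<epsilon>"
      using eventually_happens by force
    moreover have "y ^ k / (1 + y ^ k) \<in> K" using y by (simp add: V.K_closed)
    ultimately show ?thesis by blast
  qed
  then obtain e where e: "\<And>v. v \<in> W \<Longrightarrow> e v \<in> K \<and> v (e v - 1) < \<epsilon> \<and> (\<forall>w\<in>W - {v}. w (e v) < \<epsilon>)"
    by metis
  have "set (map e ws) \<subseteq> K" using e ws by auto
  from dependent_over[OF dim subfield_set_Rats this] n_gt obtain c where c:
    "\<And>i. i < n \<Longrightarrow> c i \<in> \<rat>" "\<exists>i<n. c i \<noteq> 0" "(\<Sum>i<n. c i * e (ws ! i)) = 0"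
    by (auto simp: n_def)
  have "n > 0" using n_gt by simp
  \<comment> \<open>The sizes of the rational coefficients are the same at every member of W; the
    first one is used to define them.\<close>
  define N where "N = (\<lambda>i. (ws ! 0) (c i))"
  obtain j where j: "j < n" "\<And>i. i < n \<Longrightarrow> N i \<le> N j"
  proof -
    have "Max (N ` {..<n}) \<in> N ` {..<n}" using \<open>n > 0\<close> by (intro Max_in) auto
    then obtain j where "j < n" "N j = Max (N ` {..<n})" by auto
    thus thesis using that[of j] by simp
  qed
  interpret V: valued_subfield K "ws ! j" by (rule W(2)[OF wW[OF j(1)]])
  let ?v = "ws ! j"
  have N: "N i = ?v (c i)" if "i < n" for i
    unfolding N_def using c(1)[OF that] by (intro agree wW \<open>n > 0\<close> j)
  have cK: "c i \<in> K" if "i < n" for i using c(1)[OF that] V.Rats_in by blast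
  have eK: "e (ws ! i) \<in> K" if "i < n" for i using e wW[OF that] by blast
  obtain i0 where i0: "i0 < n" "c i0 \<noteq> 0" using c(2) by blast
  hence "N i0 > 0" using N V.pos cK by simp
  hence Nj: "N j > 0" using j(2)[OF i0(1)] by simp
  \<comment> \<open>Subtracting 1 from the j-th element moves c j to the other side, and all
    remaining factors are small at the j-th absolute value.\<close>
  have "c j = - (\<Sum>i<n. c i * (e (ws ! i) - (if i = j then 1 else 0)))"
  proof -
    have "(\<Sum>i<n. c i * (if i = j then 1 else 0)) = (\<Sum>i<n. if i = j then c i else 0)"
      by (intro sum.cong) auto
    also have "\<dots> = c j" using j(1) by (simp add: sum.delta)
    finally show ?thesis using c(3) unfolding right_diff_distrib sum_subtractf by simp
  qed
  moreover have "(\<Sum>i<n. c i * (e (ws ! i) - (if i = j then 1 else 0))) \<in> K"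
    using cK eK by (intro subring_set_sum[OF V.sr]) (auto simp: V.K_closed)
  ultimately have "N j = ?v (\<Sum>i<n. c i * (e (ws ! i) - (if i = j then 1 else 0)))"
    using N[OF j(1)] V.uminus by simp
  also have "\<dots> \<le> (\<Sum>i<n. ?v (c i * (e (ws ! i) - (if i = j then 1 else 0))))"
    using cK eK by (intro V.sum_le) (auto simp: V.K_closed)
  also have "\<dots> \<le> (\<Sum>i<n. N j * \<epsilon>)"
  proof (intro sum_mono)
    fix i assume i: "i \<in> {..<n}"
    have "?v (e (ws ! i) - (if i = j then 1 else 0)) \<le> \<epsilon>"
    proof (cases "i = j")
      case True
      thus ?thesis using e[OF wW[OF j(1)]] by simp
    next
      case False
      hence "ws ! j \<noteq> ws ! i" using ws(2) i j(1) by (auto simp: nth_eq_iff_index_eq n_def)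
      hence "?v (e (ws ! i)) < \<epsilon>" using e[OF wW[of i]] wW[OF j(1)] i by auto
      thus ?thesis using False by simp
    qed
    moreover have "?v (c i) \<le> N j" using j(2)[of i] N[of i] i by simp
    ultimately show "?v (c i * (e (ws ! i) - (if i = j then 1 else 0))) \<le> N j * \<epsilon>"
      using cK eK i Nj by (auto simp: V.mult V.K_closed V.nonneg intro!: mult_mono)
  qed
  also have "\<dots> = N j / 2" using \<open>n > 0\<close> by (simp add: \<epsilon>_def)
  finally show False using Nj by simp
qed

section \<open>Ultrametric inequalities\<close>

text \<open>Bernoulli's inequality for the square root of r, squared, gives quadratic growth of r^n,
  which a linear bound excludes.\<close>

lemma le_one_if_power_le_linear:
  fixes r :: real
  assumes r: "r \<ge> 0" "\<And>n. r ^ n \<le> real n + 1"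
  shows "r \<le> 1"
proof (rule ccontr)
  assume "\<not> r \<le> 1"
  hence d: "sqrt r - 1 > 0" by simp
  then obtain n where n: "1 / (sqrt r - 1)\<^sup>2 \<le> real n" using real_arch_simple by blast
  have "1 + real n * (sqrt r - 1) \<le> (1 + (sqrt r - 1)) ^ n" by (rule Bernoulli_inequality) (use d in auto)
  hence "(1 + real n * (sqrt r - 1))\<^sup>2 \<le> (sqrt r ^ n)\<^sup>2" using d by (intro power_mono) auto
  also have "\<dots> = r ^ n" using r(1) by (simp add: power_mult_distrib flip: power_mult) (simp add: power_mult mult.commute[of n])
  also have "\<dots> \<le> real n + 1" by (rule r)
  finally have "1 + 2 * real n * (sqrt r - 1) + real n * (real n * (sqrt r - 1)\<^sup>2) \<le> real n + 1"
    by (simp add: power2_eq_square algebra_simps)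
  moreover have "real n * 1 \<le> real n * (real n * (sqrt r - 1)\<^sup>2)"
    using n d by (intro mult_left_mono) (auto simp: divide_le_eq)
  moreover have "real n > 0" using n d by (smt (verit) zero_less_divide_1_iff zero_less_power)
  hence "2 * real n * (sqrt r - 1) > 0" using d by simp
  ultimately show False by simp
qed

locale nonarch_subfield = valued_subfield +
  assumes nat_le: "v (of_nat n) \<le> 1"
begin

text \<open>The binomial coefficients have value at most 1, so expanding (x + y)^n bounds v(x + y)^n
  by (n + 1) M^n; the factor n + 1 is removed by \<open>le_one_if_power_le_linear\<close>.\<close>

lemma add_le_max:
  assumes x: "x \<in> K" and y: "y \<in> K"
  shows "v (x + y) \<le> max (v x) (v y)"
proof -
  define M where "M = max (v x) (v y)"
  have M0: "M \<ge> 0" using nonneg[OF x] by (simp add: M_def le_max_iff_disj)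
  show ?thesis
  proof (cases "M = 0")
    case True
    hence "v x = 0" "v y = 0" using nonneg[OF x] nonneg[OF y] by (auto simp: M_def max_def split: if_splits)
    thus ?thesis using triangle[OF x y] by simp
  next
    case False
    hence M: "M > 0" using M0 by simp
    have "(v (x + y) / M) ^ n \<le> real n + 1" for n
    proof -
      have "v (x + y) ^ n = v (\<Sum>k\<le>n. of_nat (n choose k) * x ^ k * y ^ (n - k))"
        using x y by (simp add: power[symmetric] K_closed binomial_ring)
      also have "\<dots> \<le> (\<Sum>k\<le>n. v (of_nat (n choose k) * x ^ k * y ^ (n - k)))"
        using x y by (intro sum_le) (auto simp: K_closed)
      also have "\<dots> \<le> (\<Sum>k\<le>n. M ^ n)"
      proof (intro sum_mono)
        fix k assume k: "k \<in> {..n}"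
        have "v (of_nat (n choose k) * x ^ k * y ^ (n - k)) = v (of_nat (n choose k)) * (v x ^ k * v y ^ (n - k))"
          using x y by (simp add: mult power K_closed)
        also have "\<dots> \<le> 1 * (M ^ k * M ^ (n - k))"
          using nat_le nonneg x y M by (intro mult_mono power_mono) (auto simp: M_def)
        finally show "v (of_nat (n choose k) * x ^ k * y ^ (n - k)) \<le> M ^ n"
          using k by (simp flip: power_add)
      qed
      finally show ?thesis using M by (simp add: power_divide divide_le_eq algebra_simps)
    qed
    hence "v (x + y) / M \<le> 1"
      using M nonneg[of "x + y"] x y by (intro le_one_if_power_le_linear) (auto simp: K_closed)
    thus ?thesis using M by (simp add: M_def)
  qed
qed

lemma sum_le_bound:
  assumes "\<And>i. i \<in> I \<Longrightarrow> f i \<in> K" "\<And>i. i \<in> I \<Longrightarrow> v (f i) \<le> M" "M \<ge> 0"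
  shows "v (sum f I) \<le> M"
  using assms
proof (induction I rule: infinite_finite_induct)
  case (insert i I)
  have "v (f i + sum f I) \<le> max (v (f i)) (v (sum f I))"
    using insert.prems by (intro add_le_max subring_set_sum[OF sr]) auto
  also have "\<dots> \<le> M" using insert by simp
  finally show ?case using insert.hyps by simp
qed (auto simp: zero)

lemma int_le: "v (of_int n) \<le> 1"
proof (cases n)
  case (neg m)
  have "of_int n = - (of_nat (Suc m) :: complex)" using neg by simp
  thus ?thesis using uminus nat_le K_closed by metis
qed (use nat_le in simp)

text \<open>The leading term of an integer equation for \<open>x\<close> dominates if \<open>v x > 1\<close>.\<close>

lemma integer_root_le_1:
  assumes p: "\<And>i. poly.coeff p i \<in> \<int>" "poly p x = 0" "p \<noteq> 0" and x: "x \<in> K" and lc: "v (lead_coeff p) = 1"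
  shows "v x \<le> 1"
proof (rule ccontr)
  assume "\<not> v x \<le> 1"
  hence gt: "v x > 1" by simp
  have cK: "poly.coeff p i \<in> K" "v (poly.coeff p i) \<le> 1" for i
    using p(1)[of i] int_le K_closed by (auto elim!: Ints_cases)
  define n where "n = degree p"
  have "n \<noteq> 0"
  proof
    assume "n = 0"
    then obtain a where "p = [:a:]" by (auto simp: n_def elim: degree_eq_zeroE)
    thus False using p by auto
  qed
  then obtain k where k: "n = Suc k" by (cases n) auto
  have "0 = (\<Sum>i\<le>n. poly.coeff p i * x ^ i)" using p by (simp add: poly_altdef n_def)
  also have "\<dots> = poly.coeff p n * x ^ n + (\<Sum>i\<le>k. poly.coeff p i * x ^ i)" by (simp add: k)
  finally have eq: "poly.coeff p n * x ^ n = - (\<Sum>i\<le>k. poly.coeff p i * x ^ i)"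
    by (simp add: eq_neg_iff_add_eq_0)
  have sumK: "(\<Sum>i\<le>k. poly.coeff p i * x ^ i) \<in> K"
    using cK x by (intro subring_set_sum[OF sr]) (auto simp: K_closed)
  have "v x ^ n = v (poly.coeff p n * x ^ n)" using lc x cK by (simp add: mult power K_closed n_def)
  also have "\<dots> = v (\<Sum>i\<le>k. poly.coeff p i * x ^ i)" unfolding eq by (rule uminus[OF sumK])
  also have "\<dots> \<le> v x ^ k"
  proof (rule sum_le_bound)
    fix i assume "i \<in> {..k}"
    hence "v (poly.coeff p i) * v x ^ i \<le> 1 * v x ^ k"
      using cK gt by (intro mult_mono power_increasing) auto
    thus "v (poly.coeff p i * x ^ i) \<le> v x ^ k" using cK x by (simp add: mult power K_closed)
  qed (use cK x gt in \<open>auto simp: K_closed\<close>)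
  finally show False using gt k by simp
qed

lemma algebraic_int_le_1:
  assumes x: "x \<in> K" "algebraic_int x"
  shows "v x \<le> 1"
proof -
  obtain p where p: "lead_coeff p = 1" "\<forall>i. poly.coeff p i \<in> \<int>" "poly p x = 0"
    using x by (auto simp: algebraic_int.simps)
  have "p \<noteq> 0" using p(1) by auto
  thus ?thesis using integer_root_le_1[of p x] p x one by simp
qed

lemma algebraic_unit_eq_1:
  assumes x: "x \<in> K" "algebraic_int x" "algebraic_int (inverse x)" "x \<noteq> 0"
  shows "v x = 1"
proof (rule antisym)
  show "v x \<le> 1" using algebraic_int_le_1 x by blast
  have "v (inverse x) \<le> 1" using algebraic_int_le_1[of "inverse x"] x by (simp add: K_closed)
  thus "1 \<le> v x" using pos[of x] x by (simp add: inverse inverse_le_1_iff)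
qed

end

subsection \<open>Places\<close>

definition arch_places :: "complex set \<Rightarrow> (complex \<Rightarrow> real) set" where
  "arch_places K = {v \<in> places K. \<forall>r::rat. v (of_rat r) = \<bar>of_rat r\<bar>}"

text \<open>Primality is part of membership, so the set is empty for other p and unions may range
  over arbitrary naturals.\<close>

definition padic_places :: "complex set \<Rightarrow> nat \<Rightarrow> (complex \<Rightarrow> real) set" where
  "padic_places K p = {v \<in> places K. Factorial_Ring.prime p \<and> (\<forall>r::rat. v (of_rat r) = padic_abs p r)}"

lemma places_cases: "v \<in> places K \<Longrightarrow> v \<in> arch_places K \<or> (\<exists>p. v \<in> padic_places K p)"
  by (auto simp: places_def arch_places_def padic_places_def)

lemma place_valued: "v \<in> places K \<Longrightarrow> subfield_set K \<Longrightarrow> valued_subfield K v"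
  by (auto simp: places_def valued_subfield_def)

lemma padic_abs_of_int:
  "n \<noteq> 0 \<Longrightarrow> padic_abs p (of_int n) = inverse (real p ^ multiplicity (int p) n)"
  by (simp add: padic_abs_def power_int_minus)

lemma padic_abs_int: "Factorial_Ring.prime p \<Longrightarrow> padic_abs p (of_int n) \<le> 1"
proof (cases "n = 0")
  case False
  assume "Factorial_Ring.prime p"
  hence "1 \<le> real p" using prime_ge_1_nat by simp
  hence "1 \<le> real p ^ multiplicity (int p) n" by (rule one_le_power)
  thus ?thesis unfolding padic_abs_of_int[OF False] by (intro inverse_le_1_iff[THEN iffD2]) auto
qed (simp add: padic_abs_def)

lemma padic_abs_not_dvd: "\<not> int p dvd n \<Longrightarrow> padic_abs p (of_int n) = 1"
proof -
  assume n: "\<not> int p dvd n"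
  hence "n \<noteq> 0" by auto
  thus ?thesis using n by (simp add: padic_abs_of_int not_dvd_imp_multiplicity_0)
qed

lemma padic_abs_self: "Factorial_Ring.prime p \<Longrightarrow> padic_abs p (of_nat p) = 1 / real p"
proof -
  assume p: "Factorial_Ring.prime p"
  hence "multiplicity (int p) (int p) = 1" by (intro multiplicity_self) auto
  moreover have "int p \<noteq> 0" using p prime_gt_0_nat by fastforce
  ultimately show ?thesis using padic_abs_of_int[of "int p" p] by (simp add: inverse_eq_divide)
qed

lemma padic_place_nonarch: "v \<in> padic_places K p \<Longrightarrow> subfield_set K \<Longrightarrow> nonarch_subfield K v"
proof -
  assume v: "v \<in> padic_places K p" and K: "subfield_set K"
  interpret valued_subfield K v using v K place_valued by (auto simp: padic_places_def)
  show ?thesis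
  proof unfold_locales
    fix n
    have "v (of_rat (of_int (int n))) = padic_abs p (of_int (int n))" "Factorial_Ring.prime p"
      using v unfolding padic_places_def by blast+
    thus "v (of_nat n) \<le> 1" using padic_abs_int[of p "int n"] by simp
  qed
qed

lemma cmod_of_rat: "cmod (of_rat r) = \<bar>of_rat r\<bar>"
proof -
  obtain a b where "r = of_int a / of_int b" by (metis quotient_of_div surj_pair)
  thus ?thesis by (simp add: of_rat_divide norm_divide)
qed

lemma arch_place_Rats: "v \<in> arch_places K \<Longrightarrow> r \<in> \<rat> \<Longrightarrow> v r = cmod r"
  by (auto simp: arch_places_def cmod_of_rat elim!: Rats_cases)

lemma padic_place_Rats: "v \<in> padic_places K p \<Longrightarrow> w \<in> padic_places K p \<Longrightarrow> r \<in> \<rat> \<Longrightarrow> v r = w r"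
  by (auto simp: padic_places_def elim!: Rats_cases)

lemma place_eqI: "v \<in> places K \<Longrightarrow> w \<in> places K \<Longrightarrow> (\<And>x. x \<in> K \<Longrightarrow> v x = w x) \<Longrightarrow> v = w"
  by (rule extensionalityI[of _ K]) (auto simp: places_def)

text \<open>Distinct places over the same rational prime are independent, so there are at most \<open>[K:\<rat>]\<close>.\<close>

lemma finite_padic_places:
  assumes dim: "CR.dimension d \<rat> K" and K: "subfield_set K"
  shows "finite (padic_places K p)"
proof (rule ccontr)
  assume "infinite (padic_places K p)"
  then obtain W where W: "finite W" "card W = Suc d" "W \<subseteq> padic_places K p"
    using infinite_arbitrarily_large by metis
  have "card W \<le> d"
  proof (rule card_separated_le[OF dim K W(1)])
    fix v assume "v \<in> W"
    hence v: "v \<in> padic_places K p" using W by blast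
    thus vs: "valued_subfield K v" by (auto simp: padic_places_def intro: place_valued K)
    have p: "Factorial_Ring.prime p" "v (of_rat (of_nat p)) = padic_abs p (of_nat p)"
      using v unfolding padic_places_def by blast+
    hence vp: "v (of_nat p) = 1 / real p" using padic_abs_self by simp
    interpret valued_subfield K v by (rule vs)
    have "v (inverse (of_nat p)) = real p"
      using inverse[of "of_nat p"] vp K_closed by (simp add: inverse_eq_divide)
    thus "\<exists>c\<in>\<rat>. 1 < v c"
      using p(1) prime_gt_1_nat by (intro bexI[of _ "inverse (of_nat p)"]) auto
    fix w assume "w \<in> W"
    hence w: "w \<in> padic_places K p" using W by blast
    show "v r = w r" if "r \<in> \<rat>" for r by (rule padic_place_Rats[OF v w that])
    show "\<exists>x\<in>K. v x \<noteq> w x" if "v \<noteq> w"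
      using place_eqI[of v K w] v w that by (auto simp: padic_places_def)
  qed
  thus False using W by simp
qed

section \<open>Archimedean places come from embeddings\<close>

text \<open>The polynomial with roots -|z| majorises the one with roots z coefficientwise, by the
  triangle inequality at each added factor.\<close>

lemma coeff_prod_linear_le:
  fixes Z :: "complex set"
  assumes "finite Z"
  shows "cmod (poly.coeff (\<Prod>z\<in>Z. [:-z, 1:]) i) \<le> poly.coeff (\<Prod>z\<in>Z. [:cmod z, 1:]) i"
  using assms
proof (induction Z arbitrary: i rule: finite_induct)
  case empty
  thus ?case by simp
next
  case (insert z Z)
  let ?P = "\<Prod>z\<in>Z. [:-z, 1:]" and ?Q = "\<Prod>z\<in>Z. [:cmod z, 1:]"
  have "cmod (poly.coeff ([:-z, 1:] * ?P) i) \<le> poly.coeff ([:cmod z, 1:] * ?Q) i"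
  proof (cases i)
    case 0
    thus ?thesis using insert.IH[of 0] by (simp add: norm_mult mult_left_mono)
  next
    case (Suc j)
    have "cmod (poly.coeff ([:-z, 1:] * ?P) i) = cmod (poly.coeff ?P j - z * poly.coeff ?P i)"
      using Suc by simp
    also have "\<dots> \<le> cmod (poly.coeff ?P j) + cmod z * cmod (poly.coeff ?P i)"
      by (metis norm_mult norm_triangle_ineq4)
    also have "\<dots> \<le> poly.coeff ?Q j + cmod z * poly.coeff ?Q i"
      by (intro add_mono mult_left_mono insert.IH) auto
    finally show ?thesis using Suc by simp
  qed
  thus ?case using insert.hyps by simp
qed

lemma sum_coeff_prod_linear_le:
  fixes Z :: "complex set" and t :: real
  assumes Z: "finite Z" and t: "t \<ge> 0"
  shows "(\<Sum>i\<le>card Z. cmod (poly.coeff (\<Prod>z\<in>Z. [:-z, 1:]) i) * t ^ i) \<le> (\<Prod>z\<in>Z. cmod z + t)"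
proof -
  let ?Q = "\<Prod>z\<in>Z. [:cmod z, 1:]"
  have deg: "degree ?Q = card Z" by (subst degree_prod_eq_sum_degree) auto
  have "(\<Sum>i\<le>card Z. cmod (poly.coeff (\<Prod>z\<in>Z. [:-z, 1:]) i) * t ^ i) \<le> (\<Sum>i\<le>card Z. poly.coeff ?Q i * t ^ i)"
    using t by (intro sum_mono mult_right_mono coeff_prod_linear_le Z) auto
  also have "\<dots> = poly ?Q t" by (simp add: poly_altdef deg)
  finally show ?thesis by (simp add: poly_prod)
qed

lemma minpoly_Rats_decomp:
  fixes x :: complex
  assumes m: "is_minpoly \<rat> x m"
  shows "m = (\<Prod>z | poly m z = 0. [:-z, 1:])" "card {z. poly m z = 0} = degree m" "finite {z. poly m z = 0}"
proof -
  have "map_poly (restrict (\<lambda>x. x) \<rat>) m = m"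
    using minpoly_over[OF subfield_set_Rats m] by (auto simp: poly_eq_iff coeff_map_poly polys_over_def)
  thus "m = (\<Prod>z | poly m z = 0. [:-z, 1:])" "card {z. poly m z = 0} = degree m"
    using map_emb_minpoly_decomp[OF subfield_set_Rats id_in_emb[OF subfield_set_Rats] m]
      card_roots_map_emb_minpoly[OF subfield_set_Rats id_in_emb[OF subfield_set_Rats] m] by simp_all
  show "finite {z. poly m z = 0}" using minpoly_nonzero[OF subfield_set_Rats m] by (rule poly_roots_finite)
qed

text \<open>A root of the minimal polynomial of y gives an embedding of \<open>adjoin y\<close>,
  which then extends to \<open>adjoin \<alpha>\<close>.\<close>

lemma minpoly_root_emb:
  assumes \<alpha>: "algebraic \<alpha>" and y: "y \<in> adjoin \<alpha>" and m: "is_minpoly \<rat> y m" and z: "poly m z = 0"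
  shows "\<exists>\<sigma>\<in>emb (adjoin \<alpha>). \<sigma> y = z"
proof -
  have alg: "algebraic y" by (rule algebraic_in_adjoin[OF \<alpha> y])
  note Ey = subfield_adjoin[OF alg]
  have sub: "adjoin y \<subseteq> adjoin \<alpha>" by (rule adjoin_subset[OF alg subfield_adjoin[OF \<alpha>] y])
  have mm: "map_poly (restrict (\<lambda>x. x) \<rat>) m = m"
    using minpoly_over[OF subfield_set_Rats m] by (auto simp: poly_eq_iff coeff_map_poly polys_over_def)
  have "z \<in> (\<lambda>\<sigma>. \<sigma> y) ` ext_emb (restrict (\<lambda>x. x) \<rat>) \<rat> (ring_adjoin \<rat> y)"
    using ext_emb_bij[OF subfield_set_Rats id_in_emb[OF subfield_set_Rats] m] z mm
    by (auto simp: bij_betw_def)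
  then obtain \<tau> where \<tau>: "\<tau> \<in> emb (adjoin y)" "\<tau> y = z"
    by (auto simp: ext_emb_def adjoin_eq[OF alg])
  obtain m' where m': "is_minpoly (adjoin y) \<alpha> m'" using minpoly_exists_over[OF \<alpha> Ey sub] by blast
  have "\<tau> \<in> (\<lambda>\<sigma>. restrict \<sigma> (adjoin y)) ` emb (adjoin \<alpha>)"
    using restrict_image_emb[OF Ey m' adjoin_eq_ring_adjoin[OF \<alpha> Ey sub]] \<tau> by blast
  thus ?thesis using \<tau>(2) in_adjoin[OF alg] by auto
qed

lemma emb_arch_place:
  assumes K: "subfield_set K" and s: "\<sigma> \<in> emb K"
  shows "restrict (\<lambda>x. cmod (\<sigma> x)) K \<in> arch_places K"
proof -
  note sr = subfield_set_subring[OF K]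
  have "abs_value_on K (restrict (\<lambda>x. cmod (\<sigma> x)) K)"
    using emb_eq_0_iff[OF K s] emb_mult[OF K s] emb_add[OF K s]
    by (auto simp: abs_value_on_def norm_mult norm_triangle_ineq subring_set_mult[OF sr] subring_set_add[OF sr])
  moreover have "restrict (\<lambda>x. cmod (\<sigma> x)) K (of_rat r) = \<bar>of_rat r\<bar>" for r
    using subsetD[OF Rats_subset_subfield_set[OF K], of "of_rat r"] emb_Rats[OF K s, of "of_rat r"]
    by (simp add: cmod_of_rat)
  ultimately show ?thesis by (simp add: arch_places_def places_def)
qed

text \<open>With T = v y and n the degree of y, the minimal equation bounds T^n by the sum of |c_i|
  T^i over i < n, since v is the usual absolute value on \<rat>. Adding T^n bounds 2 T^n by the
  product of |z| + T over the conjugates z, hence by (1 + T)^n. Passing from n to the degree of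
  \<alpha> makes the exponent the same for all powers of an element, as
  \<open>arch_places_eq\<close> requires.\<close>

lemma arch_place_small_conjugates:
  assumes \<alpha>: "algebraic \<alpha>" and v: "v \<in> arch_places (adjoin \<alpha>)" and y: "y \<in> adjoin \<alpha>" "v y > 0"
    and small: "\<And>\<sigma>. \<sigma> \<in> emb (adjoin \<alpha>) \<Longrightarrow> cmod (\<sigma> y) \<le> 1"
  shows "2 \<le> (1 + 1 / v y) ^ alg_degree \<alpha>"
proof -
  define T where "T = v y"
  interpret valued_subfield "adjoin \<alpha>" v
    using v place_valued subfield_adjoin[OF \<alpha>] by (auto simp: arch_places_def)
  obtain m where m: "is_minpoly \<rat> y m" using algebraic_minpoly_exists[OF algebraic_in_adjoin[OF \<alpha> y(1)]] by blast
  define Z where "Z = {z. poly m z = 0}"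
  have Z: "finite Z" "card Z = degree m" "m = (\<Prod>z\<in>Z. [:-z, 1:])"
    using minpoly_Rats_decomp[OF m] by (auto simp: Z_def)
  have coeff: "poly.coeff m i \<in> \<rat>" for i
    using minpoly_over[OF subfield_set_Rats m] by (simp add: polys_over_def)
  have T: "T > 0" using y by (simp add: T_def)
  define n where "n = degree m"
  have "0 = (\<Sum>i\<le>n. poly.coeff m i * y ^ i)"
    using minpoly_root[OF subfield_set_Rats m] by (simp add: poly_altdef n_def)
  also have "\<dots> = y ^ n + (\<Sum>i<n. poly.coeff m i * y ^ i)"
    using minpoly_monic[OF subfield_set_Rats m] by (simp add: n_def lessThan_Suc_atMost[symmetric])
  finally have "y ^ n = - (\<Sum>i<n. poly.coeff m i * y ^ i)" by (simp add: eq_neg_iff_add_eq_0)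
  moreover have "(\<Sum>i<n. poly.coeff m i * y ^ i) \<in> adjoin \<alpha>"
    using y Rats_in[OF coeff] by (intro subring_set_sum[OF sr]) (auto simp: K_closed)
  ultimately have "T ^ n = v (\<Sum>i<n. poly.coeff m i * y ^ i)"
    using y uminus by (simp add: T_def flip: power)
  also have "\<dots> \<le> (\<Sum>i<n. v (poly.coeff m i * y ^ i))"
    using y Rats_in[OF coeff] by (intro sum_le) (auto simp: K_closed)
  also have "\<dots> = (\<Sum>i<n. cmod (poly.coeff m i) * T ^ i)"
    using y Rats_in[OF coeff] arch_place_Rats[OF v coeff] by (simp add: mult power K_closed T_def)
  finally have "2 * T ^ n \<le> (\<Sum>i<n. cmod (poly.coeff m i) * T ^ i) + T ^ n" by simp
  also have "\<dots> = (\<Sum>i\<le>n. cmod (poly.coeff m i) * T ^ i)"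
    using minpoly_monic[OF subfield_set_Rats m] by (simp add: n_def lessThan_Suc_atMost[symmetric])
  also have "\<dots> \<le> (\<Prod>z\<in>Z. cmod z + T)"
    using sum_coeff_prod_linear_le[OF Z(1), of T] T Z(2,3) by (simp add: n_def)
  also have "\<dots> \<le> (\<Prod>z\<in>Z. 1 + T)"
  proof (intro prod_mono conjI)
    fix z assume "z \<in> Z"
    hence "cmod z \<le> 1" using minpoly_root_emb[OF \<alpha> y(1) m, of z] small by (auto simp: Z_def)
    thus "cmod z + T \<le> 1 + T" by simp
  qed (use T in auto)
  also have "\<dots> = (1 + T) ^ n" using Z(2) by (simp add: n_def)
  finally have "2 \<le> (1 + T) ^ n / T ^ n" using T by (simp add: field_simps)
  also have "\<dots> = (1 + 1 / T) ^ n" using T by (simp add: field_simps flip: power_divide)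
  also have "\<dots> \<le> (1 + 1 / T) ^ alg_degree \<alpha>"
  proof (rule power_increasing)
    have sub: "adjoin y \<subseteq> adjoin \<alpha>"
      by (intro adjoin_subset algebraic_in_adjoin[OF \<alpha> y(1)] subfield_adjoin \<alpha> y)
    have "n = alg_degree y"
      using alg_degree_eq[OF algebraic_in_adjoin[OF \<alpha> y(1)] m] by (simp add: n_def)
    also have "\<dots> = alg_degree \<alpha> \<or> \<dots> < alg_degree \<alpha>"
    proof (cases "adjoin y = adjoin \<alpha>")
      case False
      hence "adjoin y \<subset> adjoin \<alpha>" using sub by blast
      thus ?thesis
        using alg_degree_less[OF \<alpha> subfield_adjoin _ in_adjoin] algebraic_in_adjoin[OF \<alpha> y(1)] by blast
    qed (simp add: alg_degree_def)
    finally show "n \<le> alg_degree \<alpha>" by auto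
  qed (use T in simp)
  finally show ?thesis by (simp add: T_def)
qed

text \<open>A place v outside the image would, by weak approximation, admit y with v y > 1 and all
  conjugates below 1 in modulus. High powers of y then violate
  \<open>arch_place_small_conjugates\<close>, whose right side tends to 1.\<close>

theorem arch_places_eq:
  assumes \<alpha>: "algebraic \<alpha>"
  shows "arch_places (adjoin \<alpha>) = (\<lambda>\<sigma>. restrict (\<lambda>x. cmod (\<sigma> x)) (adjoin \<alpha>)) ` emb (adjoin \<alpha>)"
proof (intro equalityI subsetI)
  note K = subfield_adjoin[OF \<alpha>]
  fix v assume v: "v \<in> arch_places (adjoin \<alpha>)"
  define W where "W = (\<lambda>\<sigma>. restrict (\<lambda>x. cmod (\<sigma> x)) (adjoin \<alpha>)) ` emb (adjoin \<alpha>)"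
  have W: "W \<subseteq> arch_places (adjoin \<alpha>)" using emb_arch_place[OF K] by (auto simp: W_def)
  have vs: "valued_subfield (adjoin \<alpha>) w" if "w \<in> arch_places (adjoin \<alpha>)" for w
    using that place_valued[OF _ K] by (auto simp: arch_places_def)
  interpret valued_subfield "adjoin \<alpha>" v by (rule vs[OF v])
  show "v \<in> W"
  proof (rule ccontr)
    assume nv: "v \<notin> W"
    have "\<exists>y\<in>adjoin \<alpha>. v y > 1 \<and> (\<forall>w\<in>W. w y < 1)"
    proof (rule weak_approximation[OF vs[OF v]])
      show "finite W" using finite_emb_adjoin[OF \<alpha>] by (simp add: W_def)
      show "valued_subfield (adjoin \<alpha>) w" if "w \<in> W" for w using that W vs by blast
      have 2: "v 2 = 2" using arch_place_Rats[OF v, of 2] by simp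
      thus "\<exists>x\<in>adjoin \<alpha>. 1 < v x" using Rats_in[of 2] by (intro bexI[of _ 2]) auto
      fix w assume w: "w \<in> W"
      hence w': "w \<in> arch_places (adjoin \<alpha>)" using W by blast
      show "\<exists>x\<in>adjoin \<alpha>. 1 < v x \<and> w x < 1"
      proof (rule abs_values_separate[OF vs[OF v] vs[OF w'], where c = 2])
        show "v r = w r" if "r \<in> \<rat>" for r using arch_place_Rats[OF v that] arch_place_Rats[OF w' that] by simp
        show "\<exists>x\<in>adjoin \<alpha>. v x \<noteq> w x"
          using place_eqI[of v "adjoin \<alpha>" w] v w w' nv by (auto simp: arch_places_def)
      qed (use 2 in auto)
    qed
    then obtain y where y: "y \<in> adjoin \<alpha>" "v y > 1" "\<And>w. w \<in> W \<Longrightarrow> w y < 1" by blast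
    have small: "cmod (\<sigma> (y ^ k)) \<le> 1" if s: "\<sigma> \<in> emb (adjoin \<alpha>)" for \<sigma> k
    proof -
      have "cmod (\<sigma> y) < 1" using y(3)[of "restrict (\<lambda>x. cmod (\<sigma> x)) (adjoin \<alpha>)"] y(1) s by (auto simp: W_def)
      hence "cmod (\<sigma> y) ^ k \<le> 1" by (intro power_le_one) auto
      thus ?thesis using emb_power[OF K s y(1)] by (simp add: norm_power)
    qed
    have ge2: "2 \<le> (1 + inverse (v y ^ k)) ^ alg_degree \<alpha>" for k
    proof -
      have "y ^ k \<in> adjoin \<alpha>" "v (y ^ k) = v y ^ k" using y by (simp_all add: K_closed power)
      moreover from this have "v (y ^ k) > 0" using y by simp
      ultimately have "2 \<le> (1 + 1 / v (y ^ k)) ^ alg_degree \<alpha>"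
        by (intro arch_place_small_conjugates[OF \<alpha> v] small)
      thus ?thesis using \<open>v (y ^ k) = v y ^ k\<close> by (simp add: inverse_eq_divide)
    qed
    have "(\<lambda>k. (1 + inverse (v y ^ k)) ^ alg_degree \<alpha>) \<longlonglongrightarrow> (1 + 0) ^ alg_degree \<alpha>"
      by (intro tendsto_intros LIMSEQ_inverse_realpow_zero y)
    from order_tendstoD(2)[OF this, of 2] have "\<forall>\<^sub>F k in sequentially. (1 + inverse (v y ^ k)) ^ alg_degree \<alpha> < 2"
      by simp
    then obtain k where "(1 + inverse (v y ^ k)) ^ alg_degree \<alpha> < 2" using eventually_happens by force
    thus False using ge2[of k] by simp
  qed
qed (use emb_arch_place[OF subfield_adjoin[OF \<alpha>]] in auto)

lemma finite_arch_places: "algebraic \<alpha> \<Longrightarrow> finite (arch_places (adjoin \<alpha>))"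
  by (simp add: arch_places_eq finite_emb_adjoin)

lemma card_arch_places: "algebraic \<alpha> \<Longrightarrow> card (arch_places (adjoin \<alpha>)) \<le> alg_degree \<alpha>"
  using card_image_le[OF finite_emb_adjoin] by (simp add: arch_places_eq card_emb_adjoin)

lemma emb_eqI:
  assumes \<alpha>: "algebraic \<alpha>" and s: "\<sigma> \<in> emb (adjoin \<alpha>)" "\<sigma>' \<in> emb (adjoin \<alpha>)" and eq: "\<sigma> \<alpha> = \<sigma>' \<alpha>"
  shows "\<sigma> = \<sigma>'"
proof -
  obtain m where m: "is_minpoly \<rat> \<alpha> m" using algebraic_minpoly_exists[OF \<alpha>] by blast
  have "ext_emb (restrict (\<lambda>x. x) \<rat>) \<rat> (adjoin \<alpha>) = emb (adjoin \<alpha>)"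
    using emb_Rats[OF subfield_adjoin[OF \<alpha>]] by (auto simp: ext_emb_def)
  hence "inj_on (\<lambda>\<sigma>. \<sigma> \<alpha>) (emb (adjoin \<alpha>))"
    using ext_emb_bij[OF subfield_set_Rats id_in_emb[OF subfield_set_Rats] m]
    by (auto simp: bij_betw_def adjoin_eq[OF \<alpha>])
  thus ?thesis using s eq by (auto simp: inj_on_def)
qed

text \<open>\<open>\<bar>\<sigma>\<bar>\<close> and \<open>\<bar>\<sigma>(\<cdot> + 1)\<bar>\<close> determine \<open>\<sigma>\<close> up to complex conjugation.\<close>

lemma card_emb_same_place:
  assumes \<alpha>: "algebraic \<alpha>"
  shows "card {\<sigma> \<in> emb (adjoin \<alpha>). restrict (\<lambda>x. cmod (\<sigma> x)) (adjoin \<alpha>) = v} \<le> 2" (is "card ?S \<le> 2")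
proof (cases "?S = {}")
  case False
  then obtain \<sigma> where s: "\<sigma> \<in> ?S" by blast
  note K = subfield_adjoin[OF \<alpha>]
  note sr = subfield_set_subring[OF K]
  have "?S \<subseteq> {\<tau> \<in> emb (adjoin \<alpha>). \<tau> \<alpha> = \<sigma> \<alpha>} \<union> {\<tau> \<in> emb (adjoin \<alpha>). \<tau> \<alpha> = cnj (\<sigma> \<alpha>)}"
  proof
    fix \<tau> assume t: "\<tau> \<in> ?S"
    have same: "cmod (\<tau> x) = cmod (\<sigma> x)" if "x \<in> adjoin \<alpha>" for x
    proof -
      have "restrict (\<lambda>x. cmod (\<tau> x)) (adjoin \<alpha>) x = restrict (\<lambda>x. cmod (\<sigma> x)) (adjoin \<alpha>) x" using s t by auto
      thus ?thesis using that by simp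
    qed
    have \<alpha>K: "\<alpha> \<in> adjoin \<alpha>" by (rule in_adjoin[OF \<alpha>])
    have "cmod (\<tau> \<alpha> + 1) = cmod (\<sigma> \<alpha> + 1)"
    proof -
      have "\<rho> (\<alpha> + 1) = \<rho> \<alpha> + 1" if "\<rho> \<in> emb (adjoin \<alpha>)" for \<rho>
        using emb_add[OF K that \<alpha>K subring_set_1[OF sr]] emb_1[OF K that] by simp
      moreover have "cmod (\<tau> (\<alpha> + 1)) = cmod (\<sigma> (\<alpha> + 1))"
        by (intro same subring_set_add[OF sr] \<alpha>K subring_set_1[OF sr])
      ultimately show ?thesis using s t by auto
    qed
    \<comment> \<open>The identity |z + 1|^2 - |z|^2 = 2 Re z + 1 determines the real part, and |z|
      then determines the imaginary part up to sign.\<close>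
    hence "(cmod (\<tau> \<alpha> + 1))\<^sup>2 = (cmod (\<sigma> \<alpha> + 1))\<^sup>2" "(cmod (\<tau> \<alpha>))\<^sup>2 = (cmod (\<sigma> \<alpha>))\<^sup>2"
      using same[OF \<alpha>K] by simp_all
    hence eq: "(Re (\<tau> \<alpha>) + 1)\<^sup>2 + (Im (\<tau> \<alpha>))\<^sup>2 = (Re (\<sigma> \<alpha>) + 1)\<^sup>2 + (Im (\<sigma> \<alpha>))\<^sup>2"
      "(Re (\<tau> \<alpha>))\<^sup>2 + (Im (\<tau> \<alpha>))\<^sup>2 = (Re (\<sigma> \<alpha>))\<^sup>2 + (Im (\<sigma> \<alpha>))\<^sup>2"
      by (simp_all add: cmod_power2)
    hence re: "Re (\<tau> \<alpha>) = Re (\<sigma> \<alpha>)" by (simp add: power2_eq_square algebra_simps)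
    hence "(Im (\<tau> \<alpha>))\<^sup>2 = (Im (\<sigma> \<alpha>))\<^sup>2" using eq(2) by simp
    hence "Im (\<tau> \<alpha>) = Im (\<sigma> \<alpha>) \<or> Im (\<tau> \<alpha>) = - Im (\<sigma> \<alpha>)" by (simp add: power2_eq_iff)
    thus "\<tau> \<in> {\<tau> \<in> emb (adjoin \<alpha>). \<tau> \<alpha> = \<sigma> \<alpha>} \<union> {\<tau> \<in> emb (adjoin \<alpha>). \<tau> \<alpha> = cnj (\<sigma> \<alpha>)}"
      using t re by (auto simp: complex_eq_iff)
  qed
  moreover have one: "card {\<tau> \<in> emb (adjoin \<alpha>). \<tau> \<alpha> = z} \<le> 1" "finite {\<tau> \<in> emb (adjoin \<alpha>). \<tau> \<alpha> = z}" for z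
    using finite_emb_adjoin[OF \<alpha>] emb_eqI[OF \<alpha>] by (auto simp: card_le_Suc0_iff_eq)
  ultimately have "card ?S \<le> card ({\<tau> \<in> emb (adjoin \<alpha>). \<tau> \<alpha> = \<sigma> \<alpha>} \<union> {\<tau> \<in> emb (adjoin \<alpha>). \<tau> \<alpha> = cnj (\<sigma> \<alpha>)})"
    by (intro card_mono) auto
  also have "\<dots> \<le> 1 + 1" using one by (intro order.trans[OF card_Un_le] add_mono) auto
  finally show ?thesis by simp
next
  case True
  show ?thesis unfolding True by simp
qed

text \<open>Embeddings are grouped by the place they induce: every fibre is nonempty, and it has at
  most two elements by \<open>card_emb_same_place\<close>.\<close>

lemma
  assumes \<alpha>: "algebraic \<alpha>"
  shows sum_arch_places_le: "(\<Sum>v\<in>arch_places (adjoin \<alpha>). \<bar>ln (v \<alpha>)\<bar>) \<le> arch_sum (adjoin \<alpha>) \<alpha>"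
    and arch_sum_le_sum_arch_places: "arch_sum (adjoin \<alpha>) \<alpha> \<le> 2 * (\<Sum>v\<in>arch_places (adjoin \<alpha>). \<bar>ln (v \<alpha>)\<bar>)"
proof -
  let ?r = "\<lambda>\<sigma>. restrict (\<lambda>x. cmod (\<sigma> x)) (adjoin \<alpha>)"
  note fin = finite_emb_adjoin[OF \<alpha>]
  have eq: "arch_sum (adjoin \<alpha>) \<alpha> = (\<Sum>\<sigma>\<in>emb (adjoin \<alpha>). \<bar>ln (?r \<sigma> \<alpha>)\<bar>)"
    using in_adjoin[OF \<alpha>] by (simp add: arch_sum_def)
  show "(\<Sum>v\<in>arch_places (adjoin \<alpha>). \<bar>ln (v \<alpha>)\<bar>) \<le> arch_sum (adjoin \<alpha>) \<alpha>"
    unfolding eq arch_places_eq[OF \<alpha>] using sum_image_le[OF fin, of "\<lambda>v. \<bar>ln (v \<alpha>)\<bar>" ?r] by (simp add: o_def)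
  have "arch_sum (adjoin \<alpha>) \<alpha> = (\<Sum>v\<in>arch_places (adjoin \<alpha>). \<Sum>\<sigma> | \<sigma> \<in> emb (adjoin \<alpha>) \<and> ?r \<sigma> = v. \<bar>ln (?r \<sigma> \<alpha>)\<bar>)"
    unfolding eq using fin by (intro sum.group[symmetric]) (auto simp: arch_places_eq[OF \<alpha>])
  also have "\<dots> = (\<Sum>v\<in>arch_places (adjoin \<alpha>). real (card {\<sigma> \<in> emb (adjoin \<alpha>). ?r \<sigma> = v}) * \<bar>ln (v \<alpha>)\<bar>)"
    by (intro sum.cong refl) simp
  also have "\<dots> \<le> (\<Sum>v\<in>arch_places (adjoin \<alpha>). 2 * \<bar>ln (v \<alpha>)\<bar>)"
  proof (intro sum_mono mult_right_mono)
    fix v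
    show "real (card {\<sigma> \<in> emb (adjoin \<alpha>). ?r \<sigma> = v}) \<le> 2" using card_emb_same_place[OF \<alpha>, of v] by linarith
  qed auto
  finally show "arch_sum (adjoin \<alpha>) \<alpha> \<le> 2 * (\<Sum>v\<in>arch_places (adjoin \<alpha>). \<bar>ln (v \<alpha>)\<bar>)"
    by (simp add: sum_distrib_left)
qed

subsection \<open>Completions and local degrees\<close>

text \<open>Vectors already in the span of the later ones are skipped, so a spanning list shows that
  a dimension exists and bounds it.\<close>

lemma (in ring) dimension_Span:
  assumes K: "subfield K R" and Us: "set Us \<subseteq> carrier R"
  shows "\<exists>n\<le>length Us. dimension n K (Span K Us)"
  using Us
proof (induction Us)
  case (Cons u Us)
  then obtain n where n: "n \<le> length Us" "dimension n K (Span K Us)" by auto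
  show ?case
  proof (cases "u \<in> Span K Us")
    case True
    hence "Span K (u # Us) = Span K Us"
      using Span_base_incl[OF K] mono_Span_subset[OF K] Cons.prems
      by (metis insert_subset list.simps(15) subset_antisym)
    thus ?thesis using n by (metis le_SucI length_Cons)
  next
    case False
    hence "dimension (Suc n) K (Span K (u # Us))" using Suc_dim[OF _ False n(2)] Cons.prems by simp
    thus ?thesis using n(1) by (metis Suc_le_mono length_Cons)
  qed
qed (auto intro!: exI[of _ 0])

context valued_subfield
begin

abbreviation "C \<equiv> carrier (cauchy_ring K v)"
abbreviation "R \<equiv> cauchy_ring K v"
abbreviation "I \<equiv> null_seqs K v"
abbreviation "Q \<equiv> place_completion K v"
abbreviation "cl s \<equiv> null_seqs K v +>\<^bsub>cauchy_ring K v\<^esub> s"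

lemma cauchy_ring_simps:
  "s \<otimes>\<^bsub>R\<^esub> t = (\<lambda>n. s n * t n)" "s \<oplus>\<^bsub>R\<^esub> t = (\<lambda>n. s n + t n)" "\<one>\<^bsub>R\<^esub> = (\<lambda>_. 1)" "\<zero>\<^bsub>R\<^esub> = (\<lambda>_. 0)"
  by (auto simp: cauchy_ring_def)

lemma C_iff: "s \<in> C \<longleftrightarrow> (\<forall>n. s n \<in> K) \<and> (\<forall>e>0. \<exists>N. \<forall>m\<ge>N. \<forall>n\<ge>N. v (s m - s n) < e)"
  by (auto simp: cauchy_ring_def)

lemma C_in: "s \<in> C \<Longrightarrow> s n \<in> K"
  by (auto simp: C_iff)

lemma C_cauchy: "s \<in> C \<Longrightarrow> e > 0 \<Longrightarrow> \<exists>N. \<forall>m\<ge>N. \<forall>n\<ge>N. v (s m - s n) < e"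
  by (auto simp: C_iff)

lemma C_const: "x \<in> K \<Longrightarrow> (\<lambda>_. x) \<in> C"
  by (auto simp: C_iff zero)

lemma C_uminus: "s \<in> C \<Longrightarrow> (\<lambda>n. - s n) \<in> C"
proof -
  assume s: "s \<in> C"
  have "v (- s m - - s n) = v (s m - s n)" for m n
    using diff_commute[OF C_in[OF s] C_in[OF s], of m n] by (simp add: add.commute)
  thus ?thesis using s by (auto simp: C_iff K_closed)
qed

lemma C_add:
  assumes s: "s \<in> C" and t: "t \<in> C"
  shows "(\<lambda>n. s n + t n) \<in> C"
  unfolding C_iff
proof (intro conjI allI impI)
  show "s n + t n \<in> K" for n using C_in[OF s] C_in[OF t] by (simp add: K_closed)
  fix e :: real assume e: "e > 0"
  obtain N M where N: "\<forall>m\<ge>N. \<forall>n\<ge>N. v (s m - s n) < e / 2" and M: "\<forall>m\<ge>M. \<forall>n\<ge>M. v (t m - t n) < e / 2"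
    using C_cauchy[OF s, of "e/2"] C_cauchy[OF t, of "e/2"] e by auto
  have "v (s m + t m - (s n + t n)) < e" if "m \<ge> max N M" "n \<ge> max N M" for m n
  proof -
    have "v ((s m - s n) + (t m - t n)) \<le> v (s m - s n) + v (t m - t n)"
      by (intro triangle K_closed C_in s t)
    also have "\<dots> < e" using N[rule_format, of m n] M[rule_format, of m n] that by simp
    finally show ?thesis by (simp add: algebra_simps)
  qed
  thus "\<exists>N. \<forall>m\<ge>N. \<forall>n\<ge>N. v (s m + t m - (s n + t n)) < e" by blast
qed

lemma C_diff: "s \<in> C \<Longrightarrow> t \<in> C \<Longrightarrow> (\<lambda>n. s n - t n) \<in> C"
  using C_add[OF _ C_uminus[of t], of s] by simp

lemma C_bounded:
  assumes s: "s \<in> C"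
  shows "\<exists>B>0. \<forall>n. v (s n) \<le> B"
proof -
  obtain N where N: "\<forall>m\<ge>N. \<forall>n\<ge>N. v (s m - s n) < 1" using C_cauchy[OF s, of 1] by auto
  define B where "B = Max ((\<lambda>n. v (s n)) ` {..N}) + 1"
  have le: "v (s n) \<le> B - 1" if "n \<le> N" for n unfolding B_def using that by (auto intro!: Max_ge)
  have "v (s n) \<le> B" for n
  proof (cases "n \<le> N")
    case True
    thus ?thesis using le[OF True] by simp
  next
    case False
    have "v (s n) - v (s N) \<le> v (s n - s N)" by (intro diff_ge C_in s)
    also have "\<dots> < 1" using N False by simp
    finally show ?thesis using le[of N] by simp
  qed
  moreover have "B > 0" using le[of 0] nonneg[OF C_in[OF s], of 0] by simp
  ultimately show ?thesis by blast
qed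

lemma C_mult:
  assumes s: "s \<in> C" and t: "t \<in> C"
  shows "(\<lambda>n. s n * t n) \<in> C"
  unfolding C_iff
proof (intro conjI allI impI)
  show "s n * t n \<in> K" for n using C_in[OF s] C_in[OF t] by (simp add: K_closed)
  fix e :: real assume e: "e > 0"
  obtain A B where A: "A > 0" "\<And>n. v (s n) \<le> A" and B: "B > 0" "\<And>n. v (t n) \<le> B"
    using C_bounded[OF s] C_bounded[OF t] by blast
  obtain N M where N: "\<forall>m\<ge>N. \<forall>n\<ge>N. v (s m - s n) < e / (2 * B)" and M: "\<forall>m\<ge>M. \<forall>n\<ge>M. v (t m - t n) < e / (2 * A)"
    using C_cauchy[OF s, of "e/(2*B)"] C_cauchy[OF t, of "e/(2*A)"] e A(1) B(1) by auto
  have "v (s m * t m - s n * t n) < e" if "m \<ge> max N M" "n \<ge> max N M" for m n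
  proof -
    note inK = C_in[OF s] C_in[OF t]
    have "v ((s m - s n) * t m + s n * (t m - t n)) \<le> v ((s m - s n) * t m) + v (s n * (t m - t n))"
      by (intro triangle K_closed inK)
    also have "\<dots> = v (s m - s n) * v (t m) + v (s n) * v (t m - t n)"
      using inK by (simp add: mult K_closed)
    also have "\<dots> \<le> v (s m - s n) * B + A * v (t m - t n)"
      using A B inK by (intro add_mono mult_left_mono mult_right_mono) (auto simp: nonneg K_closed)
    also have "\<dots> < (e / (2 * B)) * B + A * (e / (2 * A))"
      using N[rule_format, of m n] M[rule_format, of m n] that A(1) B(1)
      by (intro add_strict_mono mult_strict_left_mono mult_strict_right_mono) auto
    also have "\<dots> = e" using A(1) B(1) by simp
    finally show ?thesis by (simp add: algebra_simps)
  qed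
  thus "\<exists>N. \<forall>m\<ge>N. \<forall>n\<ge>N. v (s m * t m - s n * t n) < e" by blast
qed

lemma C_sum: "finite J \<Longrightarrow> (\<And>i. i \<in> J \<Longrightarrow> f i \<in> C) \<Longrightarrow> (\<lambda>n. \<Sum>i\<in>J. f i n) \<in> C"
  by (induction J rule: finite_induct) (auto simp: C_const K_closed C_add)

lemma I_iff: "s \<in> I \<longleftrightarrow> s \<in> C \<and> (\<lambda>n. v (s n)) \<longlonglongrightarrow> 0"
  by (auto simp: null_seqs_def)

lemma cring_cauchy_ring: "cring R"
proof (rule cringI)
  show "abelian_group R"
  proof (rule abelian_groupI)
    show "\<exists>t\<in>C. t \<oplus>\<^bsub>R\<^esub> s = \<zero>\<^bsub>R\<^esub>" if "s \<in> C" for s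
      using that by (intro bexI[of _ "\<lambda>n. - s n"]) (auto simp: cauchy_ring_simps C_uminus)
  qed (auto simp: cauchy_ring_simps C_add C_const K_closed add_ac)
  show "comm_monoid R"
    by (rule comm_monoidI) (auto simp: cauchy_ring_simps C_mult C_const K_closed mult_ac)
qed (auto simp: cauchy_ring_simps algebra_simps)

interpretation R: cring "cauchy_ring K v"
  by (rule cring_cauchy_ring)

lemma null_dominated:
  assumes "s \<in> C" "\<And>n. v (s n) \<le> f n" "f \<longlonglongrightarrow> 0"
  shows "s \<in> I"
  unfolding I_iff
proof
  show "(\<lambda>n. v (s n)) \<longlonglongrightarrow> 0"
    by (rule tendsto_sandwich[OF _ _ tendsto_const assms(3)])
      (auto simp: assms nonneg C_in)
qed (rule assms)

lemma R_uminus: "s \<in> C \<Longrightarrow> \<ominus>\<^bsub>R\<^esub> s = (\<lambda>n. - s n)"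
  by (rule R.minus_equality) (auto simp: cauchy_ring_simps C_uminus)

lemma ideal_null_seqs: "ideal I R"
proof (rule idealI)
  show "ring R" by (rule R.ring_axioms)
  show "subgroup I (add_monoid R)"
  proof (rule R.add.subgroupI)
    show "I \<subseteq> C" by (auto simp: I_iff)
    show "I \<noteq> {}" using C_const[of 0] I_iff[of "\<lambda>_. 0"] by (auto simp: K_closed zero)
    show "\<ominus>\<^bsub>R\<^esub> s \<in> I" if "s \<in> I" for s
      using that by (auto simp: I_iff R_uminus C_uminus uminus C_in)
    show "s \<oplus>\<^bsub>R\<^esub> t \<in> I" if st: "s \<in> I" "t \<in> I" for s t
    proof (rule null_dominated)
      show "s \<oplus>\<^bsub>R\<^esub> t \<in> C" using st by (auto simp: I_iff cauchy_ring_simps C_add)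
      show "v ((s \<oplus>\<^bsub>R\<^esub> t) n) \<le> v (s n) + v (t n)" for n
        using st by (auto simp: I_iff cauchy_ring_simps C_in triangle)
      show "(\<lambda>n. v (s n) + v (t n)) \<longlonglongrightarrow> 0"
        using tendsto_add[of "\<lambda>n. v (s n)" 0 sequentially "\<lambda>n. v (t n)" 0] st by (simp add: I_iff)
    qed
  qed
  show 1: "t \<otimes>\<^bsub>R\<^esub> s \<in> I" if s: "s \<in> I" and t: "t \<in> C" for s t
  proof -
    obtain B where B: "B > 0" "\<And>n. v (t n) \<le> B" using C_bounded[OF t] by blast
    show ?thesis
    proof (rule null_dominated)
      show "t \<otimes>\<^bsub>R\<^esub> s \<in> C" using s t by (auto simp: I_iff cauchy_ring_simps C_mult)
      show "v ((t \<otimes>\<^bsub>R\<^esub> s) n) \<le> B * v (s n)" for n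
        using s t B by (auto simp: I_iff cauchy_ring_simps C_in mult nonneg mult_right_mono)
      show "(\<lambda>n. B * v (s n)) \<longlonglongrightarrow> 0"
        using tendsto_mult_left[of "\<lambda>n. v (s n)" 0 sequentially B] s by (simp add: I_iff)
    qed
  qed
  show "s \<otimes>\<^bsub>R\<^esub> t \<in> I" if s: "s \<in> I" and t: "t \<in> C" for s t
    using 1[OF s t] R.m_comm[of s t] s t by (simp add: I_iff)
qed

interpretation I: ideal "null_seqs K v" "cauchy_ring K v"
  by (rule ideal_null_seqs)

lemma cring_completion: "cring Q"
  unfolding place_completion_def by (rule I.quotient_is_cring[OF cring_cauchy_ring])

interpretation Q: cring "place_completion K v"
  by (rule cring_completion)

lemma cl_hom: "(+>\<^bsub>R\<^esub>) I \<in> ring_hom R Q"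
  unfolding place_completion_def by (rule I.rcos_ring_hom)

lemma cl_closed: "s \<in> C \<Longrightarrow> cl s \<in> carrier Q"
  by (rule ring_hom_closed[OF cl_hom])

lemma cl_add: "s \<in> C \<Longrightarrow> t \<in> C \<Longrightarrow> cl s \<oplus>\<^bsub>Q\<^esub> cl t = cl (\<lambda>n. s n + t n)"
  using ring_hom_add[OF cl_hom, of s t] by (simp add: cauchy_ring_simps)

lemma cl_mult: "s \<in> C \<Longrightarrow> t \<in> C \<Longrightarrow> cl s \<otimes>\<^bsub>Q\<^esub> cl t = cl (\<lambda>n. s n * t n)"
  using ring_hom_mult[OF cl_hom, of s t] by (simp add: cauchy_ring_simps)

lemma cl_one: "\<one>\<^bsub>Q\<^esub> = cl (\<lambda>_. 1)"
  using ring_hom_one[OF cl_hom] by (simp add: cauchy_ring_simps)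

lemma cl_zero_iff: "s \<in> C \<Longrightarrow> cl s = \<zero>\<^bsub>Q\<^esub> \<longleftrightarrow> s \<in> I"
proof -
  assume s: "s \<in> C"
  have "\<zero>\<^bsub>Q\<^esub> = I" by (simp add: place_completion_def FactRing_def)
  thus ?thesis using I.rcos_const_imp_mem[OF s] R.a_rcos_zero[OF ideal_null_seqs, of s] by auto
qed

lemma cl_zero: "\<zero>\<^bsub>Q\<^esub> = cl (\<lambda>_. 0)"
  using cl_zero_iff[of "\<lambda>_. 0"] by (simp add: C_const K_closed I_iff zero)

lemma cl_uminus: "s \<in> C \<Longrightarrow> \<ominus>\<^bsub>Q\<^esub> cl s = cl (\<lambda>n. - s n)"
  by (rule Q.minus_equality) (auto simp: cl_add cl_zero C_uminus cl_closed)

lemma cl_eq_iff: "s \<in> C \<Longrightarrow> t \<in> C \<Longrightarrow> cl s = cl t \<longleftrightarrow> (\<lambda>n. v (s n - t n)) \<longlonglongrightarrow> 0"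
proof -
  assume st: "s \<in> C" "t \<in> C"
  have "cl s = cl t \<longleftrightarrow> cl s \<oplus>\<^bsub>Q\<^esub> \<ominus>\<^bsub>Q\<^esub> cl t = \<zero>\<^bsub>Q\<^esub>"
    using st cl_closed by (metis Q.add.inv_equality Q.add.inv_inv Q.add.inv_closed Q.r_neg)
  also have "\<dots> \<longleftrightarrow> (\<lambda>n. s n - t n) \<in> I"
    using st by (simp add: cl_uminus cl_add C_uminus cl_zero_iff C_diff)
  finally show ?thesis using st by (simp add: I_iff C_diff)
qed

lemma completion_cases:
  assumes "Z \<in> carrier Q"
  obtains s where "s \<in> C" "Z = cl s"
  using assms by (auto simp: place_completion_def FactRing_def A_RCOSETS_defs a_r_coset_def)

text \<open>F = \<rat> gives the completed rationals and F = K the whole completion, so one argument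
  shows that both are fields.\<close>

definition classes_of :: "complex set \<Rightarrow> (nat \<Rightarrow> complex) set set" where
  "classes_of F = {cl s | s. s \<in> C \<and> range s \<subseteq> F}"

lemma completed_rationals_eq: "completed_rationals K v = classes_of \<rat>"
  by (simp add: completed_rationals_def classes_of_def)

lemma classes_of_K: "classes_of K = carrier Q"
proof (intro equalityI subsetI)
  fix Z assume "Z \<in> carrier Q"
  then obtain s where "s \<in> C" "Z = cl s" by (rule completion_cases)
  thus "Z \<in> classes_of K" using C_in by (auto simp: classes_of_def)
qed (auto simp: classes_of_def cl_closed)

text \<open>A Cauchy sequence that does not tend to 0 is eventually bounded away from 0, and then
  its termwise inverses are Cauchy. Finitely many zero terms do no harm, since their inverse is 0
  and lies in F.\<close>

lemma invertible_seq:
  assumes s: "s \<in> C" "s \<notin> I" and F: "subfield_set F" "range s \<subseteq> F" "F \<subseteq> K"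
  shows "\<exists>t\<in>C. range t \<subseteq> F \<and> (\<lambda>n. s n * t n - 1) \<in> I"
proof -
  have "\<exists>d>0. \<forall>N. \<exists>n\<ge>N. v (s n) \<ge> d"
  proof (rule ccontr)
    assume "\<not> ?thesis"
    hence "\<exists>N. \<forall>n\<ge>N. v (s n) < d" if "d > 0" for d using that by (meson not_le)
    hence "(\<lambda>n. v (s n)) \<longlonglongrightarrow> 0"
      using nonneg[OF C_in[OF s(1)]] by (intro LIMSEQ_I) simp
    thus False using s by (simp add: I_iff)
  qed
  then obtain d where d: "d > 0" "\<And>N. \<exists>n\<ge>N. v (s n) \<ge> d" by blast
  obtain N where N: "\<forall>m\<ge>N. \<forall>n\<ge>N. v (s m - s n) < d / 2" using C_cauchy[OF s(1), of "d/2"] d by auto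
  have low: "v (s m) > d / 2" if m: "m \<ge> N" for m
  proof -
    obtain n where n: "n \<ge> N" "v (s n) \<ge> d" using d by blast
    have "v (s n) - v (s m) \<le> v (s n - s m)" by (intro diff_ge C_in s)
    thus ?thesis using N[rule_format, OF n(1) m] n by simp
  qed
  define t where "t = (\<lambda>n. inverse (s n))"
  have tC: "t \<in> C"
    unfolding C_iff
  proof (intro conjI allI impI)
    show "t n \<in> K" for n using C_in[OF s(1)] by (simp add: t_def K_closed)
    fix e :: real assume e: "e > 0"
    \<comment> \<open>The factor (d/2)^2 compensates for the denominator v(s m) v(s n).\<close>
    obtain M where M: "\<forall>m\<ge>M. \<forall>n\<ge>M. v (s m - s n) < e * (d / 2)\<^sup>2"
      using C_cauchy[OF s(1), of "e * (d / 2)\<^sup>2"] e d by auto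
    have "v (t m - t n) < e" if mn: "m \<ge> max N M" "n \<ge> max N M" for m n
    proof -
      have pos: "v (s m) > d / 2" "v (s n) > d / 2" using low mn by auto
      hence nz: "s m \<noteq> 0" "s n \<noteq> 0" using d zero by auto
      have "t m - t n = (s n - s m) / (s m * s n)" using nz by (simp add: t_def field_simps)
      hence "v (t m - t n) = v (s n - s m) / (v (s m) * v (s n))"
        using C_in[OF s(1)] by (simp add: divide mult K_closed)
      also have "\<dots> \<le> v (s n - s m) / (d / 2)\<^sup>2"
        unfolding power2_eq_square using pos d C_in[OF s(1)]
        by (intro divide_left_mono mult_mono) (auto simp: nonneg K_closed)
      also have "\<dots> < e" using M mn d by (simp add: pos_divide_less_eq)
      finally show ?thesis .
    qed
    thus "\<exists>N. \<forall>m\<ge>N. \<forall>n\<ge>N. v (t m - t n) < e" by blast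
  qed
  have "\<forall>\<^sub>F n in sequentially. v (s n * t n - 1) = 0"
    using eventually_ge_at_top[of N]
  proof eventually_elim
    case (elim n)
    hence "s n \<noteq> 0" using low[of n] d zero by auto
    thus ?case by (simp add: t_def zero)
  qed
  hence "(\<lambda>n. v (s n * t n - 1)) \<longlonglongrightarrow> 0" by (rule tendsto_eventually)
  hence "(\<lambda>n. s n * t n - 1) \<in> I" by (simp add: I_iff C_diff C_mult C_const K_closed s tC)
  moreover have "range t \<subseteq> F" using F by (auto simp: t_def subfield_set_inverse)
  ultimately show ?thesis using tC by blast
qed

lemma classes_of_inverse:
  assumes Z: "Z \<in> classes_of F" "Z \<noteq> \<zero>\<^bsub>Q\<^esub>" and F: "subfield_set F" "F \<subseteq> K"
  shows "\<exists>Y\<in>classes_of F. Z \<otimes>\<^bsub>Q\<^esub> Y = \<one>\<^bsub>Q\<^esub>"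
proof -
  obtain s where s: "s \<in> C" "range s \<subseteq> F" "Z = cl s" using Z by (auto simp: classes_of_def)
  hence "s \<notin> I" using Z cl_zero_iff by blast
  from invertible_seq[OF s(1) this F(1) s(2) F(2)] obtain t where
    t: "t \<in> C" "range t \<subseteq> F" "(\<lambda>n. s n * t n - 1) \<in> I" by blast
  have "Z \<otimes>\<^bsub>Q\<^esub> cl t = \<one>\<^bsub>Q\<^esub>"
    using s t by (simp add: cl_mult cl_one cl_eq_iff C_mult C_const K_closed I_iff)
  thus ?thesis using t by (auto simp: classes_of_def)
qed

lemma one_neq_zero: "\<one>\<^bsub>Q\<^esub> \<noteq> \<zero>\<^bsub>Q\<^esub>"
  using cl_zero_iff[of "\<lambda>_. 1"] by (simp add: cl_one C_const K_closed I_iff one LIMSEQ_const_iff)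

lemma field_completion: "field Q"
proof (rule Q.cring_fieldI2)
  show "\<zero>\<^bsub>Q\<^esub> \<noteq> \<one>\<^bsub>Q\<^esub>" using one_neq_zero by simp
  show "\<exists>b\<in>carrier Q. a \<otimes>\<^bsub>Q\<^esub> b = \<one>\<^bsub>Q\<^esub>" if "a \<in> carrier Q" "a \<noteq> \<zero>\<^bsub>Q\<^esub>" for a
    using classes_of_inverse[of a K] that subfield_K by (simp add: classes_of_K)
qed

lemma subfield_classes_of:
  assumes F: "subfield_set F" "F \<subseteq> K"
  shows "subfield (classes_of F) Q"
proof (rule field.subfieldI'[OF field_completion])
  note sF = subfield_set_subring[OF F(1)]
  show "subring (classes_of F) Q"
  proof (rule Q.subringI)
    show "classes_of F \<subseteq> carrier Q" by (auto simp: classes_of_def cl_closed)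
    show "\<one>\<^bsub>Q\<^esub> \<in> classes_of F"
      unfolding cl_one classes_of_def using subring_set_1[OF sF] by (auto simp: C_const K_closed)
    fix Z assume "Z \<in> classes_of F"
    then obtain s where s: "s \<in> C" "range s \<subseteq> F" "Z = cl s" by (auto simp: classes_of_def)
    show "\<ominus>\<^bsub>Q\<^esub> Z \<in> classes_of F"
      unfolding s(3) cl_uminus[OF s(1)] classes_of_def
      using s(2) C_uminus[OF s(1)] subring_set_uminus[OF sF] by auto
    fix Y assume "Y \<in> classes_of F"
    then obtain t where t: "t \<in> C" "range t \<subseteq> F" "Y = cl t" by (auto simp: classes_of_def)
    have "range (\<lambda>n. s n * t n) \<subseteq> F" "range (\<lambda>n. s n + t n) \<subseteq> F"
      using s(2) t(2) by (auto simp: image_subset_iff intro: subring_set_mult[OF sF] subring_set_add[OF sF])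
    thus "Z \<otimes>\<^bsub>Q\<^esub> Y \<in> classes_of F" "Z \<oplus>\<^bsub>Q\<^esub> Y \<in> classes_of F"
      unfolding s(3) t(3) cl_mult[OF s(1) t(1)] cl_add[OF s(1) t(1)] classes_of_def
      using C_mult[OF s(1) t(1)] C_add[OF s(1) t(1)] by blast+
  qed
  fix Z assume Z: "Z \<in> classes_of F - {\<zero>\<^bsub>Q\<^esub>}"
  then obtain Y where Y: "Y \<in> classes_of F" "Z \<otimes>\<^bsub>Q\<^esub> Y = \<one>\<^bsub>Q\<^esub>" using classes_of_inverse F by blast
  have "Z \<in> carrier Q" "Y \<in> carrier Q" using Z Y by (auto simp: classes_of_def cl_closed)
  hence "inv\<^bsub>Q\<^esub> Z = Y" using Y(2) by (intro Q.inv_char) (auto simp: Q.m_comm)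
  thus "inv\<^bsub>Q\<^esub> Z \<in> classes_of F" using Y by simp
qed

abbreviation "Qr \<equiv> completed_rationals K v"

lemma subfield_Qr: "subfield Qr Q"
  unfolding completed_rationals_eq
  by (rule subfield_classes_of[OF subfield_set_Rats Rats_subset_subfield_set[OF subfield_K]])

text \<open>A subspace \<open>\<rat>b + U\<close> is complete over the completed rationals if \<open>U\<close> is: either \<open>b\<close> is a limit
  of elements of \<open>U\<close>, or its distance from \<open>U\<close> is positive and the coefficient of \<open>b\<close> in a Cauchy
  sequence is itself a Cauchy sequence.\<close>

lemma cl_in_Span:
  assumes "set bs \<subseteq> K" "t \<in> C" "range t \<subseteq> CR.Span \<rat> bs"
  shows "cl t \<in> ring.Span Q Qr (map (\<lambda>b. cl (\<lambda>_. b)) bs)"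
  using assms
proof (induction bs arbitrary: t)
  case Nil
  hence "t = (\<lambda>_. 0)" by (auto simp: complex_ring_simps)
  thus ?case using cl_zero by simp
next
  case (Cons b bs)
  let ?U = "CR.Span \<rat> bs"
  have sQ: "subfield \<rat> complex_ring" by (simp add: subfield_complex_ring_iff subfield_set_Rats)
  have car: "set bs \<subseteq> carrier complex_ring" by (simp add: complex_ring_simps)
  have carQ: "set (map (\<lambda>b. cl (\<lambda>_. b)) bs) \<subseteq> carrier Q"
    using Cons.prems(1) by (auto intro!: cl_closed C_const)
  have b: "b \<in> K" and bs: "set bs \<subseteq> K" using Cons.prems(1) by auto
  have U_add: "x + y \<in> ?U" if "x \<in> ?U" "y \<in> ?U" for x y
    using CR.Span_subgroup_props(3)[OF sQ car] that by (simp add: complex_ring_simps)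
  have U_smult: "q * x \<in> ?U" if "q \<in> \<rat>" "x \<in> ?U" for q x
    using CR.Span_smult_closed[OF sQ car] that by (simp add: complex_ring_simps)
  have U_K: "x \<in> K" if x: "x \<in> ?U" for x
  proof -
    obtain Ks where Ks: "set Ks \<subseteq> \<rat>" "length Ks = length bs" "x = CR.combine Ks bs"
      using x CR.Span_mem_iff_length_version[OF sQ car] by blast
    have "Ks ! i \<in> K" "bs ! i \<in> K" if "i < length bs" for i
      using Ks(1,2) bs that Rats_in[OF subsetD[OF Ks(1) nth_mem[of i Ks]]] subsetD[OF bs nth_mem[of i bs]] by simp_all
    thus "x \<in> K" unfolding Ks(3) combine_complex_ring using Ks(2)
      by (intro subring_set_sum[OF sr]) (auto simp: K_closed)
  qed
  have "\<exists>q u. q \<in> \<rat> \<and> u \<in> ?U \<and> t n = q * b + u" for n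
  proof -
    have "t n \<in> CR.line_extension \<rat> b ?U" using Cons.prems(3) by auto
    thus ?thesis unfolding CR.line_extension_mem_iff by (auto simp: complex_ring_simps)
  qed
  then obtain q u where qu: "\<And>n. q n \<in> \<rat>" "\<And>n. u n \<in> ?U" "\<And>n. t n = q n * b + u n" by metis
  have qK: "q n \<in> K" for n using Rats_in[OF qu(1)] by auto
  note tC = Cons.prems(2)
  show ?case
  proof (cases "\<exists>d>0. \<forall>w\<in>?U. v (b - w) \<ge> d")
    case True
    then obtain d where d: "d > 0" "\<And>w. w \<in> ?U \<Longrightarrow> v (b - w) \<ge> d" by blast
    \<comment> \<open>For different coefficients, t m - t n = (q m - q n)(b - w) with w in the span,
      so the distance d turns the Cauchy property of t into that of q.\<close>
    have key: "v (q m - q n) * d \<le> v (t m - t n)" for m n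
    proof (cases "q m = q n")
      case True
      thus ?thesis using nonneg[OF K_closed(4)[OF C_in[OF tC] C_in[OF tC]]] by (simp add: zero)
    next
      case False
      define r where "r = q m - q n"
      have r: "r \<in> \<rat>" "r \<noteq> 0" "r \<in> K" using qu(1) False qK by (auto simp: r_def K_closed)
      define w where "w = inverse r * (u n + (-1) * u m)"
      have w: "w \<in> ?U" unfolding w_def using r qu(2) by (intro U_smult U_add) auto
      have "t m - t n = r * (b - w)" using r(2) by (simp add: qu(3) r_def[symmetric] w_def field_simps) (simp add: r_def algebra_simps)
      hence "v (t m - t n) = v r * v (b - w)" using r b U_K[OF w] by (simp add: mult K_closed)
      thus ?thesis using d(2)[OF w] nonneg[OF r(3)] by (simp add: r_def mult_left_mono)
    qed
    have qC: "q \<in> C"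
      unfolding C_iff
    proof (intro conjI allI impI qK)
      fix e :: real assume "e > 0"
      then obtain N where N: "\<forall>m\<ge>N. \<forall>n\<ge>N. v (t m - t n) < e * d" using C_cauchy[OF tC, of "e * d"] d by auto
      have "v (q m - q n) < e" if "m \<ge> N" "n \<ge> N" for m n
        using le_less_trans[OF key[of m n] N[rule_format, OF that]] d(1) by simp
      thus "\<exists>N. \<forall>m\<ge>N. \<forall>n\<ge>N. v (q m - q n) < e" by blast
    qed
    have bC: "(\<lambda>_. b) \<in> C" by (rule C_const[OF b])
    have "(\<lambda>n. t n - q n * b) \<in> C" by (intro C_diff C_mult tC qC bC)
    hence uC: "u \<in> C" using qu(3) by (simp add: fun_eq_iff)
    have "cl u \<in> ring.Span Q Qr (map (\<lambda>b. cl (\<lambda>_. b)) bs)"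
      using qu(2) by (intro Cons.IH bs uC) auto
    moreover have "cl q \<in> Qr" unfolding completed_rationals_eq classes_of_def using qC qu(1) by auto
    moreover have "cl t = cl q \<otimes>\<^bsub>Q\<^esub> cl (\<lambda>_. b) \<oplus>\<^bsub>Q\<^esub> cl u"
    proof -
      have "t = (\<lambda>n. q n * b + u n)" using qu(3) by auto
      thus ?thesis unfolding cl_mult[OF qC bC] cl_add[OF C_mult[OF qC bC] uC] by simp
    qed
    ultimately show ?thesis by (auto simp: Q.line_extension_mem_iff)
  next
    case False
    hence "\<exists>w\<in>?U. v (b - w) < d" if "d > 0" for d using that by (meson not_le)
    then obtain w where w: "\<And>d. d > 0 \<Longrightarrow> w d \<in> ?U \<and> v (b - w d) < d" by metis
    \<comment> \<open>The tolerance is chosen so that replacing b by w (d n) in the n-th term costs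
      at most 1/(n + 1); adding 1 to v (q n) keeps the denominator positive.\<close>
    define d where "d = (\<lambda>n. 1 / ((v (q n) + 1) * real (Suc n)))"
    have dpos: "d n > 0" for n using nonneg[OF qK[of n]] by (auto simp: d_def intro!: mult_pos_pos)
    define t' where "t' = (\<lambda>n. q n * w (d n) + u n)"
    have t'U: "t' n \<in> ?U" for n
      unfolding t'_def using w[OF dpos[of n]] qu by (intro U_add U_smult) auto
    have diff: "v (t n - t' n) \<le> 1 / real (Suc n)" for n
    proof -
      have wK: "w (d n) \<in> K" using w[OF dpos[of n]] U_K by blast
      have "t n - t' n = q n * (b - w (d n))" by (simp add: qu(3) t'_def algebra_simps)
      hence "v (t n - t' n) = v (q n) * v (b - w (d n))" using qK wK b by (simp add: mult K_closed)
      also have "\<dots> \<le> (v (q n) + 1) * d n"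
        using w[OF dpos[of n]] nonneg[OF qK[of n]] b wK by (intro mult_mono) (auto simp: nonneg K_closed)
      also have "\<dots> = 1 / real (Suc n)" using nonneg[OF qK[of n]] by (simp add: d_def)
      finally show ?thesis .
    qed
    have "(\<lambda>n. t n - t' n) \<in> C"
      unfolding C_iff
    proof (intro conjI allI impI)
      show inK: "t n - t' n \<in> K" for n using C_in[OF tC] U_K[OF t'U] by (simp add: K_closed)
      fix e :: real assume e: "e > 0"
      obtain N where N: "inverse (real (Suc N)) < e / 2" using reals_Archimedean[of "e/2"] e by auto
      have "v (t m - t' m - (t n - t' n)) < e" if mn: "m \<ge> N" "n \<ge> N" for m n
      proof -
        have le: "1 / real (Suc k) \<le> inverse (real (Suc N))" if "k \<ge> N" for k
          using that by (simp add: inverse_eq_divide frac_le)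
        have "v (t m - t' m - (t n - t' n)) \<le> v (t m - t' m) + v (t n - t' n)" by (intro diff_le inK)
        also have "\<dots> \<le> inverse (real (Suc N)) + inverse (real (Suc N))"
          using diff[of m] diff[of n] le[OF mn(1)] le[OF mn(2)] by simp
        finally show ?thesis using N by simp
      qed
      thus "\<exists>N. \<forall>m\<ge>N. \<forall>n\<ge>N. v (t m - t' m - (t n - t' n)) < e" by blast
    qed
    from C_diff[OF tC this] have t'C: "t' \<in> C" by simp
    have "(\<lambda>n. v (t n - t' n)) \<longlonglongrightarrow> 0"
    proof (rule tendsto_sandwich[OF _ _ tendsto_const])
      show "(\<lambda>n. 1 / real (Suc n)) \<longlonglongrightarrow> 0" using LIMSEQ_inverse_real_of_nat by (simp add: inverse_eq_divide)
      show "\<forall>\<^sub>F n in sequentially. 0 \<le> v (t n - t' n)"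
        by (intro always_eventually allI nonneg K_closed(4) C_in[OF tC] C_in[OF t'C])
      show "\<forall>\<^sub>F n in sequentially. v (t n - t' n) \<le> 1 / real (Suc n)"
        using diff by (intro always_eventually allI)
    qed
    hence "cl t = cl t'" using cl_eq_iff[OF tC t'C] by simp
    also have "\<dots> \<in> ring.Span Q Qr (map (\<lambda>b. cl (\<lambda>_. b)) bs)"
      using t'U by (intro Cons.IH bs t'C) auto
    also have "\<dots> \<subseteq> ring.Span Q Qr (map (\<lambda>b. cl (\<lambda>_. b)) (b # bs))"
      using Q.mono_Span[OF subfield_Qr carQ cl_closed[OF C_const[OF b]]] by simp
    finally show ?thesis .
  qed
qed

text \<open>The classes of a rational basis of K span the completion by \<open>cl_in_Span\<close>.
  So a dimension exists, without which the value of \<open>local_degree\<close> would carry no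
  information.\<close>

theorem local_degree_dimension:
  assumes dim: "CR.dimension d \<rat> K"
  shows "ring.dimension Q (local_degree K v) Qr (carrier Q)" "local_degree K v \<le> d" "local_degree K v \<ge> 1"
proof -
  have sQ: "subfield \<rat> complex_ring" by (simp add: subfield_complex_ring_iff subfield_set_Rats)
  obtain bs where bs: "length bs = d" "CR.Span \<rat> bs = K"
    using CR.exists_base[OF sQ dim] by blast
  have car: "set bs \<subseteq> carrier complex_ring" by (simp add: complex_ring_simps)
  have bsK: "set bs \<subseteq> K" using CR.Span_base_incl[OF sQ car] bs by simp
  let ?Bs = "map (\<lambda>b. cl (\<lambda>_. b)) bs"
  have carQ: "set ?Bs \<subseteq> carrier Q" using bsK by (auto intro!: cl_closed C_const)
  have "carrier Q \<subseteq> Q.Span Qr ?Bs"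
  proof
    fix Z assume "Z \<in> carrier Q"
    then obtain s where s: "s \<in> C" "Z = cl s" by (rule completion_cases)
    thus "Z \<in> Q.Span Qr ?Bs" using cl_in_Span[OF bsK s(1)] bs(2) C_in[OF s(1)] by auto
  qed
  hence span: "Q.Span Qr ?Bs = carrier Q" using Q.Span_in_carrier[of Qr ?Bs] carQ subfieldE(3)[OF subfield_Qr] by blast
  obtain n where n: "n \<le> d" "Q.dimension n Qr (carrier Q)"
    using Q.dimension_Span[OF subfield_Qr carQ] span bs(1) by auto
  hence "local_degree K v = n"
    using Q.dimI[OF subfield_Qr n(2)] by (simp add: local_degree_def over_def)
  thus dimQ: "Q.dimension (local_degree K v) Qr (carrier Q)" and "local_degree K v \<le> d"
    using n by simp_all
  show "local_degree K v \<ge> 1"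
  proof (rule ccontr)
    assume "\<not> ?thesis"
    hence "local_degree K v = 0" by simp
    hence "carrier Q = {\<zero>\<^bsub>Q\<^esub>}" using Q.dimension_zero dimQ subfield_Qr by metis
    thus False using one_neq_zero Q.one_closed by blast
  qed
qed


end

context valued_subfield
begin

interpretation Q: cring "place_completion K v"
  by (rule cring_completion)

text \<open>Coefficients and vectors are both represented by sequences, so that a linear relation in
  the completion becomes a null sequence of sums in K.\<close>

lemma combine_cl:
  assumes "length Ss = length Us" "set Ss \<subseteq> C" "set Us \<subseteq> C"
  shows "Q.combine (map (\<lambda>s. cl s) Ss) (map (\<lambda>s. cl s) Us) = cl (\<lambda>m. \<Sum>i<length Us. (Ss ! i) m * (Us ! i) m)"
  using assms
proof (induction Ss Us rule: list_induct2)
  case Nil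
  thus ?case by (simp add: cl_zero)
next
  case (Cons s Ss u Us)
  have "(\<lambda>m. \<Sum>i<length Us. (Ss ! i) m * (Us ! i) m) \<in> C"
    using Cons.hyps Cons.prems by (intro C_sum C_mult) auto
  thus ?case
    using Cons by (simp add: cl_mult cl_add C_mult sum.lessThan_Suc_shift del: sum.lessThan_Suc)
qed

lemma Qr_list:
  assumes "set Ks \<subseteq> Qr"
  shows "\<exists>Ss. Ks = map (\<lambda>s. cl s) Ss \<and> (\<forall>s\<in>set Ss. s \<in> C \<and> range s \<subseteq> \<rat>)"
proof -
  have "\<forall>k\<in>Qr. \<exists>s. s \<in> C \<and> range s \<subseteq> \<rat> \<and> k = cl s"
    by (auto simp: completed_rationals_eq classes_of_def)
  then obtain g where g: "\<And>k. k \<in> Qr \<Longrightarrow> g k \<in> C \<and> range (g k) \<subseteq> \<rat> \<and> k = cl (g k)" by metis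
  have "Ks = map (\<lambda>s. cl s) (map g Ks)" using assms g by (auto intro!: map_idI[symmetric])
  thus ?thesis using assms g by (intro exI[of _ "map g Ks"]) auto
qed

lemma completion_list:
  assumes "set Zs \<subseteq> carrier Q"
  shows "\<exists>Ss. Zs = map (\<lambda>s. cl s) Ss \<and> set Ss \<subseteq> C"
proof -
  have "\<exists>s. s \<in> C \<and> k = cl s" if "k \<in> carrier Q" for k
    using completion_cases[OF that] by blast
  then obtain g where g: "\<And>k. k \<in> carrier Q \<Longrightarrow> g k \<in> C \<and> k = cl (g k)" by metis
  have "Zs = map (\<lambda>s. cl s) (map g Zs)" using assms g by (auto intro!: map_idI[symmetric])
  thus ?thesis using assms g by (intro exI[of _ "map g Zs"]) auto
qed

lemma independent_drop: "Q.independent k Us \<Longrightarrow> Q.independent k (drop m Us)"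
proof (induction m arbitrary: Us)
  case (Suc m)
  show ?case
  proof (cases Us)
    case (Cons u Us')
    thus ?thesis using Suc.IH[of Us'] Suc.prems Q.independent_backwards(2) by auto
  qed (use Suc.prems in auto)
qed simp

end

section \<open>Local degrees at archimedean places\<close>

text \<open>The identity cr(z1,z2) z0 + cr(z2,z0) z1 + cr(z0,z1) z2 = 0 is such a relation unless
  all three determinants vanish; then either z0 = 0 or z1 is a real multiple of z0.\<close>

lemma real_relation_three:
  fixes z :: "nat \<Rightarrow> complex"
  shows "\<exists>r. (\<exists>i<3. r i \<noteq> (0::real)) \<and> (\<Sum>i<3. of_real (r i) * z i) = 0"
proof -
  define cr where "cr = (\<lambda>x y. Re x * Im y - Im x * Re y)"
  have expand: "(\<Sum>i<3. of_real (r i) * z i) = of_real (r 0) * z 0 + of_real (r 1) * z 1 + of_real (r 2) * z 2" for r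
    by (simp add: numeral_3_eq_3 numeral_2_eq_2)
  have ex: "?thesis" if nz: "a \<noteq> 0 \<or> b \<noteq> 0 \<or> c \<noteq> 0"
    and rel: "of_real a * z 0 + of_real b * z 1 + of_real c * z 2 = 0" for a b c
  proof -
    define r where "r = (\<lambda>i::nat. if i = 0 then a else if i = 1 then b else c)"
    have "\<exists>i<3. r i \<noteq> 0"
      using nz
    proof (elim disjE)
      assume "a \<noteq> 0"
      thus ?thesis by (intro exI[of _ 0]) (simp add: r_def)
    next
      assume "b \<noteq> 0"
      thus ?thesis by (intro exI[of _ 1]) (simp add: r_def)
    next
      assume "c \<noteq> 0"
      thus ?thesis by (intro exI[of _ 2]) (simp add: r_def)
    qed
    moreover have "(\<Sum>i<3. of_real (r i) * z i) = 0" unfolding expand using rel by (simp add: r_def)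
    ultimately show ?thesis by blast
  qed
  consider "cr (z 1) (z 2) \<noteq> 0 \<or> cr (z 2) (z 0) \<noteq> 0 \<or> cr (z 0) (z 1) \<noteq> 0" | "z 0 = 0"
    | "z 0 \<noteq> 0" "cr (z 0) (z 1) = 0" by blast
  thus ?thesis
  proof cases
    case 1
    show ?thesis
      by (rule ex[OF 1]) (simp add: complex_eq_iff cr_def algebra_simps)
  next
    case 2
    thus ?thesis by (intro ex[of 1 0 0]) auto
  next
    case 3
    have "of_real (Re (z 1 * cnj (z 0))) * z 0 + of_real (- (cmod (z 0))\<^sup>2) * z 1 = 0"
    proof -
      have c: "Re (z 0) * Im (z 1) = Im (z 0) * Re (z 1)" using 3 by (simp add: cr_def)
      have id: "(p * a + q * b) * a - (a\<^sup>2 + b\<^sup>2) * p = b * (a * q - b * p)"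
        "(p * a + q * b) * b - (a\<^sup>2 + b\<^sup>2) * q = - a * (a * q - b * p)" for a b p q :: real
        by (simp_all add: power2_eq_square algebra_simps)
      have "(Re (z 1) * Re (z 0) + Im (z 1) * Im (z 0)) * Re (z 0) = ((Re (z 0))\<^sup>2 + (Im (z 0))\<^sup>2) * Re (z 1)"
        "(Re (z 1) * Re (z 0) + Im (z 1) * Im (z 0)) * Im (z 0) = ((Re (z 0))\<^sup>2 + (Im (z 0))\<^sup>2) * Im (z 1)"
        using id[where p = "Re (z 1)" and a = "Re (z 0)" and q = "Im (z 1)" and b = "Im (z 0)"] c by simp_all
      thus ?thesis by (simp add: complex_eq_iff cmod_power2) (simp add: algebra_simps)
    qed
    thus ?thesis using 3 by (intro ex[of "Re (z 1 * cnj (z 0))" "- (cmod (z 0))\<^sup>2" 0]) auto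
  qed
qed

lemma rational_sequence:
  fixes r :: real
  shows "\<exists>q. (\<lambda>n. of_rat (q n)) \<longlonglongrightarrow> r"
proof -
  have "\<exists>q. r < of_rat q \<and> of_rat q < r + 1 / real (Suc n)" for n by (rule of_rat_dense) simp
  then obtain q where q: "\<And>n. r < of_rat (q n) \<and> of_rat (q n) < r + 1 / real (Suc n)" by metis
  have "(\<lambda>n. of_rat (q n)) \<longlonglongrightarrow> r"
  proof (rule tendsto_sandwich[OF _ _ tendsto_const])
    show "(\<lambda>n. r + 1 / real (Suc n)) \<longlonglongrightarrow> r"
      using tendsto_add[OF tendsto_const LIMSEQ_inverse_real_of_nat, of r] by (simp add: inverse_eq_divide)
  qed (use q in \<open>auto intro!: always_eventually less_imp_le\<close>)
  thus ?thesis by blast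
qed

text \<open>An archimedean completion embeds into the complex numbers, so any three of its elements satisfy a real relation.\<close>

lemma local_degree_arch_le_2:
  assumes dim: "CR.dimension d \<rat> K" and K: "subfield_set K" and s: "\<sigma> \<in> emb K"
    and v: "v \<in> places K" "\<And>x. x \<in> K \<Longrightarrow> v x = cmod (\<sigma> x)"
  shows "local_degree K v \<le> 2"
proof (rule ccontr)
  assume "\<not> ?thesis"
  hence n3: "local_degree K v \<ge> 3" by simp
  interpret valued_subfield K v by (rule place_valued[OF v(1) K])
  interpret Q: cring "place_completion K v" by (rule cring_completion)
  obtain Vs where Vs: "set Vs \<subseteq> carrier Q" "Q.independent Qr Vs" "length Vs = local_degree K v"
    using Q.exists_base[OF subfield_Qr local_degree_dimension(1)[OF dim]] by blast
  \<comment> \<open>Three independent elements suffice for the contradiction; the tail of a basis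
    provides them.\<close>
  define Us where "Us = drop (length Vs - 3) Vs"
  have Us: "length Us = 3" "Q.independent Qr Us" "set Us \<subseteq> carrier Q"
    using Vs n3 independent_drop set_drop_subset[of "length Vs - 3" Vs] by (auto simp: Us_def)
  obtain Ss where Ss: "Us = map (\<lambda>s. cl s) Ss" "set Ss \<subseteq> C" using completion_list[OF Us(3)] by blast
  have len: "length Ss = 3" using Us Ss by simp
  have SC: "Ss ! i \<in> C" if "i < 3" for i using Ss len that by auto
  have cmod_diff: "cmod (\<sigma> x - \<sigma> y) = v (x - y)" if "x \<in> K" "y \<in> K" for x y
    using that emb_diff[OF K s that] v(2)[of "x - y"] by (simp add: K_closed)
  have conv: "\<exists>z. (\<lambda>m. \<sigma> ((Ss ! i) m)) \<longlonglongrightarrow> z" if i: "i < 3" for i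
  proof -
    have "Cauchy (\<lambda>m. \<sigma> ((Ss ! i) m))"
      unfolding Cauchy_altdef2
    proof (intro allI impI)
      fix e :: real assume "e > 0"
      then obtain N where "\<forall>m\<ge>N. \<forall>n\<ge>N. v ((Ss ! i) m - (Ss ! i) n) < e" using C_cauchy[OF SC[OF i]] by blast
      hence "\<forall>n\<ge>N. dist (\<sigma> ((Ss ! i) n)) (\<sigma> ((Ss ! i) N)) < e"
        using cmod_diff C_in[OF SC[OF i]] by (simp add: dist_norm)
      thus "\<exists>N. \<forall>n\<ge>N. dist (\<sigma> ((Ss ! i) n)) (\<sigma> ((Ss ! i) N)) < e" by blast
    qed
    thus ?thesis by (simp add: Cauchy_convergent_iff convergent_def)
  qed
  then obtain z where z: "\<And>i. i < 3 \<Longrightarrow> (\<lambda>m. \<sigma> ((Ss ! i) m)) \<longlonglongrightarrow> z i" by metis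
  obtain r where r: "\<exists>i<3. r i \<noteq> 0" "(\<Sum>i<3. of_real (r i) * z i) = 0" using real_relation_three by blast
  have "\<forall>i. \<exists>q. (\<lambda>n. of_rat (q n)) \<longlonglongrightarrow> r i" using rational_sequence by blast
  from choice[OF this] obtain q where q: "\<And>i. (\<lambda>n. of_rat (q i n)) \<longlonglongrightarrow> r i" by blast
  \<comment> \<open>The real coefficients are replaced by rational Cauchy sequences converging to
    them, whose classes lie in the completed rationals.\<close>
  define \<rho> where "\<rho> = (\<lambda>i n. of_rat (q i n) :: complex)"
  have \<rho>K: "\<rho> i n \<in> K" "\<sigma> (\<rho> i n) = \<rho> i n" for i n
    using Rats_in emb_Rats[OF K s] by (auto simp: \<rho>_def)
  have v_rat: "v (of_rat a) = \<bar>of_rat a\<bar>" for a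
    using v(2)[of "of_rat a"] Rats_in emb_Rats[OF K s, of "of_rat a"] by (simp add: cmod_of_rat)
  have \<rho>C: "\<rho> i \<in> C" for i
    unfolding C_iff
  proof (intro conjI allI impI \<rho>K)
    fix e :: real assume e: "e > 0"
    have "Cauchy (\<lambda>n. of_rat (q i n) :: real)" using q LIMSEQ_imp_Cauchy by blast
    then obtain N where "\<forall>m\<ge>N. \<forall>n\<ge>N. norm (of_rat (q i m) - of_rat (q i n) :: real) < e"
      using CauchyD[OF _ e] by blast
    moreover have "v (\<rho> i m - \<rho> i n) = norm (of_rat (q i m) - of_rat (q i n) :: real)" for m n
      using v_rat[of "q i m - q i n"] by (simp add: \<rho>_def of_rat_diff)
    ultimately show "\<exists>N. \<forall>m\<ge>N. \<forall>n\<ge>N. v (\<rho> i m - \<rho> i n) < e" by auto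
  qed
  have \<rho>_lim: "(\<lambda>n. \<rho> i n) \<longlonglongrightarrow> of_real (r i)" for i
  proof -
    have "of_rat a = complex_of_real (of_rat a)" for a
    proof -
      obtain b c where "a = of_int b / of_int c" by (metis quotient_of_div surj_pair)
      thus ?thesis by (simp add: of_rat_divide)
    qed
    thus ?thesis using tendsto_of_real[OF q[of i], where 'a = complex] by (simp add: \<rho>_def)
  qed
  define Ks where "Ks = map (\<lambda>s. cl s) (map \<rho> [0..<3])"
  have "Q.combine Ks Us = cl (\<lambda>m. \<Sum>i<3. \<rho> i m * (Ss ! i) m)"
  proof -
    have "(\<lambda>m. \<Sum>i<3. (map \<rho> [0..<3] ! i) m * (Ss ! i) m) = (\<lambda>m. \<Sum>i<3. \<rho> i m * (Ss ! i) m)"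
      by (intro ext sum.cong) auto
    thus ?thesis
      unfolding Ks_def Ss(1) using combine_cl[of "map \<rho> [0..<3]" Ss] len Ss \<rho>C
      by (simp add: image_subset_iff)
  qed
  also have "\<dots> = \<zero>\<^bsub>Q\<^esub>"
  proof (subst cl_zero_iff)
    show C: "(\<lambda>m. \<Sum>i<3. \<rho> i m * (Ss ! i) m) \<in> C" using SC \<rho>C by (intro C_sum C_mult) auto
    have "v (\<Sum>i<3. \<rho> i m * (Ss ! i) m) = cmod (\<Sum>i<3. \<rho> i m * \<sigma> ((Ss ! i) m))" for m
    proof -
      have inK: "(Ss ! i) m \<in> K" if "i < 3" for i using C_in[OF SC[OF that]] .
      have "v (\<Sum>i<3. \<rho> i m * (Ss ! i) m) = cmod (\<sigma> (\<Sum>i<3. \<rho> i m * (Ss ! i) m))"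
        using C_in[OF C] by (rule v(2))
      also have "\<sigma> (\<Sum>i<3. \<rho> i m * (Ss ! i) m) = (\<Sum>i<3. \<sigma> (\<rho> i m * (Ss ! i) m))"
        using inK \<rho>K by (intro emb_sum[OF K s]) (auto simp: K_closed)
      also have "\<dots> = (\<Sum>i<3. \<rho> i m * \<sigma> ((Ss ! i) m))"
        using inK \<rho>K by (intro sum.cong) (auto simp: emb_mult[OF K s])
      finally show ?thesis .
    qed
    moreover have "(\<lambda>m. cmod (\<Sum>i<3. \<rho> i m * \<sigma> ((Ss ! i) m))) \<longlonglongrightarrow> cmod (\<Sum>i<3. of_real (r i) * z i)"
      using \<rho>_lim z by (intro tendsto_intros) auto
    ultimately show "(\<lambda>m. \<Sum>i<3. \<rho> i m * (Ss ! i) m) \<in> I" using C r(2) by (simp add: I_iff)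
  qed
  finally have "Q.combine Ks Us = \<zero>\<^bsub>Q\<^esub>" .
  moreover have "set Ks \<subseteq> Qr"
    using \<rho>C by (auto simp: Ks_def completed_rationals_eq classes_of_def \<rho>_def)
  ultimately have sub: "set (take (length Us) Ks) \<subseteq> {\<zero>\<^bsub>Q\<^esub>}"
    using Q.independent_imp_trivial_combine[OF subfield_Qr Us(2)] by blast
  \<comment> \<open>Independence makes every coefficient class zero, but \<rho> i converges to the
    nonzero number r i.\<close>
  obtain i where i: "i < 3" "r i \<noteq> 0" using r by blast
  have "cl (\<rho> i) \<in> set (take (length Us) Ks)" using i(1) Us(1) by (auto simp: Ks_def)
  hence "\<rho> i \<in> I" using sub cl_zero_iff[OF \<rho>C] by auto
  hence "(\<lambda>n. v (\<rho> i n)) \<longlonglongrightarrow> 0" by (simp add: I_iff)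
  moreover have "(\<lambda>n. v (\<rho> i n)) \<longlonglongrightarrow> \<bar>r i\<bar>"
    using tendsto_rabs[OF q[of i]] by (simp add: \<rho>_def v_rat)
  ultimately show False using i(2) LIMSEQ_unique by fastforce
qed

section \<open>Ramification bounds the local degree\<close>

context nonarch_subfield
begin

lemma add_eq_max:
  assumes x: "x \<in> K" and y: "y \<in> K" and ne: "v x \<noteq> v y"
  shows "v (x + y) = max (v x) (v y)"
proof -
  have *: "v (a + b) = v b" if ab: "a \<in> K" "b \<in> K" "v a < v b" for a b
  proof (rule antisym)
    show "v (a + b) \<le> v b" using add_le_max[of a b] ab by simp
    have "v ((a + b) + (- a)) \<le> max (v (a + b)) (v (- a))" using ab by (intro add_le_max) (auto simp: K_closed)
    thus "v b \<le> v (a + b)" using ab by (auto simp: uminus)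
  qed
  show ?thesis
  proof (cases "v x < v y")
    case True
    thus ?thesis using *[OF x y True] by simp
  next
    case False
    hence "v y < v x" using ne by simp
    thus ?thesis using *[OF y x] by (simp add: add.commute)
  qed
qed

text \<open>The value of a nonzero partial sum is the value of one of its terms, so it differs from
  that of the next nonzero term and the larger of the two survives. The second conjunct carries this
  through the induction.\<close>

lemma sum_distinct:
  assumes "finite J" "\<And>i. i \<in> J \<Longrightarrow> f i \<in> K"
    and "\<And>i j. i \<in> J \<Longrightarrow> j \<in> J \<Longrightarrow> i \<noteq> j \<Longrightarrow> f i \<noteq> 0 \<Longrightarrow> f j \<noteq> 0 \<Longrightarrow> v (f i) \<noteq> v (f j)"
  shows "(\<forall>i\<in>J. v (f i) \<le> v (sum f J)) \<and> (sum f J = 0 \<or> (\<exists>j\<in>J. f j \<noteq> 0 \<and> v (sum f J) = v (f j)))"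
  using assms
proof (induction J rule: finite_induct)
  case (insert a J)
  have IH: "\<forall>i\<in>J. v (f i) \<le> v (sum f J)" "sum f J = 0 \<or> (\<exists>j\<in>J. f j \<noteq> 0 \<and> v (sum f J) = v (f j))"
    using insert.IH insert.prems by blast+
  have inK: "f a \<in> K" "sum f J \<in> K" using insert.prems(1) by (auto intro: subring_set_sum[OF sr])
  consider "f a = 0" | "f a \<noteq> 0" "sum f J = 0" | "f a \<noteq> 0" "sum f J \<noteq> 0" by blast
  thus ?case
  proof cases
    case 1
    thus ?thesis using IH insert.hyps nonneg[OF inK(2)] by (auto simp: zero)
  next
    case 2
    hence "v (f i) = 0" if "i \<in> J" for i using IH(1) that nonneg insert.prems(1) zero by force
    thus ?thesis using 2 insert.hyps nonneg[OF inK(1)] by auto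
  next
    case 3
    then obtain j where j: "j \<in> J" "f j \<noteq> 0" "v (sum f J) = v (f j)" using IH(2) by blast
    have "v (f a) \<noteq> v (sum f J)" using insert.prems(2)[of a j] insert.hyps j 3 by auto
    from add_eq_max[OF inK this] have eq: "v (sum f (insert a J)) = max (v (f a)) (v (sum f J))"
      using insert.hyps by simp
    show ?thesis
    proof
      show "\<forall>i\<in>insert a J. v (f i) \<le> v (sum f (insert a J))" using IH(1) unfolding eq by (auto simp: le_max_iff_disj)
      show "sum f (insert a J) = 0 \<or> (\<exists>j\<in>insert a J. f j \<noteq> 0 \<and> v (sum f (insert a J)) = v (f j))"
        using 3 j unfolding eq max_def by auto
    qed
  qed
qed simp

text \<open>The powers x^i with i < e are independent over the completed rationals. Nonzero rational
  multiples of different powers have different values, so \<open>sum_distinct\<close> bounds every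
  term of a combination by the whole; if the combination is null, so is each coefficient
  sequence.\<close>

lemma ramification_le_local_degree:
  assumes dim: "CR.dimension d \<rat> K" and x: "x \<in> K" "x \<noteq> 0"
    and distinct: "\<And>j r. 0 < j \<Longrightarrow> j < e \<Longrightarrow> r \<in> \<rat> \<Longrightarrow> v x ^ j \<noteq> v r"
  shows "e \<le> local_degree K v"
proof -
  interpret Q: cring "place_completion K v" by (rule cring_completion)
  define Us where "Us = map (\<lambda>s. cl s) (map (\<lambda>i _. x ^ i) [0..<e])"
  have UC: "(\<lambda>_. x ^ i) \<in> C" for i using x by (intro C_const) (simp add: K_closed)
  have Us: "length Us = e" "set Us \<subseteq> carrier Q" using UC by (auto simp: Us_def cl_closed)
  have "Q.independent Qr Us"
  proof (rule Q.trivial_combine_imp_independent[OF subfield_Qr Us(2)])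
    fix Ks assume Ks: "set Ks \<subseteq> Qr" "Q.combine Ks Us = \<zero>\<^bsub>Q\<^esub>"
    obtain Ss where Ss: "Ks = map (\<lambda>s. cl s) Ss" "\<And>s. s \<in> set Ss \<Longrightarrow> s \<in> C \<and> range s \<subseteq> \<rat>"
      using Qr_list[OF Ks(1)] by blast
    define L where "L = min (length Ks) e"
    have len: "length (take L Ss) = L" using Ss(1) by (simp add: L_def)
    have S: "Ss ! i \<in> C" "(Ss ! i) m \<in> \<rat>" if "i < L" for i m
      using Ss(2)[of "Ss ! i"] Ss(1) that by (auto simp: L_def)
    \<comment> \<open>\<open>Q.combine\<close> stops at the shorter list and the coefficient list
      may have any length, so both lists are cut to length L.\<close>
    have "Q.combine As Bs = Q.combine (take (min (length As) (length Bs)) As) (take (min (length As) (length Bs)) Bs)"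
      for As Bs by (induction As Bs rule: Q.combine.induct) auto
    from this[of Ks Us] have "Q.combine Ks Us = Q.combine (take L Ks) (take L Us)"
      by (simp only: L_def Us(1))
    also have "\<dots> = cl (\<lambda>m. \<Sum>i<L. (Ss ! i) m * x ^ i)"
    proof -
      have "take L Us = map (\<lambda>s. cl s) (map (\<lambda>i _. x ^ i) [0..<L])"
        by (simp add: Us_def take_map L_def)
      moreover have "take L Ks = map (\<lambda>s. cl s) (take L Ss)" using Ss(1) by (simp add: take_map)
      moreover have "set (take L Ss) \<subseteq> C" using Ss(2) set_take_subset[of L Ss] by blast
      moreover have "(\<lambda>m. \<Sum>i<L. (take L Ss ! i) m * (map (\<lambda>i _. x ^ i) [0..<L] ! i) m)
          = (\<lambda>m. \<Sum>i<L. (Ss ! i) m * x ^ i)"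
        by (intro ext sum.cong) auto
      ultimately show ?thesis
        using combine_cl[of "take L Ss" "map (\<lambda>i _. x ^ i) [0..<L]"] len UC by (simp add: image_subset_iff)
    qed
    finally have "cl (\<lambda>m. \<Sum>i<L. (Ss ! i) m * x ^ i) = \<zero>\<^bsub>Q\<^esub>" using Ks(2) by simp
    moreover have "(\<lambda>m. \<Sum>i<L. (Ss ! i) m * x ^ i) \<in> C" using S(1) UC by (intro C_sum C_mult) auto
    ultimately have lim: "(\<lambda>m. v (\<Sum>i<L. (Ss ! i) m * x ^ i)) \<longlonglongrightarrow> 0"
      using cl_zero_iff by (simp add: I_iff)
    have "Ss ! j \<in> I" if j: "j < L" for j
    proof (rule null_dominated[OF S(1)[OF j]])
      have vx: "v x > 0" using pos x by blast
      show "v ((Ss ! j) m) \<le> v (\<Sum>i<L. (Ss ! i) m * x ^ i) * inverse (v x ^ j)" for m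
      proof -
        have inK: "(Ss ! i) m \<in> K" if "i < L" for i using S(2)[OF that] Rats_in by blast
        have ne: "v ((Ss ! i) m * x ^ i) \<noteq> v ((Ss ! k) m * x ^ k)"
          if ik: "i < k" "k < L" "(Ss ! i) m \<noteq> 0" "(Ss ! k) m \<noteq> 0" for i k
        proof
          assume "v ((Ss ! i) m * x ^ i) = v ((Ss ! k) m * x ^ k)"
          hence eq: "v ((Ss ! i) m) * v x ^ i = v ((Ss ! k) m) * (v x ^ i * v x ^ (k - i))"
            using ik inK x by (simp add: mult power K_closed flip: power_add)
          have "v x ^ (k - i) = v ((Ss ! i) m) / v ((Ss ! k) m)"
            using eq vx pos[OF inK[of k]] ik by (simp add: field_simps)
          also have "\<dots> = v ((Ss ! i) m / (Ss ! k) m)" using inK ik by (simp add: divide)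
          finally have "v x ^ (k - i) = v ((Ss ! i) m / (Ss ! k) m)" .
          moreover have "(Ss ! i) m / (Ss ! k) m \<in> \<rat>" using S(2) ik by simp
          moreover have "k - i < e" "0 < k - i" using ik by (auto simp: L_def)
          ultimately show False using distinct by blast
        qed
        have "v ((Ss ! j) m * x ^ j) \<le> v (\<Sum>i<L. (Ss ! i) m * x ^ i)"
        proof -
          have "\<forall>i\<in>{..<L}. v ((Ss ! i) m * x ^ i) \<le> v (\<Sum>i<L. (Ss ! i) m * x ^ i)"
          proof (rule conjunct1[OF sum_distinct])
            show "(Ss ! i) m * x ^ i \<in> K" if "i \<in> {..<L}" for i using that inK x by (simp add: K_closed)
            fix i k assume "i \<in> {..<L}" "k \<in> {..<L}" "i \<noteq> k" "(Ss ! i) m * x ^ i \<noteq> 0" "(Ss ! k) m * x ^ k \<noteq> 0"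
            thus "v ((Ss ! i) m * x ^ i) \<noteq> v ((Ss ! k) m * x ^ k)"
              using ne[of i k] ne[of k i] by (cases "i < k") auto
          qed simp
          thus ?thesis using j by simp
        qed
        thus ?thesis using inK[OF j] x vx by (simp add: mult power K_closed field_simps)
      qed
      show "(\<lambda>m. v (\<Sum>i<L. (Ss ! i) m * x ^ i) * inverse (v x ^ j)) \<longlonglongrightarrow> 0"
        using tendsto_mult_right[OF lim, of "inverse (v x ^ j)"] by simp
    qed
    hence "Ks ! j = \<zero>\<^bsub>Q\<^esub>" if "j < L" for j
      using cl_zero_iff[OF S(1)[OF that]] that Ss(1) by (simp add: L_def)
    thus "set (take (length Us) Ks) \<subseteq> {\<zero>\<^bsub>Q\<^esub>}" by (auto simp: set_conv_nth Us L_def)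
  qed
  from Q.independent_length_le_dimension[OF subfield_Qr local_degree_dimension(1)[OF dim] this Us(2)]
  show ?thesis using Us(1) by simp
qed

end

subsection \<open>Extending p-adic absolute values\<close>

locale valuation_ring =
  fixes V :: "complex set"
  assumes subring: "subring_set V" and total: "y \<in> V \<or> inverse y \<in> V"
begin

definition U :: "complex set" where "U = {x. x \<noteq> 0 \<and> x \<in> V \<and> inverse x \<in> V}"

lemmas V_closed = subring_set_0[OF subring] subring_set_1[OF subring] subring_set_add[OF subring]
  subring_set_diff[OF subring] subring_set_mult[OF subring] subring_set_uminus[OF subring]
  subring_set_power[OF subring] subring_set_of_nat[OF subring] subring_set_of_int[OF subring]

lemma U_one: "1 \<in> U"
  by (simp add: U_def V_closed)

lemma U_mult: "x \<in> U \<Longrightarrow> y \<in> U \<Longrightarrow> x * y \<in> U"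
  by (auto simp: U_def V_closed)

lemma U_inverse: "x \<in> U \<Longrightarrow> inverse x \<in> U"
  by (auto simp: U_def)

lemma U_divide: "x \<in> U \<Longrightarrow> y \<in> U \<Longrightarrow> x / y \<in> U"
  by (simp add: divide_inverse U_mult U_inverse)

lemma U_power: "x \<in> U \<Longrightarrow> x ^ n \<in> U"
  by (induction n) (auto simp: U_one U_mult)

lemma U_uminus: "x \<in> U \<Longrightarrow> - x \<in> U"
  by (auto simp: U_def V_closed)

lemma nonunit_mult:
  assumes "x \<in> V" "x \<notin> U" "y \<in> V"
  shows "y * x \<notin> U"
proof
  assume "y * x \<in> U"
  hence "y * x \<noteq> 0" "inverse (y * x) \<in> V" by (auto simp: U_def)
  hence "inverse x = y * inverse (y * x)" "x \<noteq> 0" by auto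
  hence "inverse x \<in> V" using \<open>inverse (y * x) \<in> V\<close> assms(3) by (metis V_closed(5))
  thus False using assms \<open>x \<noteq> 0\<close> by (simp add: U_def)
qed

text \<open>One of x/y and y/x lies in V; factoring out the larger summand reduces the claim to
  \<open>nonunit_mult\<close>. So the nonunits of V form an ideal.\<close>

lemma nonunit_add:
  assumes x: "x \<in> V" "x \<notin> U" and y: "y \<in> V" "y \<notin> U"
  shows "x + y \<notin> U"
proof -
  consider "x = 0" | "y = 0" | "y \<noteq> 0" "x / y \<in> V" | "x \<noteq> 0" "y / x \<in> V"
    using total[of "x / y"] by fastforce
  thus ?thesis
  proof cases
    case 3
    hence "(1 + x / y) * y \<notin> U" using y by (intro nonunit_mult) (auto simp: V_closed)
    thus ?thesis using 3 by (simp add: field_simps)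
  next
    case 4
    hence "(1 + y / x) * x \<notin> U" using x by (intro nonunit_mult) (auto simp: V_closed)
    thus ?thesis using 4 by (simp add: field_simps)
  qed (use x y in auto)
qed

lemma nonunit_sum:
  "finite J \<Longrightarrow> (\<And>i. i \<in> J \<Longrightarrow> f i \<in> V \<and> f i \<notin> U) \<Longrightarrow> sum f J \<in> V \<and> sum f J \<notin> U"
  by (induction J rule: finite_induct) (auto simp: V_closed nonunit_add, auto simp: U_def)

text \<open>Divisibility in V is a total preorder, so a finite family has a term that divides all
  the others.\<close>

lemma dominant_term:
  assumes "finite J" "J \<noteq> {}" "\<And>i. i \<in> J \<Longrightarrow> f i \<noteq> (0::complex)"
  shows "\<exists>j\<in>J. \<forall>i\<in>J. f i / f j \<in> V"
  using assms
proof (induction J rule: finite_ne_induct)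
  case (singleton x)
  thus ?case by (simp add: V_closed)
next
  case (insert a J)
  then obtain j where j: "j \<in> J" "\<forall>i\<in>J. f i / f j \<in> V" by blast
  have nz: "f a \<noteq> 0" "f j \<noteq> 0" using insert.prems j by auto
  show ?case
  proof (cases "f a / f j \<in> V")
    case True
    thus ?thesis using j by auto
  next
    case False
    hence ja: "f j / f a \<in> V" using total[of "f a / f j"] by simp
    have "f i / f a \<in> V" if "i \<in> J" for i
    proof -
      have "f i / f a = (f i / f j) * (f j / f a)" using nz by simp
      thus ?thesis using j(2) that ja V_closed(5) by metis
    qed
    thus ?thesis using nz by (intro bexI[of _ a]) (auto simp: V_closed)
  qed
qed

text \<open>After division by a dominant term the other terms sum to -1, a unit, whereas a sum of
  nonunits is a nonunit. In valuation terms, two summands of a vanishing sum have equal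
  value.\<close>

lemma associated_terms:
  assumes J: "finite J" "J \<noteq> {}" "\<And>i. i \<in> J \<Longrightarrow> f i \<noteq> (0::complex)" and s: "sum f J = 0"
  shows "\<exists>i\<in>J. \<exists>j\<in>J. i \<noteq> j \<and> f i / f j \<in> U"
proof (rule ccontr)
  assume H: "\<not> ?thesis"
  from dominant_term[OF J] obtain j where j: "j \<in> J" "\<forall>i\<in>J. f i / f j \<in> V" ..
  have "(\<Sum>i\<in>J - {j}. f i / f j) \<notin> U"
  proof (rule conjunct2[OF nonunit_sum])
    show "f i / f j \<in> V \<and> f i / f j \<notin> U" if "i \<in> J - {j}" for i
      using H j that by (metis DiffE singletonI)
  qed (use J(1) in simp)
  moreover have "(\<Sum>i\<in>J - {j}. f i / f j) = - 1"
  proof -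
    have "f j + sum f (J - {j}) = 0" using s J(1) j(1) by (simp add: sum.remove)
    hence "sum f (J - {j}) = - f j" by (simp add: eq_neg_iff_add_eq_0 add.commute)
    thus ?thesis using J(3)[OF j(1)] by (simp flip: sum_divide_distrib)
  qed
  ultimately show False using U_uminus[OF U_one] by simp
qed

end

locale padic_valuation_ring = valuation_ring +
  fixes p :: nat
  assumes prime: "Factorial_Ring.prime p" and p_nonunit: "inverse (of_nat p) \<notin> V"
begin

lemma p_pos: "p > 0" "(of_nat p :: complex) \<noteq> 0"
  using prime by (auto simp: prime_gt_0_nat)

lemma p_power_int_in_V: "of_nat p powi k \<in> V \<longleftrightarrow> k \<ge> 0"
proof
  assume "k \<ge> 0"
  thus "of_nat p powi k \<in> V" by (simp add: power_int_def V_closed)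
next
  assume H: "of_nat p powi k \<in> V"
  show "k \<ge> 0"
  proof (rule ccontr)
    assume "\<not> k \<ge> 0"
    hence "of_nat p ^ nat (- k - 1) * (of_nat p :: complex) powi k = of_nat p powi (- k - 1 + k)"
      using p_pos by (subst power_int_add) (auto simp: power_int_def)
    also have "\<dots> = inverse (of_nat p)" by (simp add: power_int_minus)
    finally have "inverse (of_nat p) = of_nat p ^ nat (- k - 1) * (of_nat p :: complex) powi k" by simp
    also have "\<dots> \<in> V" by (intro V_closed(5) V_closed(7) V_closed(8) H)
    finally show False using p_nonunit by simp
  qed
qed

lemma p_power_int_in_U: "of_nat p powi k \<in> U \<longleftrightarrow> k = 0"
proof
  assume "of_nat p powi k \<in> U"
  hence "of_nat p powi k \<in> V" "of_nat p powi (- k) \<in> V" by (auto simp: U_def power_int_minus)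
  thus "k = 0" by (simp add: p_power_int_in_V)
qed (simp add: U_one)

text \<open>A Bezout combination of n and p equals 1. If n were a nonunit then, p being one as well,
  so would be 1.\<close>

lemma int_in_U:
  assumes "\<not> int p dvd n"
  shows "of_int n \<in> U"
proof (rule ccontr)
  assume n: "of_int n \<notin> U"
  have "coprime (int p) n" using prime assms by (simp add: prime_imp_coprime)
  then obtain u w where uw: "u * n + w * int p = 1"
    by (metis bezout_int coprime_imp_gcd_eq_1 mult.commute add.commute)
  have pU: "of_nat p \<notin> U" using p_nonunit by (auto simp: U_def)
  have "of_int u * of_int n + of_int w * of_nat p \<notin> U"
    using n pU nonunit_mult by (intro nonunit_add) (auto simp: V_closed)
  moreover have "of_int u * of_int n + of_int w * of_nat p = (of_int (u * n + w * int p) :: complex)" by simp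
  ultimately show False unfolding uw using U_one by simp
qed

lemma int_decomp:
  assumes "n \<noteq> 0"
  shows "\<exists>u\<in>U. of_int n = of_nat p powi int (multiplicity (int p) n) * u"
proof -
  have nu: "\<not> is_unit (int p)" using prime_gt_1_nat[OF prime] by simp
  obtain n' where n': "n = int p ^ multiplicity (int p) n * n'" "\<not> int p dvd n'"
    by (rule multiplicity_decompose'[OF assms nu])
  have "of_int n = (of_nat p ^ multiplicity (int p) n * of_int n' :: complex)"
    by (subst n'(1)) simp
  thus ?thesis using int_in_U[OF n'(2)] by auto
qed

text \<open>Here t is the order of x, normalised so that p has order 1. A power x^e is used because
  the order of an algebraic number need not be an integer; e, k and u are not unique, so the order
  starts out as a relation.\<close>

definition has_ord :: "complex \<Rightarrow> real \<Rightarrow> bool" where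
  "has_ord x t \<longleftrightarrow> (\<exists>e>0. \<exists>k. \<exists>u\<in>U. x ^ e = of_nat p powi k * u \<and> t = real_of_int k / real e)"

text \<open>Raising both representations to a common exponent yields a power of p that is a unit, so
  its exponent is 0.\<close>

lemma has_ord_unique:
  assumes "has_ord x s" "has_ord x t"
  shows "s = t"
proof -
  obtain e k u e' k' u' where *: "e > 0" "u \<in> U" "x ^ e = of_nat p powi k * u" "s = real_of_int k / real e"
    "e' > 0" "u' \<in> U" "x ^ e' = of_nat p powi k' * u'" "t = real_of_int k' / real e'"
    using assms unfolding has_ord_def by blast
  have nz: "u \<noteq> 0" "u' \<noteq> 0" using * by (auto simp: U_def)
  have "x ^ (e * e') = of_nat p powi (k * int e') * u ^ e'"
    using * by (simp add: power_mult power_mult_distrib power_int_mult)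
  moreover have "x ^ (e * e') = of_nat p powi (k' * int e) * u' ^ e"
    using * by (simp add: mult.commute[of e] power_mult power_mult_distrib power_int_mult)
  ultimately have "of_nat p powi (k * int e') * u ^ e' = of_nat p powi (k' * int e) * u' ^ e" by simp
  hence "of_nat p powi (k * int e' - k' * int e) = u' ^ e / u ^ e'"
    using nz p_pos by (simp add: power_int_diff field_simps)
  hence "of_nat p powi (k * int e' - k' * int e) \<in> U" using * by (simp add: U_divide U_power)
  hence "k * int e' = k' * int e" by (simp add: p_power_int_in_U)
  hence "real_of_int k * real e' = real_of_int k' * real e" by (metis of_int_mult of_int_of_nat_eq)
  thus ?thesis unfolding *(4) *(8) using *(1,5) by (simp add: frac_eq_eq)
qed

lemma has_ord_mult:
  assumes "has_ord x s" "has_ord y t"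
  shows "has_ord (x * y) (s + t)"
proof -
  obtain e k u e' k' u' where *: "e > 0" "u \<in> U" "x ^ e = of_nat p powi k * u" "s = real_of_int k / real e"
    "e' > 0" "u' \<in> U" "y ^ e' = of_nat p powi k' * u'" "t = real_of_int k' / real e'"
    using assms unfolding has_ord_def by blast
  have "y ^ (e * e') = (y ^ e') ^ e" by (metis mult.commute power_mult)
  hence "(x * y) ^ (e * e') = (x ^ e) ^ e' * (y ^ e') ^ e" by (simp only: power_mult_distrib power_mult[of x])
  also have "\<dots> = (of_nat p powi k) ^ e' * (of_nat p powi k') ^ e * (u ^ e' * u' ^ e)"
    unfolding *(3) *(7) by (simp add: power_mult_distrib)
  also have "(of_nat p powi k) ^ e' * (of_nat p powi k') ^ e = (of_nat p powi (k * int e' + k' * int e) :: complex)"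
    using p_pos by (simp add: power_int_mult power_int_add)
  finally have "(x * y) ^ (e * e') = of_nat p powi (k * int e' + k' * int e) * (u ^ e' * u' ^ e)" .
  moreover have "u ^ e' * u' ^ e \<in> U" using * by (simp add: U_mult U_power)
  moreover have "s + t = real_of_int (k * int e' + k' * int e) / real (e * e')" "e * e' > 0"
    unfolding *(4) *(8) using *(1,5) by (simp_all add: add_frac_eq)
  ultimately show ?thesis unfolding has_ord_def by blast
qed

lemma has_ord_nonneg: "has_ord x t \<Longrightarrow> x \<in> V \<Longrightarrow> t \<ge> 0"
proof -
  assume "has_ord x t" and x: "x \<in> V"
  then obtain e k u where *: "e > 0" "u \<in> U" "x ^ e = of_nat p powi k * u" "t = real_of_int k / real e"
    unfolding has_ord_def by blast
  have "of_nat p powi k = x ^ e * inverse u" using * by (auto simp: U_def)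
  also have "\<dots> \<in> V" using * x by (intro V_closed) (auto simp: U_def)
  finally show "t \<ge> 0" using * by (simp add: p_power_int_in_V)
qed

lemma has_ord_neg:
  assumes "has_ord x t" and x: "x \<notin> V"
  shows "t < 0"
proof (rule ccontr)
  assume "\<not> t < 0"
  obtain e k u where *: "e > 0" "u \<in> U" "x ^ e = of_nat p powi k * u" "t = real_of_int k / real e"
    using assms unfolding has_ord_def by blast
  hence "k \<ge> 0" using \<open>\<not> t < 0\<close> by (simp add: divide_less_0_iff)
  hence "x ^ e \<in> V" using * by (auto simp: U_def intro!: V_closed(5) p_power_int_in_V[THEN iffD2])
  moreover have inv: "inverse x \<in> V" and "x \<noteq> 0" using total[of x] x V_closed(1) by auto
  moreover obtain e' where e': "e = Suc e'" using * by (cases e) auto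
  \<comment> \<open>As 1/x lies in V, membership of x^e would bring x itself back into V.\<close>
  have "x = x ^ e * inverse x ^ e'" using \<open>x \<noteq> 0\<close> by (simp add: e' field_simps)
  ultimately show False using x V_closed(5,7) by metis
qed

lemma has_ord_of_int: "n \<noteq> 0 \<Longrightarrow> has_ord (of_int n) (real (multiplicity (int p) n))"
proof -
  assume "n \<noteq> 0"
  then obtain u where "u \<in> U" "of_int n = of_nat p powi int (multiplicity (int p) n) * u"
    using int_decomp by blast
  thus ?thesis unfolding has_ord_def
    by (intro exI[of _ 1] exI[of _ "int (multiplicity (int p) n)"] conjI bexI[of _ u]) auto
qed

lemma has_ord_inverse: "has_ord x t \<Longrightarrow> has_ord (inverse x) (- t)"
proof -
  assume "has_ord x t"
  then obtain e k u where *: "e > 0" "u \<in> U" "x ^ e = of_nat p powi k * u" "t = real_of_int k / real e"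
    unfolding has_ord_def by blast
  have "inverse x ^ e = of_nat p powi (- k) * inverse u" using * by (simp add: power_inverse power_int_minus)
  thus ?thesis unfolding has_ord_def using * U_inverse
    by (intro exI[of _ e] exI[of _ "- k"] conjI bexI[of _ "inverse u"]) auto
qed

lemma has_ord_of_rat:
  assumes "r \<noteq> 0"
  shows "has_ord (of_rat r) (real (multiplicity (int p) (fst (quotient_of r))) - real (multiplicity (int p) (snd (quotient_of r))))"
proof -
  obtain a b where ab: "quotient_of r = (a, b)" by fastforce
  have r: "r = of_int a / of_int b" and "b > 0" using quotient_of_div[OF ab] quotient_of_denom_pos[OF ab] by auto
  have "a \<noteq> 0" using assms r by auto
  have "has_ord (of_int a * inverse (of_int b)) (real (multiplicity (int p) a) + - real (multiplicity (int p) b))"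
    using \<open>a \<noteq> 0\<close> \<open>b > 0\<close> by (intro has_ord_mult has_ord_inverse has_ord_of_int) auto
  moreover have "of_rat r = (of_int a * inverse (of_int b) :: complex)"
    using of_rat_divide[of "of_int a" "of_int b"] by (simp only: r divide_inverse[symmetric] of_rat_of_int_eq)
  ultimately show ?thesis by (simp add: ab)
qed

text \<open>In a rational equation for x two of the nonzero terms are associated by
  \<open>associated_terms\<close>, so some power of x is a unit times a rational number, and nonzero
  rationals have an order.\<close>

lemma has_ord_exists:
  assumes x: "algebraic x" "x \<noteq> 0"
  shows "\<exists>t. has_ord x t"
proof -
  obtain P where P: "\<And>i. poly.coeff P i \<in> \<rat>" "P \<noteq> 0" "poly P x = 0"
    using x by (auto simp: algebraic_altdef)
  define J where "J = {i. i \<le> degree P \<and> poly.coeff P i \<noteq> 0}"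
  have "(\<Sum>i\<in>J. poly.coeff P i * x ^ i) = (\<Sum>i\<le>degree P. poly.coeff P i * x ^ i)"
    by (intro sum.mono_neutral_left) (auto simp: J_def)
  hence "(\<Sum>i\<in>J. poly.coeff P i * x ^ i) = 0" using P by (simp add: poly_altdef)
  moreover have "degree P \<in> J" using P by (simp add: J_def)
  hence "J \<noteq> {}" by blast
  moreover have "finite J" "\<And>i. i \<in> J \<Longrightarrow> poly.coeff P i * x ^ i \<noteq> 0" using x(2) by (auto simp: J_def)
  ultimately have "\<exists>i\<in>J. \<exists>j\<in>J. i \<noteq> j \<and> (poly.coeff P i * x ^ i) / (poly.coeff P j * x ^ j) \<in> U"
    by (intro associated_terms)
  then obtain i j where ij: "i \<in> J" "j \<in> J" "i \<noteq> j" "(poly.coeff P i * x ^ i) / (poly.coeff P j * x ^ j) \<in> U"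
    by blast
  have "\<exists>e>0. \<exists>r. r \<in> \<rat> \<and> r \<noteq> 0 \<and> x ^ e / r \<in> U"
  proof (cases "i < j")
    case True
    have eq: "x ^ (j - i) / (poly.coeff P i / poly.coeff P j) = inverse ((poly.coeff P i * x ^ i) / (poly.coeff P j * x ^ j))"
    proof -
      have "x ^ j = x ^ i * x ^ (j - i)" using True by (simp flip: power_add)
      thus ?thesis using ij x(2) by (simp add: J_def)
    qed
    have "x ^ (j - i) / (poly.coeff P i / poly.coeff P j) \<in> U" unfolding eq by (rule U_inverse[OF ij(4)])
    thus ?thesis using True ij P(1) by (intro exI[of _ "j - i"] conjI exI[of _ "poly.coeff P i / poly.coeff P j"]) (auto simp: J_def)
  next
    case False
    have eq: "x ^ (i - j) / (poly.coeff P j / poly.coeff P i) = (poly.coeff P i * x ^ i) / (poly.coeff P j * x ^ j)"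
    proof -
      have "x ^ i = x ^ j * x ^ (i - j)" using False by (simp flip: power_add)
      thus ?thesis using ij x(2) by (simp add: J_def)
    qed
    have "x ^ (i - j) / (poly.coeff P j / poly.coeff P i) \<in> U" unfolding eq by (rule ij(4))
    thus ?thesis using False ij P(1) by (intro exI[of _ "i - j"] conjI exI[of _ "poly.coeff P j / poly.coeff P i"]) (auto simp: J_def)
  qed
  then obtain e r where er: "e > 0" "r \<in> \<rat>" "r \<noteq> 0" "x ^ e / r \<in> U" by blast
  obtain q where q: "r = of_rat q" using er(2) by (rule Rats_cases)
  obtain t where "has_ord r t" using has_ord_of_rat[of q] er(3) q by auto
  then obtain e' k u where *: "e' > 0" "u \<in> U" "r ^ e' = of_nat p powi k * u" unfolding has_ord_def by blast
  have "x ^ (e * e') = (x ^ e / r) ^ e' * r ^ e'" using er by (simp add: power_mult power_divide)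
  also have "\<dots> = of_nat p powi k * ((x ^ e / r) ^ e' * u)" using * by simp
  finally have "x ^ (e * e') = of_nat p powi k * ((x ^ e / r) ^ e' * u)" .
  moreover have "(x ^ e / r) ^ e' * u \<in> U" using er * by (intro U_mult U_power)
  moreover have "e * e' > 0" using er * by simp
  ultimately show ?thesis unfolding has_ord_def by blast
qed

definition ord :: "complex \<Rightarrow> real" where "ord x = (THE t. has_ord x t)"

lemma ord_eq: "has_ord x t \<Longrightarrow> ord x = t"
  unfolding ord_def using has_ord_unique by blast

lemma has_ord: "algebraic x \<Longrightarrow> x \<noteq> 0 \<Longrightarrow> has_ord x (ord x)"
  using has_ord_exists ord_eq by metis

definition pabs :: "complex \<Rightarrow> real" where
  "pabs x = (if x = 0 then 0 else real p powr (- ord x))"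

lemma p_gt_1: "real p > 1"
  using prime prime_gt_1_nat by simp

lemma pabs_mult: "algebraic x \<Longrightarrow> algebraic y \<Longrightarrow> pabs (x * y) = pabs x * pabs y"
  using has_ord_mult[OF has_ord has_ord, of x y] by (auto simp: pabs_def ord_eq powr_add powr_minus)

text \<open>In x + y = y (1 + x/y) the second factor lies in V, hence has nonnegative order. The
  algebraicity assumptions secure that the orders exist.\<close>

lemma pabs_add:
  assumes x: "algebraic x" and y: "algebraic y" and xy: "algebraic (x / y)" "algebraic (x + y)"
    "algebraic (1 + x / y)" and V: "y \<noteq> 0" "x / y \<in> V"
  shows "pabs (x + y) \<le> pabs y"
proof (cases "x + y = 0")
  case False
  have eq: "x + y = y * (1 + x / y)" using V by (simp add: field_simps)
  hence nz: "1 + x / y \<noteq> 0" using False by auto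
  have h: "has_ord (1 + x / y) (ord (1 + x / y))" using xy nz by (intro has_ord)
  hence "ord (1 + x / y) \<ge> 0" using V by (intro has_ord_nonneg[OF h]) (auto simp: V_closed)
  moreover have "ord (x + y) = ord y + ord (1 + x / y)"
    unfolding eq by (rule ord_eq[OF has_ord_mult[OF has_ord[OF y V(1)] h]])
  ultimately have "- ord (x + y) \<le> - ord y" by simp
  hence "real p powr (- ord (x + y)) \<le> real p powr (- ord y)" using p_gt_1 by (intro powr_mono) auto
  thus ?thesis using False V by (simp add: pabs_def)
qed (simp add: pabs_def)

lemma pabs_place:
  assumes \<alpha>: "algebraic \<alpha>"
  shows "restrict pabs (adjoin \<alpha>) \<in> padic_places (adjoin \<alpha>) p"
proof -
  note K = subfield_adjoin[OF \<alpha>]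
  note sr = subfield_set_subring[OF K]
  note alg = algebraic_in_adjoin[OF \<alpha>]
  have tri: "pabs (x + y) \<le> pabs x + pabs y" if xy: "x \<in> adjoin \<alpha>" "y \<in> adjoin \<alpha>" for x y
  proof -
    have pos: "pabs z \<ge> 0" for z by (simp add: pabs_def)
    consider "x = 0" | "y = 0" | "y \<noteq> 0" "x / y \<in> V" | "x \<noteq> 0" "y / x \<in> V"
      using total[of "x / y"] by fastforce
    thus ?thesis
    proof cases
      case 3
      hence "pabs (x + y) \<le> pabs y"
        using xy by (intro pabs_add alg subring_set_add[OF sr] subfield_set_divide[OF K] subring_set_1[OF sr]) auto
      thus ?thesis using pos[of x] by simp
    next
      case 4
      hence "pabs (y + x) \<le> pabs x"
        using xy by (intro pabs_add alg subring_set_add[OF sr] subfield_set_divide[OF K] subring_set_1[OF sr]) auto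
      thus ?thesis using pos[of y] by (simp add: add.commute)
    qed (use pos in \<open>auto simp: pabs_def\<close>)
  qed
  have "pabs x \<ge> 0 \<and> (pabs x = 0 \<longleftrightarrow> x = 0)" for x using p_pos by (simp add: pabs_def)
  hence "abs_value_on (adjoin \<alpha>) (restrict pabs (adjoin \<alpha>))"
    using tri pabs_mult alg by (simp add: abs_value_on_def subring_set_add[OF sr] subring_set_mult[OF sr])
  moreover have "restrict pabs (adjoin \<alpha>) (of_rat r) = padic_abs p r" for r
  proof -
    have "of_rat r \<in> adjoin \<alpha>" using Rats_subset_subfield_set[OF K] by auto
    moreover have "pabs (of_rat r) = padic_abs p r"
    proof (cases "r = 0")
      case False
      have "real p powr (real b - real a) = real p powi (int b - int a)" for a b
        using p_pos by (simp add: powr_real_of_int'[symmetric])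
      thus ?thesis using False ord_eq[OF has_ord_of_rat[OF False]] by (simp add: pabs_def padic_abs_def)
    qed (simp add: pabs_def padic_abs_def)
    ultimately show ?thesis by simp
  qed
  ultimately show ?thesis using prime unfolding padic_places_def places_def by auto
qed

end

section \<open>Places that detect non-units, and finiteness of the nontrivial places\<close>

text \<open>In a valuation ring V excluding x some prime is not invertible: otherwise every rational
  is in V, and x, being integral over \<rat>, would be in V because V is integrally closed. The
  order of x that V defines is negative.\<close>

theorem padic_place_exists:
  assumes \<alpha>: "algebraic \<alpha>" "\<not> algebraic_int x" and x: "x \<in> adjoin \<alpha>"
  shows "\<exists>p. \<exists>v\<in>padic_places (adjoin \<alpha>) p. v x > 1"
proof -
  have nint: "\<not> integral_over \<int> x" using \<alpha> by (simp add: algebraic_int_iff_integral)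
  have x0: "x \<noteq> 0" using \<alpha>(2) by auto
  have algx: "algebraic x" by (rule algebraic_in_adjoin[OF \<alpha>(1) x])
  obtain V where V: "subring_set V" "\<int> \<subseteq> V" "x \<notin> V" "\<And>y. y \<in> V \<or> inverse y \<in> V"
    using valuation_ring_excluding[OF subring_set_Ints nint x0] by blast
  interpret valuation_ring V using V by unfold_locales auto
  have "\<exists>p. Factorial_Ring.prime p \<and> inverse (of_nat p) \<notin> V"
  proof (rule ccontr)
    assume H: "\<not> ?thesis"
    have inv: "inverse (of_nat n) \<in> V" if "n > 0" for n
      using that
    proof (induction n rule: less_induct)
      case (less n)
      show ?case
      proof (cases "n = 1")
        case False
        then obtain q where q: "Factorial_Ring.prime q" "q dvd n" using prime_factor_nat by blast
        then obtain m where m: "n = q * m" by (auto simp: dvd_def)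
        have "m < n" "m > 0" using m less.prems prime_gt_1_nat[OF q(1)] by auto
        hence "inverse (of_nat m) \<in> V" using less.IH by blast
        moreover have "inverse (of_nat q) \<in> V" using H q(1) by blast
        ultimately show ?thesis by (simp add: m V_closed)
      qed (simp add: V_closed)
    qed
    have "\<rat> \<subseteq> V"
    proof
      fix r :: complex assume "r \<in> \<rat>"
      then obtain a b where "b > 0" "r = of_int a / of_int b" by (rule Rats_cases')
      hence "r = of_int a * inverse (of_nat (nat b))" "nat b > 0" by (auto simp: divide_inverse)
      thus "r \<in> V" using inv[of "nat b"] by (simp add: V_closed)
    qed
    hence "integral_over V x" using algx integral_over_mono by (auto simp: algebraic_iff_integral)
    hence "x \<in> V" by (rule valuation_ring_integrally_closed[OF V(1,4)])
    thus False using V(3) by simp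
  qed
  then obtain p where p: "Factorial_Ring.prime p" "inverse (of_nat p) \<notin> V" by blast
  interpret padic_valuation_ring V p using p by unfold_locales
  have "ord x < 0" by (rule has_ord_neg[OF has_ord[OF algx x0] V(3)])
  hence "real p powr 0 < real p powr (- ord x)" using p_gt_1 by (intro powr_less_mono) auto
  hence "pabs x > 1" using x0 p_gt_1 by (simp add: pabs_def)
  thus ?thesis using pabs_place[OF \<alpha>(1)] x by (intro exI[of _ p] bexI[of _ "restrict pabs (adjoin \<alpha>)"]) auto
qed

text \<open>Let n be the local degree. By \<open>ramification_le_local_degree\<close> for n + 1,
  some v(x)^j with 1 \<le> j \<le> n is the value of a rational, that is p^k. Since v x \<noteq> 1,
  k is nonzero, so j |ln v(x)| \<ge> ln p \<ge> ln 2.\<close>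

lemma padic_place_lower_bound:
  assumes dim: "CR.dimension d \<rat> K" and K: "subfield_set K" and v: "v \<in> padic_places K p"
    and x: "x \<in> K" "x \<noteq> 0" "v x \<noteq> 1"
  shows "ln 2 \<le> real (local_degree K v) * \<bar>ln (v x)\<bar>"
proof -
  interpret nonarch_subfield K v by (rule padic_place_nonarch[OF v K])
  define n where "n = local_degree K v"
  have "\<exists>j r. 0 < j \<and> j < Suc n \<and> r \<in> \<rat> \<and> v x ^ j = v r"
    using ramification_le_local_degree[OF dim x(1,2), of "Suc n"] by (force simp: n_def)
  then obtain j r where j: "0 < j" "j \<le> n" "r \<in> \<rat>" "v x ^ j = v r" by auto
  have vx: "v x > 0" using pos x by blast
  obtain q where q: "r = of_rat q" using j(3) by (rule Rats_cases)
  have p: "Factorial_Ring.prime p" and vr: "v r = padic_abs p q" using v by (auto simp: padic_places_def q)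
  have "q \<noteq> 0" using j(4) vx q zero by auto
  then obtain k where k: "v r = real p powi k" using vr by (auto simp: padic_abs_def)
  have p2: "real p \<ge> 2" using prime_ge_2_nat[OF p] by simp
  have "real j * ln (v x) = ln (v x ^ j)" using vx by (simp add: ln_realpow)
  also have "\<dots> = real_of_int k * ln (real p)" using j(4) k p2 by (simp add: ln_powr flip: powr_real_of_int')
  finally have eq: "real j * ln (v x) = real_of_int k * ln (real p)" .
  have "ln (v x) \<noteq> 0" using vx x by simp
  hence "k \<noteq> 0" using eq j(1) by auto
  hence "1 * ln 2 \<le> real_of_int \<bar>k\<bar> * ln (real p)" using p2 by (intro mult_mono) auto
  also have "\<dots> = \<bar>real j * ln (v x)\<bar>" unfolding eq using p2 by (simp add: abs_mult)
  also have "\<dots> = real j * \<bar>ln (v x)\<bar>" by (simp add: abs_mult)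
  also have "\<dots> \<le> real n * \<bar>ln (v x)\<bar>" using j by (intro mult_right_mono) auto
  finally show ?thesis by (simp add: n_def)
qed

text \<open>A p-adic place is nontrivial at \<alpha> only if p divides the leading or the constant
  coefficient of an integer polynomial with root \<alpha>: the first controls \<alpha>, the second,
  through the reflected polynomial, 1/\<alpha>. Finiteness turns the infinite sum in the height into
  a finite one and bounds the supremum.\<close>

lemma finite_nontrivial_places:
  assumes \<alpha>: "algebraic \<alpha>" "\<alpha> \<noteq> 0"
  shows "finite {v \<in> places (adjoin \<alpha>). v \<alpha> \<noteq> 1}"
proof -
  note K = subfield_adjoin[OF \<alpha>(1)]
  obtain m where m: "is_minpoly \<rat> \<alpha> m" using algebraic_minpoly_exists[OF \<alpha>(1)] by blast
  have dim: "CR.dimension (degree m) \<rat> (adjoin \<alpha>)"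
    using dimension_ring_adjoin[OF subfield_set_Rats m] by (simp add: adjoin_eq[OF \<alpha>(1)])
  obtain P where P: "\<And>i. poly.coeff P i \<in> \<int>" "P \<noteq> 0" "poly P \<alpha> = 0" "poly.coeff P 0 \<noteq> 0"
  proof -
    obtain R :: "int poly" where R: "R \<noteq> 0" "poly.coeff R 0 \<noteq> 0" "poly (map_poly of_int R) \<alpha> = 0"
      using algebraicE'_nonzero[OF \<alpha>] by blast
    have "map_poly of_int R \<noteq> (0 :: complex poly)"
      using R(2) by (metis coeff_0 coeff_map_poly of_int_0 of_int_eq_0_iff)
    thus thesis using that[of "map_poly of_int R"] R by (simp add: coeff_map_poly)
  qed
  obtain a b where ab: "lead_coeff P = of_int a" "poly.coeff P 0 = of_int b"
    using P(1) by (metis Ints_cases)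
  have nz: "a * b \<noteq> 0" using P ab by auto
  have "p dvd nat \<bar>a * b\<bar>" if v: "v \<in> padic_places (adjoin \<alpha>) p" "v \<alpha> \<noteq> 1" for v p
  proof (rule ccontr)
    assume "\<not> p dvd nat \<bar>a * b\<bar>"
    hence "\<not> int p dvd a * b" by (simp add: int_dvd_int_iff[symmetric] del: int_dvd_int_iff)
    hence ndvd: "\<not> int p dvd a" "\<not> int p dvd b" by auto
    interpret nonarch_subfield "adjoin \<alpha>" v by (rule padic_place_nonarch[OF v(1) K])
    have "v (of_int c) = 1" if "\<not> int p dvd c" for c
    proof -
      have "v (of_rat (of_int c)) = padic_abs p (of_int c)" using v(1) unfolding padic_places_def by blast
      thus ?thesis using padic_abs_not_dvd[OF that] by simp
    qed
    hence v1: "v (lead_coeff P) = 1" "v (poly.coeff P 0) = 1" using ab ndvd by auto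
    have "v \<alpha> \<le> 1" by (rule integer_root_le_1[OF P(1,3,2) in_adjoin[OF \<alpha>(1)] v1(1)])
    moreover have "v (inverse \<alpha>) \<le> 1"
    proof (rule integer_root_le_1)
      show "poly.coeff (reflect_poly P) i \<in> \<int>" for i using P(1) by (simp add: coeff_reflect_poly)
      show "poly (reflect_poly P) (inverse \<alpha>) = 0" using P(3) \<alpha>(2) poly_reflect_poly_nz[of "inverse \<alpha>" P] by simp
      show "reflect_poly P \<noteq> 0" using P(2) by simp
      show "inverse \<alpha> \<in> adjoin \<alpha>" by (intro K_closed in_adjoin \<alpha>)
      show "v (lead_coeff (reflect_poly P)) = 1" using v1(2) P(4) by (simp add: degree_reflect_poly_eq coeff_reflect_poly)
    qed
    ultimately have "v \<alpha> = 1"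
      using inverse[OF in_adjoin[OF \<alpha>(1)]] pos[OF in_adjoin[OF \<alpha>(1)] \<alpha>(2)] by (simp add: inverse_le_1_iff)
    thus False using v by simp
  qed
  note p_dvd = this
  have "{v \<in> places (adjoin \<alpha>). v \<alpha> \<noteq> 1}
      \<subseteq> arch_places (adjoin \<alpha>) \<union> (\<Union>p\<in>{p. p dvd nat \<bar>a * b\<bar>}. padic_places (adjoin \<alpha>) p)"
  proof
    fix v assume "v \<in> {v \<in> places (adjoin \<alpha>). v \<alpha> \<noteq> 1}"
    hence v: "v \<in> places (adjoin \<alpha>)" "v \<alpha> \<noteq> 1" by auto
    from places_cases[OF v(1)]
    show "v \<in> arch_places (adjoin \<alpha>) \<union> (\<Union>p\<in>{p. p dvd nat \<bar>a * b\<bar>}. padic_places (adjoin \<alpha>) p)"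
    proof
      assume "\<exists>p. v \<in> padic_places (adjoin \<alpha>) p"
      then obtain p where "v \<in> padic_places (adjoin \<alpha>) p" ..
      thus ?thesis using p_dvd[of v p] v(2) by auto
    qed simp
  qed
  moreover have "finite {p. p dvd nat \<bar>a * b\<bar>}" using nz by (intro finite_divisors_nat) auto
  ultimately show ?thesis
    using finite_arch_places[OF \<alpha>(1)] finite_padic_places[OF dim K] by (auto intro: finite_subset)
qed

subsection \<open>Heights\<close>

text \<open>S may be any finite set of places containing the nontrivial ones; for units it will be
  the set of archimedean places.\<close>

lemma height_eq_sum:
  fixes p :: ereal
  assumes p: "1 \<le> p" "p \<noteq> \<infinity>"
    and S: "finite S" "S \<subseteq> places (adjoin \<alpha>)" "\<And>v. v \<in> places (adjoin \<alpha>) \<Longrightarrow> v \<notin> S \<Longrightarrow> v \<alpha> = 1"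
  shows "height p \<alpha> = (\<Sum>v\<in>S. real (local_degree (adjoin \<alpha>) v) / real (alg_degree \<alpha>)
    * \<bar>ln (v \<alpha>)\<bar> powr real_of_ereal p) powr (1 / real_of_ereal p)"
proof -
  let ?f = "\<lambda>v. real (local_degree (adjoin \<alpha>) v) / real (field_degree (adjoin \<alpha>)) * \<bar>ln (v \<alpha>)\<bar> powr real_of_ereal p"
  have "infsum ?f (places (adjoin \<alpha>)) = infsum ?f S"
  proof (rule infsum_cong_neutral)
    fix v assume "v \<in> places (adjoin \<alpha>) - S"
    hence "v \<alpha> = 1" using S(3) by blast
    thus "?f v = 0" by simp
  qed (use S(2) in auto)
  thus ?thesis using p S(1) by (simp add: height_def height_in_def alg_degree_def)
qed

text \<open>A real supremum bounds the members of a set only if the set is bounded above; by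
  \<open>finite_nontrivial_places\<close> it is finite.\<close>

lemma height_infinity_ge:
  assumes \<alpha>: "algebraic \<alpha>" "\<alpha> \<noteq> 0" and v: "v \<in> places (adjoin \<alpha>)"
  shows "\<bar>ln (v \<alpha>)\<bar> \<le> height \<infinity> \<alpha>"
proof -
  let ?f = "\<lambda>v::complex \<Rightarrow> real. \<bar>ln (v \<alpha>)\<bar>"
  have "?f ` places (adjoin \<alpha>) \<subseteq> insert 0 (?f ` {v \<in> places (adjoin \<alpha>). v \<alpha> \<noteq> 1})" by auto
  hence "finite (?f ` places (adjoin \<alpha>))"
    using finite_nontrivial_places[OF \<alpha>] by (meson finite_imageI finite_insert finite_subset)
  thus ?thesis using v unfolding height_def height_in_def
    by (auto intro!: cSUP_upper bdd_above_finite)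
qed

lemma real_of_ereal_ge_1: "1 \<le> p \<Longrightarrow> p \<noteq> \<infinity> \<Longrightarrow> 1 \<le> real_of_ereal p"
  by (cases p) auto

lemma dimension_adjoin: "algebraic \<alpha> \<Longrightarrow> CR.dimension (alg_degree \<alpha>) \<rat> (adjoin \<alpha>)"
  using algebraic_minpoly_exists[of \<alpha>] dimension_ring_adjoin[OF subfield_set_Rats, of \<alpha>]
  by (auto simp: adjoin_eq alg_degree_eq)

lemma local_degree_bounds:
  assumes "algebraic \<alpha>" "v \<in> places (adjoin \<alpha>)"
  shows "local_degree (adjoin \<alpha>) v \<le> alg_degree \<alpha>" "1 \<le> local_degree (adjoin \<alpha>) v"
  using valued_subfield.local_degree_dimension[OF place_valued[OF assms(2) subfield_adjoin[OF assms(1)]]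
      dimension_adjoin[OF assms(1)]] by auto

lemma height_nonunit:
  fixes p :: ereal
  assumes p: "1 \<le> p" and \<alpha>: "algebraic \<alpha>" "\<alpha> \<noteq> 0"
    and nonunit: "\<not> (algebraic_int \<alpha> \<and> algebraic_int (inverse \<alpha>))"
  shows "ln 2 \<le> real (alg_degree \<alpha>) * height p \<alpha>"
proof -
  note K = subfield_adjoin[OF \<alpha>(1)] and in_K = in_adjoin[OF \<alpha>(1)]
  have "\<exists>q. \<exists>v\<in>padic_places (adjoin \<alpha>) q. v \<alpha> \<noteq> 1"
  proof (cases "algebraic_int \<alpha>")
    case False
    then obtain q v where "v \<in> padic_places (adjoin \<alpha>) q" "v \<alpha> > 1"
      using padic_place_exists[OF \<alpha>(1) _ in_K] by blast
    thus ?thesis by (intro exI[of _ q] bexI[of _ v]) auto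
  next
    case True
    hence "\<not> algebraic_int (inverse \<alpha>)" using nonunit by blast
    then obtain q v where v: "v \<in> padic_places (adjoin \<alpha>) q" "v (inverse \<alpha>) > 1"
      using padic_place_exists[OF \<alpha>(1) _ subfield_set_inverse[OF K in_K]] by blast
    interpret nonarch_subfield "adjoin \<alpha>" v by (rule padic_place_nonarch[OF v(1) K])
    have "v \<alpha> \<noteq> 1" using v(2) inverse[OF in_K] by auto
    thus ?thesis using v(1) by blast
  qed
  then obtain q v where v: "v \<in> padic_places (adjoin \<alpha>) q" "v \<alpha> \<noteq> 1" by blast
  have vp: "v \<in> places (adjoin \<alpha>)" using v(1) by (simp add: padic_places_def)
  define n d a where "n = real (local_degree (adjoin \<alpha>) v)" and "d = real (alg_degree \<alpha>)" and "a = \<bar>ln (v \<alpha>)\<bar>"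
  have n: "1 \<le> n" "n \<le> d" using local_degree_bounds[OF \<alpha>(1) vp] by (auto simp: n_def d_def)
  have na: "ln 2 \<le> n * a"
    using padic_place_lower_bound[OF dimension_adjoin[OF \<alpha>(1)] K v(1) in_K \<alpha>(2) v(2)] by (simp add: n_def a_def)
  have a0: "a \<ge> 0" by (simp add: a_def)
  show ?thesis
  proof (cases "p = \<infinity>")
    case True
    have "n * a \<le> d * height \<infinity> \<alpha>"
      using height_infinity_ge[OF \<alpha> vp] n a0 by (intro mult_mono) (auto simp: a_def)
    thus ?thesis using na True by (simp add: d_def)
  next
    case False
    define P where "P = real_of_ereal p"
    have P: "P \<ge> 1" using real_of_ereal_ge_1[OF p False] by (simp add: P_def)
    define S where "S = {v \<in> places (adjoin \<alpha>). v \<alpha> \<noteq> 1}"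
    have S: "finite S" "v \<in> S" using finite_nontrivial_places[OF \<alpha>] v vp by (auto simp: S_def)
    have h: "height p \<alpha> = (\<Sum>v\<in>S. real (local_degree (adjoin \<alpha>) v) / d * \<bar>ln (v \<alpha>)\<bar> powr P) powr (1 / P)"
      unfolding d_def P_def using S(1) by (intro height_eq_sum p False) (auto simp: S_def)
    \<comment> \<open>Splitting ln 2 / d as (n/d)(ln 2 / n) lets n/d \<le> 1 shed its exponent P
      \<ge> 1, while ln 2 / n \<le> a; the result is the single term of v in the height.\<close>
    have "(ln 2 / d) powr P = (n / d * (ln 2 / n)) powr P" using n by simp
    also have "\<dots> = (n / d) powr P * (ln 2 / n) powr P" using n by (intro powr_mult)
    also have "\<dots> \<le> (n / d) powr 1 * a powr P"
      using n P na by (intro mult_mono powr_mono' powr_mono2) (auto simp: divide_le_eq mult.commute)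
    also have "\<dots> = n / d * a powr P" using n by simp
    also have "\<dots> \<le> (\<Sum>v\<in>S. real (local_degree (adjoin \<alpha>) v) / d * \<bar>ln (v \<alpha>)\<bar> powr P)"
      unfolding n_def a_def using S by (intro member_le_sum) (auto simp: d_def)
    finally have "((ln 2 / d) powr P) powr (1 / P) \<le> height p \<alpha>"
      unfolding h using P by (intro powr_mono2) auto
    hence "ln 2 / d \<le> height p \<alpha>" using P n by (simp add: powr_powr)
    thus ?thesis using n by (simp add: d_def divide_le_eq mult.commute)
  qed
qed

text \<open>This is Bernoulli's inequality for a real exponent, the tangent line at 1, deduced from
  Young's inequality with weights 1/P and 1 - 1/P.\<close>

lemma powr_ge_linear:
  fixes x P :: real
  assumes "x \<ge> 0" "P \<ge> 1"
  shows "1 + P * (x - 1) \<le> x powr P"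
proof (cases "x = 0")
  case False
  hence "x = (x powr P) powr (1 / P) * 1 powr (1 - 1 / P)" using assms by (simp add: powr_powr)
  also have "\<dots> \<le> 1 / P * x powr P + (1 - 1 / P) * 1"
    using assms False by (intro Youngs_inequality_0) auto
  finally have "P * x \<le> P * (1 / P * x powr P + (1 - 1 / P) * 1)" using assms by (intro mult_left_mono) auto
  thus ?thesis using assms by (simp add: algebra_simps)
qed (use assms in simp)

text \<open>This is Jensen's inequality for total weight card V / d, at most 1. The tangent bound at
  T, the sum of a divided by d, is added up over V; the missing weight only helps, because 1 - P
  \<le> 0.\<close>

lemma power_mean_le:
  fixes a :: "'a \<Rightarrow> real" and d P :: real
  assumes V: "finite V" "real (card V) \<le> d" "d > 0" and a: "\<And>v. v \<in> V \<Longrightarrow> a v \<ge> 0" and P: "P \<ge> 1"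
  shows "(sum a V / d) powr P \<le> (\<Sum>v\<in>V. 1 / d * a v powr P)"
proof (cases "sum a V = 0")
  case True
  thus ?thesis using V by (auto intro!: sum_nonneg)
next
  case False
  define T where "T = sum a V / d"
  have T: "T > 0" using False V sum_nonneg[of V a] a by (auto simp: T_def less_le)
  have "1 = (1 - P) + P * (sum a V / T / d)" using False V by (simp add: T_def)
  also have "\<dots> \<le> (1 - P) * (card V / d) + P * (sum a V / T / d)"
    using mult_left_mono_neg[of "card V / d" 1 "1 - P"] V P by simp
  also have "\<dots> = (\<Sum>v\<in>V. 1 / d * (1 + P * (a v / T - 1)))"
    by (simp add: sum.distrib sum_subtractf sum_distrib_left sum_divide_distrib algebra_simps add_divide_distrib diff_divide_distrib)
  also have "\<dots> \<le> (\<Sum>v\<in>V. 1 / d * (a v / T) powr P)"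
    using V T a P by (intro sum_mono mult_left_mono powr_ge_linear) auto
  also have "\<dots> = (\<Sum>v\<in>V. 1 / d * a v powr P) / T powr P"
    unfolding sum_divide_distrib using T a by (intro sum.cong) (auto simp: powr_divide)
  finally show ?thesis using T by (simp add: T_def[symmetric] le_divide_eq)
qed

lemma unit_trivial_nonarch:
  assumes \<alpha>: "algebraic_int \<alpha>" "algebraic_int (inverse \<alpha>)" "\<alpha> \<noteq> 0"
    and v: "v \<in> places (adjoin \<alpha>)" "v \<notin> arch_places (adjoin \<alpha>)"
  shows "v \<alpha> = 1"
proof -
  have alg: "algebraic \<alpha>" using \<alpha> by blast
  obtain p where "v \<in> padic_places (adjoin \<alpha>) p" using places_cases v by blast
  then interpret nonarch_subfield "adjoin \<alpha>" v by (rule padic_place_nonarch[OF _ subfield_adjoin[OF alg]])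
  show ?thesis by (rule algebraic_unit_eq_1[OF in_adjoin[OF alg] \<alpha>])
qed

lemma arch_places_subset: "arch_places K \<subseteq> places K"
  by (auto simp: arch_places_def)

text \<open>There are at most as many archimedean places as the degree, each of local degree at
  least 1, so their sum is bounded by the power mean inequality, or termwise for p = \<infinity>.
  The factor 2 accounts for two embeddings inducing the same place.\<close>

lemma arch_sum_le_height:
  fixes p :: ereal
  assumes p: "1 \<le> p" and \<alpha>: "algebraic_int \<alpha>" "algebraic_int (inverse \<alpha>)" "\<alpha> \<noteq> 0"
  shows "arch_sum (adjoin \<alpha>) \<alpha> \<le> 2 * (real (alg_degree \<alpha>) * height p \<alpha>)"
proof -
  have alg: "algebraic \<alpha>" using \<alpha> by blast
  define V d a where "V = arch_places (adjoin \<alpha>)" and "d = real (alg_degree \<alpha>)" and "a = (\<lambda>v::complex \<Rightarrow> real. \<bar>ln (v \<alpha>)\<bar>)"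
  have V: "finite V" "real (card V) \<le> d" "V \<subseteq> places (adjoin \<alpha>)"
    using finite_arch_places[OF alg] card_arch_places[OF alg] arch_places_subset by (auto simp: V_def d_def)
  have d: "d > 0" using alg_degree_pos[OF alg] by (simp add: d_def)
  have "sum a V \<le> d * height p \<alpha>"
  proof (cases "p = \<infinity>")
    case True
    \<comment> \<open>The sign of the supremum is known only when a place exists; the identity
      embedding later excludes the empty case.\<close>
    have h0: "height \<infinity> \<alpha> \<ge> 0 \<or> V = {}"
      using height_infinity_ge[OF alg \<alpha>(3)] V(3) by (meson abs_ge_zero equals0I order_trans subsetD)
    have "sum a V \<le> real (card V) * height \<infinity> \<alpha>"
      using height_infinity_ge[OF alg \<alpha>(3)] V(3) by (intro sum_bounded_above) (auto simp: a_def)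
    also have "\<dots> \<le> d * height \<infinity> \<alpha>"
    proof (cases "V = {}")
      case True
      obtain \<sigma> where "\<sigma> \<in> emb (adjoin \<alpha>)" using id_in_emb[OF subfield_adjoin[OF alg]] by blast
      thus ?thesis using True arch_places_eq[OF alg] by (auto simp: V_def)
    next
      case False
      thus ?thesis using h0 V(2) by (intro mult_right_mono) auto
    qed
    finally show ?thesis using True by simp
  next
    case False
    define P where "P = real_of_ereal p"
    have P: "P \<ge> 1" using real_of_ereal_ge_1[OF p False] by (simp add: P_def)
    have h: "height p \<alpha> = (\<Sum>v\<in>V. real (local_degree (adjoin \<alpha>) v) / d * \<bar>ln (v \<alpha>)\<bar> powr P) powr (1 / P)"
      unfolding d_def P_def using V unit_trivial_nonarch[OF \<alpha>] by (intro height_eq_sum p False) (auto simp: V_def)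
    have "(sum a V / d) powr P \<le> (\<Sum>v\<in>V. 1 / d * a v powr P)"
      by (rule power_mean_le[OF V(1,2) d _ P]) (simp add: a_def)
    also have "\<dots> \<le> (\<Sum>v\<in>V. real (local_degree (adjoin \<alpha>) v) / d * \<bar>ln (v \<alpha>)\<bar> powr P)"
      unfolding a_def using d V(3) local_degree_bounds(2)[OF alg]
      by (intro sum_mono mult_right_mono divide_right_mono) auto
    finally have "((sum a V / d) powr P) powr (1 / P) \<le> height p \<alpha>"
      unfolding h using P by (intro powr_mono2) auto
    moreover have "sum a V \<ge> 0" by (intro sum_nonneg) (simp add: a_def)
    ultimately have "sum a V / d \<le> height p \<alpha>" using P d by (simp add: powr_powr)
    thus ?thesis using d by (simp add: divide_le_eq mult.commute)
  qed
  thus ?thesis using arch_sum_le_sum_arch_places[OF alg] by (simp add: V_def d_def a_def)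
qed

text \<open>For p = 1 the height of a unit is a weighted sum over the archimedean places; their
  local degrees are at most 2, and each comes from some embedding.\<close>

lemma height_1_le_arch_sum:
  assumes \<alpha>: "algebraic_int \<alpha>" "algebraic_int (inverse \<alpha>)" "\<alpha> \<noteq> 0"
  shows "real (alg_degree \<alpha>) * height 1 \<alpha> \<le> 2 * arch_sum (adjoin \<alpha>) \<alpha>"
proof -
  have alg: "algebraic \<alpha>" using \<alpha> by blast
  note K = subfield_adjoin[OF alg]
  define V d where "V = arch_places (adjoin \<alpha>)" and "d = real (alg_degree \<alpha>)"
  have V: "finite V" "V \<subseteq> places (adjoin \<alpha>)"
    using finite_arch_places[OF alg] arch_places_subset by (auto simp: V_def)
  have d: "d > 0" using alg_degree_pos[OF alg] by (simp add: d_def)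
  have nonneg: "(\<Sum>v\<in>V. real (local_degree (adjoin \<alpha>) v) / d * \<bar>ln (v \<alpha>)\<bar>) \<ge> 0"
    using d by (intro sum_nonneg) auto
  have "height 1 \<alpha> = (\<Sum>v\<in>V. real (local_degree (adjoin \<alpha>) v) / d * \<bar>ln (v \<alpha>)\<bar> powr real_of_ereal 1) powr (1 / real_of_ereal 1)"
    unfolding d_def using V unit_trivial_nonarch[OF \<alpha>] by (intro height_eq_sum) (auto simp: V_def)
  also have "\<dots> = (\<Sum>v\<in>V. real (local_degree (adjoin \<alpha>) v) / d * \<bar>ln (v \<alpha>)\<bar>)" using nonneg by simp
  also have "\<dots> \<le> (\<Sum>v\<in>V. 2 / d * \<bar>ln (v \<alpha>)\<bar>)"
  proof (intro sum_mono mult_right_mono divide_right_mono)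
    fix v assume v: "v \<in> V"
    then obtain \<sigma> where \<sigma>: "\<sigma> \<in> emb (adjoin \<alpha>)" "v = restrict (\<lambda>x. cmod (\<sigma> x)) (adjoin \<alpha>)"
      unfolding V_def arch_places_eq[OF alg] by blast
    have "local_degree (adjoin \<alpha>) v \<le> 2"
      using v V(2) \<sigma>(2) by (intro local_degree_arch_le_2[OF dimension_adjoin[OF alg] K \<sigma>(1)]) auto
    thus "real (local_degree (adjoin \<alpha>) v) \<le> 2" by simp
  qed (use d in auto)
  also have "\<dots> = 2 * (\<Sum>v\<in>V. \<bar>ln (v \<alpha>)\<bar>) / d" by (simp add: sum_distrib_left sum_divide_distrib)
  finally have "d * height 1 \<alpha> \<le> 2 * (\<Sum>v\<in>V. \<bar>ln (v \<alpha>)\<bar>)" using d by (simp add: field_simps)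
  thus ?thesis using sum_arch_places_le[OF alg] by (simp add: V_def d_def)
qed

subsection \<open>Classes modulo torsion\<close>

lemma comm_group_alg_units: "comm_group alg_units"
proof (rule comm_groupI)
  show "\<exists>y\<in>carrier alg_units. y \<otimes>\<^bsub>alg_units\<^esub> x = \<one>\<^bsub>alg_units\<^esub>" if "x \<in> carrier alg_units" for x
    using that by (intro bexI[of _ "inverse x"]) (auto simp: alg_units_def)
qed (auto simp: alg_units_def algebraic_times)

lemma tors_algebraic_int:
  assumes "\<zeta> \<in> tors"
  shows "algebraic_int \<zeta>" "algebraic_int (inverse \<zeta>)" "\<zeta> \<noteq> 0" "inverse \<zeta> \<in> tors"
proof -
  obtain n where n: "n > 0" "\<zeta> ^ n = 1" using assms by (auto simp: tors_def)
  have root: "algebraic_int z" if z: "z ^ n = 1" for z :: complex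
  proof (rule algebraic_int.intros)
    have "degree (monom 1 n + [:-1::complex:]) = n" using n
      by (subst degree_add_eq_left) (auto simp: degree_monom_eq)
    thus "lead_coeff (monom 1 n + [:-1::complex:]) = 1" using n by (simp add: coeff_pCons split: nat.split)
    show "\<forall>i. poly.coeff (monom 1 n + [:-1::complex:]) i \<in> \<int>" by (auto simp: coeff_pCons split: nat.split)
    show "poly (monom 1 n + [:-1:]) z = 0" using z by (simp add: poly_monom)
  qed
  show "algebraic_int \<zeta>" "algebraic_int (inverse \<zeta>)"
    using root n by (auto simp: power_inverse)
  show "\<zeta> \<noteq> 0" using n by (auto simp: zero_power)
  show "inverse \<zeta> \<in> tors" using n by (auto simp: tors_def power_inverse)
qed

lemma tors_mult: "\<zeta> \<in> tors \<Longrightarrow> \<xi> \<in> tors \<Longrightarrow> \<zeta> * \<xi> \<in> tors"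
proof -
  assume "\<zeta> \<in> tors" "\<xi> \<in> tors"
  then obtain n m where "n > 0" "\<zeta> ^ n = 1" "m > 0" "\<xi> ^ m = 1" by (auto simp: tors_def)
  hence "(\<zeta> * \<xi>) ^ (n * m) = 1" by (metis mult.commute mult.right_neutral power_mult power_mult_distrib power_one)
  thus "\<zeta> * \<xi> \<in> tors" using \<open>n > 0\<close> \<open>m > 0\<close> unfolding tors_def by (metis (mono_tags, lifting) mem_Collect_eq mult_pos_pos)
qed

lemma subgroup_tors: "subgroup tors alg_units"
proof (rule group.subgroupI)
  show "group alg_units" using comm_group_alg_units by (simp add: comm_group_def)
  show "tors \<subseteq> carrier alg_units" using tors_algebraic_int by (auto simp: alg_units_def)
  have "1 \<in> tors" by (auto simp: tors_def)
  thus "tors \<noteq> {}" by blast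
  show "inv\<^bsub>alg_units\<^esub> a \<in> tors" if a: "a \<in> tors" for a
  proof -
    have "inv\<^bsub>alg_units\<^esub> a = inverse a"
      using tors_algebraic_int[OF a] comm_group_alg_units
      by (intro group.inv_equality) (auto simp: alg_units_def comm_group_def)
    thus ?thesis using tors_algebraic_int(4)[OF a] by simp
  qed
  show "a \<otimes>\<^bsub>alg_units\<^esub> b \<in> tors" if "a \<in> tors" "b \<in> tors" for a b
    using that tors_mult by (simp add: alg_units_def)
qed

lemma comm_group_alg_mod_tors: "comm_group alg_mod_tors"
proof -
  interpret G: comm_group alg_units by (rule comm_group_alg_units)
  have normal: "tors \<lhd> alg_units" by (rule G.subgroup_imp_normal[OF subgroup_tors])
  interpret Q: group alg_mod_tors
    unfolding alg_mod_tors_def by (rule normal.factorgroup_is_group[OF normal])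
  show ?thesis
  proof (rule Q.group_comm_groupI)
    fix A B assume AB: "A \<in> carrier alg_mod_tors" "B \<in> carrier alg_mod_tors"
    then obtain x y where xy: "x \<in> carrier alg_units" "y \<in> carrier alg_units"
      "A = tors #>\<^bsub>alg_units\<^esub> x" "B = tors #>\<^bsub>alg_units\<^esub> y"
      by (auto simp: alg_mod_tors_def FactGroup_def RCOSETS_def)
    show "A \<otimes>\<^bsub>alg_mod_tors\<^esub> B = B \<otimes>\<^bsub>alg_mod_tors\<^esub> A"
      using xy normal.rcos_sum[OF normal] G.m_comm[of x y] by (simp add: alg_mod_tors_def FactGroup_def)
  qed
qed

lemma class_mahler_nonneg: "class_mahler 1 D \<ge> 0"
  by (simp add: class_mahler_def class_height_def height_def height_in_def)

lemma rat_pow_1: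
  assumes "D \<in> carrier alg_mod_tors"
  shows "rat_pow D 1 = D"
proof -
  interpret Q: comm_group alg_mod_tors by (rule comm_group_alg_mod_tors)
  have "quotient_of 1 = (1, 1)" by simp
  thus ?thesis unfolding rat_pow_def using assms by (intro the_equality) auto
qed

text \<open>The representation of D as its own first power competes in the infimum, which is bounded
  below by nonnegativity.\<close>

lemma mahler_norm_le_class_mahler:
  assumes D: "D \<in> carrier alg_mod_tors"
  shows "mahler_norm 1 D \<le> class_mahler 1 D"
proof -
  interpret Q: comm_group alg_mod_tors by (rule comm_group_alg_mod_tors)
  show ?thesis
    unfolding mahler_norm_def
  proof (rule cInf_lower)
    have "D = (\<Otimes>\<^bsub>alg_mod_tors\<^esub>i\<in>{..<1::nat}. rat_pow D 1)"
      using D by (simp add: rat_pow_1 lessThan_Suc)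
    moreover have "class_mahler 1 D = (\<Sum>i<1::nat. \<bar>of_rat 1\<bar> * class_mahler 1 D)" by simp
    ultimately show "class_mahler 1 D \<in> {(\<Sum>i<n. \<bar>of_rat (r i)\<bar> * class_mahler 1 (E i)) | (n::nat) E r.
        (\<forall>i<n. E i \<in> carrier alg_mod_tors) \<and>
        D = (\<Otimes>\<^bsub>alg_mod_tors\<^esub>i\<in>{..<n}. rat_pow (E i) (r i))}"
      using D by (intro CollectI exI[of _ "1::nat"] exI[of _ "\<lambda>_. D"] exI[of _ "\<lambda>_. 1::rat"]) auto
    show "bdd_below {(\<Sum>i<n. \<bar>of_rat (r i)\<bar> * class_mahler 1 (E i)) | (n::nat) E r.
        (\<forall>i<n. E i \<in> carrier alg_mod_tors) \<and>
        D = (\<Otimes>\<^bsub>alg_mod_tors\<^esub>i\<in>{..<n}. rat_pow (E i) (r i))}"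
      by (rule bdd_belowI[of _ 0]) (auto intro!: sum_nonneg mult_nonneg_nonneg class_mahler_nonneg)
  qed
qed

text \<open>The class degree is a minimum over representatives, while the class height is taken at
  an arbitrary one, \<gamma> = \<zeta> \<beta>, whose degree may differ from that of \<beta>. The
  bound is transferred by \<open>arch_sum_tors\<close>, since the average of the logarithms is the
  same for both.\<close>

lemma class_mahler_unit_le:
  assumes \<beta>: "algebraic_int \<beta>" "algebraic_int (inverse \<beta>)" "\<beta> \<noteq> 0"
  shows "class_mahler 1 (tors #>\<^bsub>alg_units\<^esub> \<beta>) \<le> 2 * arch_sum (adjoin \<beta>) \<beta>"
proof -
  define D where "D = tors #>\<^bsub>alg_units\<^esub> \<beta>"
  have algb: "algebraic \<beta>" using \<beta> by blast
  have D: "D = (\<lambda>\<zeta>. \<zeta> * \<beta>) ` tors" by (auto simp: D_def r_coset_def alg_units_def)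
  have "1 \<in> tors" by (auto simp: tors_def)
  hence bD: "\<beta> \<in> D" unfolding D by (intro image_eqI[of _ _ 1]) auto
  define \<gamma> where "\<gamma> = (SOME \<gamma>. \<gamma> \<in> D)"
  have "\<gamma> \<in> D" unfolding \<gamma>_def using bD by (rule someI)
  then obtain \<zeta> where \<zeta>: "\<zeta> \<in> tors" "\<gamma> = \<zeta> * \<beta>" by (auto simp: D)
  note z = tors_algebraic_int[OF \<zeta>(1)]
  have \<gamma>: "algebraic_int \<gamma>" "algebraic_int (inverse \<gamma>)" "\<gamma> \<noteq> 0"
    using z \<beta> by (auto simp: \<zeta>(2) algebraic_int_times)
  have algg: "algebraic \<gamma>" using \<gamma> by blast
  have "class_degree D \<le> alg_degree \<beta>"
    unfolding class_degree_def using bD by (intro Least_le) auto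
  moreover have h0: "height 1 \<gamma> \<ge> 0" by (simp add: height_def height_in_def)
  ultimately have "class_mahler 1 D \<le> real (alg_degree \<beta>) * height 1 \<gamma>"
    by (simp add: class_mahler_def class_height_def \<gamma>_def[symmetric] mult_right_mono)
  moreover have "real (alg_degree \<beta>) * height 1 \<gamma> \<le> 2 * arch_sum (adjoin \<beta>) \<beta>"
  proof -
    define b g where "b = real (alg_degree \<beta>)" and "g = real (alg_degree \<gamma>)"
    have pos: "b > 0" "g > 0" using alg_degree_pos algb algg by (auto simp: b_def g_def)
    \<comment> \<open>Both sides are multiplied by the degree of \<gamma>, so that
      \<open>height_1_le_arch_sum\<close> applies to \<gamma> itself.\<close>
    have "g * (b * height 1 \<gamma>) = b * (g * height 1 \<gamma>)" by simp
    also have "\<dots> \<le> b * (2 * arch_sum (adjoin \<gamma>) \<gamma>)"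
      using height_1_le_arch_sum[OF \<gamma>] pos by (intro mult_left_mono) (auto simp: g_def)
    also have "\<dots> = 2 * (arch_sum (adjoin \<gamma>) \<gamma> * b)" by simp
    also have "arch_sum (adjoin \<gamma>) \<gamma> * b = arch_sum (adjoin \<beta>) \<beta> * g"
      unfolding b_def g_def using \<zeta> \<beta>(3) by (intro arch_sum_tors algb algg) auto
    finally have "g * (b * height 1 \<gamma>) \<le> g * (2 * arch_sum (adjoin \<beta>) \<beta>)" by (simp add: mult_ac)
    thus ?thesis using pos by (simp add: b_def)
  qed
  ultimately show ?thesis by (simp add: D_def)
qed

lemma reduced_class:
  assumes \<beta>: "algebraic_int \<beta>" "\<beta> \<noteq> 0" "\<beta> \<notin> tors" "reduced_rep \<beta>"
  shows "tors #>\<^bsub>alg_units\<^esub> \<beta> \<in> reduced_classes"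
proof -
  have bD: "\<beta> \<in> tors #>\<^bsub>alg_units\<^esub> \<beta>"
    by (auto simp: r_coset_def alg_units_def tors_def intro!: exI[of _ 1])
  have "\<beta> \<in> carrier alg_units" using \<beta> by (auto simp: alg_units_def)
  hence "tors #>\<^bsub>alg_units\<^esub> \<beta> \<in> carrier alg_mod_tors"
    by (auto simp: alg_mod_tors_def FactGroup_def RCOSETS_def)
  moreover have "tors #>\<^bsub>alg_units\<^esub> \<beta> \<noteq> \<one>\<^bsub>alg_mod_tors\<^esub>"
    using bD \<beta>(3) by (auto simp: alg_mod_tors_def FactGroup_def)
  ultimately show ?thesis using bD \<beta>(4) by (auto simp: reduced_classes_def)
qed

section \<open>The lower bound for all non-torsion numbers\<close>

theorem theorem2:
  assumes "\<And>p::ereal. 1 \<le> p \<Longrightarrow>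
    \<exists>c>0. \<forall>C\<in>reduced_classes. c \<le> mahler_norm p C"
  shows "\<forall>p::ereal. 1 \<le> p \<longrightarrow>
    (\<exists>c>0. \<forall>\<alpha>. algebraic \<alpha> \<and> \<alpha> \<noteq> 0 \<and> \<alpha> \<notin> tors \<longrightarrow>
       c \<le> real (alg_degree \<alpha>) * height p \<alpha>)"
proof (intro allI impI)
  fix p :: ereal assume p: "1 \<le> p"
  obtain c where c: "c > 0" "\<And>C. C \<in> reduced_classes \<Longrightarrow> c \<le> mahler_norm 1 C"
    using assms[of 1] by auto
  \<comment> \<open>The value ln 2 serves the non-units. For units, c is at most twice S(\<beta>)
    \<le> S(\<alpha>), and S(\<alpha>) is at most twice the degree times the height, whence the
    4.\<close>
  have "min (ln 2) (c / 4) \<le> real (alg_degree \<alpha>) * height p \<alpha>"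
    if \<alpha>: "algebraic \<alpha>" "\<alpha> \<noteq> 0" "\<alpha> \<notin> tors" for \<alpha>
  proof (cases "algebraic_int \<alpha> \<and> algebraic_int (inverse \<alpha>)")
    case False
    thus ?thesis using height_nonunit[OF p \<alpha>(1,2)] by (simp add: min_le_iff_disj)
  next
    case True
    obtain \<beta> where \<beta>: "algebraic_int \<beta>" "algebraic_int (inverse \<beta>)" "\<beta> \<noteq> 0" "\<beta> \<notin> tors" "reduced_rep \<beta>"
      and le: "arch_sum (adjoin \<beta>) \<beta> \<le> arch_sum (adjoin \<alpha>) \<alpha>"
      using reduced_rep_descent[OF _ _ \<alpha>(2,3)] True by blast
    let ?C = "tors #>\<^bsub>alg_units\<^esub> \<beta>"
    have C: "?C \<in> reduced_classes" by (rule reduced_class[OF \<beta>(1,3,4,5)])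
    hence "?C \<in> carrier alg_mod_tors" by (simp add: reduced_classes_def)
    hence "c \<le> class_mahler 1 ?C" using c(2)[OF C] mahler_norm_le_class_mahler by force
    also have "\<dots> \<le> 2 * arch_sum (adjoin \<beta>) \<beta>" by (rule class_mahler_unit_le[OF \<beta>(1-3)])
    also have "\<dots> \<le> 2 * arch_sum (adjoin \<alpha>) \<alpha>" using le by simp
    also have "\<dots> \<le> 2 * (2 * (real (alg_degree \<alpha>) * height p \<alpha>))"
      using arch_sum_le_height[OF p] True \<alpha>(2) by (intro mult_left_mono) auto
    finally show ?thesis by simp
  qed
  thus "\<exists>c>0. \<forall>\<alpha>. algebraic \<alpha> \<and> \<alpha> \<noteq> 0 \<and> \<alpha> \<notin> tors \<longrightarrow> c \<le> real (alg_degree \<alpha>) * height p \<alpha>"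
    using c(1) by (intro exI[of _ "min (ln 2) (c / 4)"]) auto
qed

end
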